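(* Let $\sigma$ be a simplicial triangulation of the 2-sphere $S^2$, let $X(\sigma)$ be an associated integral 2-cycle, and let $M$ be a taut filling of $X(\sigma)$. Then $K(M)$ is a flag complex.
   Context: A simplicial complex is a finite collection of finite sets (simplices) closed under taking subsets; a set of size $k+1$ is a $k$-simplex. A simplicial complex is a simplicial triangulation of a manifold $W$ if its geometric realization is homeomorphic to $W$. A simplicial complex is a flag complex if every clique in its 1-skeleton (every set of vertices pairwise joined by edges of the complex) occurs as a simplex. For a finite set $\Omega$ containing the vertices of $\sigma$, $C_k=C_k(\Delta(\Omega),\mathbf{Z})$ denotes integral oriented simplicial $k$-chains on the full simplex $\Delta(\Omega)$ (all subsets of $\Omega$). For a simplicial triangulation $\sigma$ of $S^2$, $X(\sigma)\in C_2$ is either one of the two 2-cycles obtained by coherently orienting the 2-simplices of $\sigma$, each with coefficient $\pm1$. A filling of a 2-cycle $X$ is a 3-chain $M\in C_3$ with $\partial M=X$; it is taut if its $L_1$-norm $|M|$ (sum of absolute values of coefficients) is minimal among all fillings of $X$. $K(M)$ is the simplicial complex generated by the unoriented 3-simplices on which $M$ has nonzero coefficient. *)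

theory Defs
  imports "HOL-Analysis.Analysis"
begin

definition abstract_simplicial_complex :: "'v set set \<Rightarrow> bool" where
  "abstract_simplicial_complex K \<longleftrightarrow>
     finite K \<and> (\<forall>s\<in>K. finite s) \<and> (\<forall>s\<in>K. \<forall>t. t \<subseteq> s \<longrightarrow> t \<in> K)"

(* Points are given by barycentric coordinates. The topology is the one induced from the
   product topology on 'v => real; on a finite complex, where all but finitely many
   coordinates vanish identically, this is the Euclidean one. *)
definition geometric_realization :: "'v set set \<Rightarrow> ('v \<Rightarrow> real) set" where
  "geometric_realization K =
     {f. (\<forall>v. 0 \<le> f v) \<and> {v. f v \<noteq> 0} \<in> K \<and> (\<Sum>v | f v \<noteq> 0. f v) = 1}"

definition simplicial_triangulation :: "'v set set \<Rightarrow> 'b::topological_space set \<Rightarrow> bool" where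
  "simplicial_triangulation K W \<longleftrightarrow>
     abstract_simplicial_complex K \<and> geometric_realization K homeomorphic W"

definition flag_complex :: "'v set set \<Rightarrow> bool" where
  "flag_complex K \<longleftrightarrow> abstract_simplicial_complex K \<and>
     (\<forall>s. s \<subseteq> \<Union>K \<and> (\<forall>u\<in>s. \<forall>v\<in>s. u \<noteq> v \<longrightarrow> {u, v} \<in> K) \<longrightarrow> s \<in> K)"

(* Integral oriented k-chains on the full simplex with vertex set \<Omega>. A chain c is encoded as
   an alternating function: c [v0, ..., vk] is the coefficient of c at the oriented simplex
   [v0, ..., vk], so reordering the vertices multiplies it by the sign of the permutation. *)
definition chains :: "'v set \<Rightarrow> nat \<Rightarrow> ('v list \<Rightarrow> int) set" where
  "chains \<Omega> k =
     {c. (\<forall>xs. c xs \<noteq> 0 \<longrightarrow> length xs = k + 1 \<and> distinct xs \<and> set xs \<subseteq> \<Omega>) \<and>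
         (\<forall>xs p. p permutes {..<length xs} \<longrightarrow> c (permute_list p xs) = sign p * c xs)}"

(* The usual boundary, the sum over i of (-1)^i [v0, ..., vi omitted, ..., vk], read off
   coefficientwise: the oriented simplices having [y1, ..., yk] as a face with sign +1 are
   exactly the [v, y1, ..., yk]. Terms with v among the yi vanish, as chains are supported
   on distinct lists. *)
definition boundary :: "'v set \<Rightarrow> ('v list \<Rightarrow> int) \<Rightarrow> 'v list \<Rightarrow> int" where
  "boundary \<Omega> c = (\<lambda>ys. \<Sum>v\<in>\<Omega>. c (v # ys))"

(* The choice of an ordering of s is immaterial for chains, by the sign rule. *)
definition abs_coeff :: "('v list \<Rightarrow> int) \<Rightarrow> 'v set \<Rightarrow> int" where
  "abs_coeff c s = \<bar>c (SOME xs. distinct xs \<and> set xs = s)\<bar>"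

definition l1_norm :: "'v set \<Rightarrow> nat \<Rightarrow> ('v list \<Rightarrow> int) \<Rightarrow> int" where
  "l1_norm \<Omega> k c = (\<Sum>s | s \<subseteq> \<Omega> \<and> card s = k + 1. abs_coeff c s)"

(* Each 2-simplex of \<sigma> is given one of its two orientations, with coefficient 1. That these
   orientations are coherent (the two triangles at an edge induce opposite orientations on
   it) is expressed by X being a cycle. *)
definition associated_cycle :: "'v set \<Rightarrow> 'v set set \<Rightarrow> ('v list \<Rightarrow> int) \<Rightarrow> bool" where
  "associated_cycle \<Omega> \<sigma> X \<longleftrightarrow>
     X \<in> chains \<Omega> 2 \<and>
     (\<forall>xs. distinct xs \<and> length xs = 3 \<longrightarrow> \<bar>X xs\<bar> = (if set xs \<in> \<sigma> then 1 else 0)) \<and>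
     boundary \<Omega> X = (\<lambda>_. 0)"

definition filling :: "'v set \<Rightarrow> ('v list \<Rightarrow> int) \<Rightarrow> ('v list \<Rightarrow> int) \<Rightarrow> bool" where
  "filling \<Omega> X M \<longleftrightarrow> M \<in> chains \<Omega> 3 \<and> boundary \<Omega> M = X"

definition taut_filling :: "'v set \<Rightarrow> ('v list \<Rightarrow> int) \<Rightarrow> ('v list \<Rightarrow> int) \<Rightarrow> bool" where
  "taut_filling \<Omega> X M \<longleftrightarrow>
     filling \<Omega> X M \<and> (\<forall>N. filling \<Omega> X N \<longrightarrow> l1_norm \<Omega> 3 M \<le> l1_norm \<Omega> 3 N)"

definition support_complex :: "('v list \<Rightarrow> int) \<Rightarrow> 'v set set" where
  "support_complex M = {t. \<exists>xs. M xs \<noteq> 0 \<and> t \<subseteq> set xs}"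

end

theory Submission
  imports Defs "HOL-Combinatorics.Multiset_Permutations"
begin

text \<open>Taut fillings split: if X = Y + Z for cycles supported on vertex sets A and B with three common
  vertices, then every taut filling of X is a sum of taut fillings of Y and Z. To see this, push
  the filling forward along retractions onto A and B that collapse to two different common vertices.
  Consequently a taut filling has no interior vertices, and it splits along every triangle of edges of
  the sphere that is not a face.

  The rest is an induction on the norm. A sphere whose triangles of edges are all faces has, by
  comparing the filling with a cone from a vertex, several tetrahedra in its filling that contain two
  of its faces; removing one of them is a bistellar flip of the sphere, or deletes a tetrahedral component.
  The class of spheres is described homologically (each edge lies in two triangles, links are
  connected, the first cohomology vanishes), so that it is visibly stable under flips and splittings.
  A flip destroys at most the edge shared by its two faces. A triangle of edges of the filling thus survives some
  flip, because at most two of its three edges lie on the sphere while the surplus of such tetrahedra is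
  at least three. So triangles of edges are filled, and then larger cliques are too.\<close>

section \<open>Alternating chains\<close>

text \<open>Behind the surplus stands one pairing. Weight each tetrahedron of a filling
  \<open>M\<close> of \<open>X\<close> by its coefficient times its signed number of faces on the
  sphere. The total is the pairing of \<open>boundary \<Omega> M = X\<close> with \<open>X\<close>,
  that is the number F of faces, since the coefficients of \<open>X\<close> on its faces are 1 or
  -1. A cone from a vertex v needs only the F - deg v faces away from v, so a taut \<open>M\<close>
  has norm at most F - deg v, and the difference of the two counts is at least deg v, hence at least
  3. Sums run over ordered tuples: a tetrahedron counts 24 times, a triangle 6 times.

  A flip is legitimate only if the edge to be created is absent. This is why the sphere is cut along
  its empty triangles first: afterwards an edge already present forces all four faces of the
  tetrahedron.

  Point-set topology enters only in the last section: connected open sets of a punctured sphere have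
  no cut points, invariance of domain allows at most two triangles at an edge, and circle-valued
  maps on the sphere lift, which makes the first cohomology vanish.\<close>

definition tuples :: "'v set \<Rightarrow> nat \<Rightarrow> 'v list set" where
  "tuples \<Omega> n = {xs. length xs = n \<and> set xs \<subseteq> \<Omega>}"

lemma finite_tuples: "finite \<Omega> \<Longrightarrow> finite (tuples \<Omega> n)"
  using finite_lists_length_eq[of \<Omega> n] by (simp add: tuples_def conj_commute)

lemma chains_supp:
  assumes "c \<in> chains \<Omega> k" "c xs \<noteq> 0"
  shows "length xs = k + 1" "distinct xs" "set xs \<subseteq> \<Omega>"
  using assms by (auto simp: chains_def)

lemma chains_permute:
  assumes "c \<in> chains \<Omega> k" "p permutes {..<length xs}"
  shows "c (permute_list p xs) = sign p * c xs"
  using assms by (simp add: chains_def)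

lemma permute_list_transpose:
  assumes "i < length xs" "j < length xs"
  shows "permute_list (Transposition.transpose i j) xs = xs[i := xs ! j, j := xs ! i]"
  using assms by (intro nth_equalityI)
    (auto simp: permute_list_def Transposition.transpose_def nth_list_update)

lemma chains_swap:
  assumes "c \<in> chains \<Omega> k" "i < j" "j < length xs"
  shows "c (xs[i := xs ! j, j := xs ! i]) = - c xs"
proof -
  have "Transposition.transpose i j permutes {..<length xs}"
    using assms by (intro permutes_swap_id) auto
  from chains_permute[OF assms(1) this] show ?thesis
    using assms by (simp add: permute_list_transpose sign_swap_id)
qed

text \<open>Distinctness of the support comes for free: exchanging two equal entries fixes the list,
  so the swap rule gives \<open>c xs = - c xs\<close>. The full sign rule follows because
  transpositions generate all permutations.\<close>

lemma chainsI:
  assumes supp: "\<And>xs. c xs \<noteq> 0 \<Longrightarrow> length xs = k + 1 \<and> set xs \<subseteq> \<Omega>"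
    and swap: "\<And>xs i j. i < j \<Longrightarrow> j < length xs \<Longrightarrow> c (xs[i := xs ! j, j := xs ! i]) = - c xs"
  shows "c \<in> chains \<Omega> k"
proof -
  have dist: "distinct xs" if "c xs \<noteq> 0" for xs
  proof (rule ccontr)
    assume "\<not> distinct xs"
    then obtain i j where ij: "i < j" "j < length xs" "xs ! i = xs ! j"
      by (metis distinct_conv_nth linorder_neqE_nat)
    then have "xs[i := xs ! j, j := xs ! i] = xs"
      by (metis list_update_id)
    with swap[OF ij(1,2)] that show False by simp
  qed
  have swap': "c (permute_list (Transposition.transpose i j) xs) = - c xs"
    if "i \<noteq> j" "i < length xs" "j < length xs" for i j xs
  proof (cases "i < j")
    case True
    then show ?thesis using swap that by (simp add: permute_list_transpose)
  next
    case False
    then show ?thesis using swap[of j i xs] that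
      by (simp add: permute_list_transpose Transposition.transpose_commute[of i j])
  qed
  have "c (permute_list p xs) = sign p * c xs" if "p permutes {..<length xs}" for p xs
  proof -
    \<comment> \<open>Generalised over \<open>xs\<close>, since the induction applies its hypothesis
      to the list already permuted by the transposition.\<close>
    have "\<forall>xs. length xs = n \<longrightarrow> c (permute_list p xs) = sign p * c xs"
      if "p permutes {..<n}" for n
      using that finite_lessThan[of n]
    proof (induction p rule: permutes_induct)
      case id
      then show ?case by simp
    next
      case (swap a b p)
      show ?case
      proof (intro allI impI)
        fix xs :: "'a list" assume len: "length xs = n"
        have "permutation p"
          using swap.hyps(4) permutation_permutes by blast
        then have s: "sign (Transposition.transpose a b \<circ> p) = - sign p"
          using swap.hyps(3) by (simp add: sign_compose permutation_swap_id sign_swap_id)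
        have "permute_list (Transposition.transpose a b \<circ> p) xs = permute_list p (permute_list (Transposition.transpose a b) xs)"
          using swap.hyps len by (intro permute_list_compose) auto
        moreover have "c (permute_list p (permute_list (Transposition.transpose a b) xs))
            = sign p * c (permute_list (Transposition.transpose a b) xs)"
          using swap.hyps len swap.IH by simp
        ultimately show "c (permute_list (Transposition.transpose a b \<circ> p) xs) = sign (Transposition.transpose a b \<circ> p) * c xs"
          using swap'[of a b xs] swap.hyps len s by simp
      qed
    qed
    then show ?thesis using that by blast
  qed
  then show ?thesis using supp dist by (auto simp: chains_def)
qed

lemma chains2_swap:
  assumes "X \<in> chains \<Omega> 2"
  shows "X [v,u,w] = - X [u,v,w]" "X [u,w,v] = - X [u,v,w]" "X [w,v,u] = - X [u,v,w]"
    "X [v,w,u] = X [u,v,w]" "X [w,u,v] = X [u,v,w]"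
proof -
  show a: "X [v,u,w] = - X [u,v,w]" for u v w
    using chains_swap[OF assms, of 0 1 "[u,v,w]"] by simp
  show b: "X [u,w,v] = - X [u,v,w]" for u v w
    using chains_swap[OF assms, of 1 2 "[u,v,w]"] by simp
  show "X [w,v,u] = - X [u,v,w]" "X [v,w,u] = X [u,v,w]" "X [w,u,v] = X [u,v,w]"
    using a[of v w u] a[of w u v] a[of u v w] b[of v u w] b[of u v w] a[of u w v] by linarith+
qed

lemma chains3_swap:
  assumes "M \<in> chains \<Omega> 3"
  shows "M [b,a,c,d] = - M [a,b,c,d]" "M [a,c,b,d] = - M [a,b,c,d]" "M [a,b,d,c] = - M [a,b,c,d]"
  using chains_swap[OF assms, of 0 1 "[a,b,c,d]"] chains_swap[OF assms, of 1 2 "[a,b,c,d]"]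
    chains_swap[OF assms, of 2 3 "[a,b,c,d]"]
  by simp_all

lemma length_3E:
  assumes "length xs = 3" obtains a b c where "xs = [a,b,c]"
  using assms by (auto simp: numeral_eq_Suc length_Suc_conv)

lemma length_4E:
  assumes "length xs = 4" obtains a b c d where "xs = [a,b,c,d]"
  using assms by (auto simp: numeral_eq_Suc length_Suc_conv)

text \<open>Adjacent transpositions generate the others; the three remaining swaps are conjugates of
  them, computed in \<open>t1\<close>, \<open>t2\<close> and \<open>t3\<close>.\<close>

lemma chains3I:
  assumes supp: "\<And>xs. M xs \<noteq> 0 \<Longrightarrow> length xs = 4 \<and> set xs \<subseteq> \<Omega>"
    and s1: "\<And>a b c d. M [b,a,c,d] = - M [a,b,c,d]"
    and s2: "\<And>a b c d. M [a,c,b,d] = - M [a,b,c,d]"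
    and s3: "\<And>a b c d. M [a,b,d,c] = - M [a,b,c,d]"
  shows "M \<in> chains \<Omega> 3"
proof (rule chainsI)
  fix xs :: "'a list" and i j :: nat assume ij: "i < j" "j < length xs"
  show "M (xs[i := xs ! j, j := xs ! i]) = - M xs"
  proof (cases "length xs = 4")
    case False
    then have "M xs = 0" "M (xs[i := xs ! j, j := xs ! i]) = 0"
      using supp[of xs] supp[of "xs[i := xs ! j, j := xs ! i]"] by (metis, metis length_list_update)
    then show ?thesis by simp
  next
    case True
    then obtain a b c d where xs: "xs = [a,b,c,d]" by (rule length_4E)
    have t1: "M [c,b,a,d] = - M [a,b,c,d]"
      using s1[of c b a d] s2[of b c a d] s1[of b a c d] by linarith
    have t2: "M [a,d,c,b] = - M [a,b,c,d]"
      using s2[of a d c b] s3[of a c d b] s2[of a c b d] by linarith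
    have "M [d,b,c,a] = - M [b,d,c,a]" using s1[of d b c a] by simp
    also have "M [b,d,c,a] = - M [b,a,c,d]"
      using s2[of b d c a] s3[of b c d a] s2[of b c a d] by linarith
    finally have t3: "M [d,b,c,a] = - M [a,b,c,d]" using s1[of a b c d] by simp
    have "(i,j) \<in> {(0,1),(0,2),(0,3),(1,2),(1,3),(2,3)}"
      using ij True by auto
    then show ?thesis using t1 t2 t3 s1[of a b c d] s2[of a b c d] s3[of a b c d] xs
      by (auto simp: numeral_eq_Suc)
  qed
qed (use supp in auto)

lemma chains_add:
  assumes "c \<in> chains \<Omega> k" "d \<in> chains \<Omega> k"
  shows "(\<lambda>xs. c xs + d xs) \<in> chains \<Omega> k"
proof (rule chainsI)
  fix xs assume "c xs + d xs \<noteq> 0"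
  then have "c xs \<noteq> 0 \<or> d xs \<noteq> 0" by auto
  then show "length xs = k + 1 \<and> set xs \<subseteq> \<Omega>" using chains_supp assms by metis
qed (simp add: chains_swap[OF assms(1)] chains_swap[OF assms(2)])

lemma chains_diff:
  assumes "c \<in> chains \<Omega> k" "d \<in> chains \<Omega> k"
  shows "(\<lambda>xs. c xs - d xs) \<in> chains \<Omega> k"
proof (rule chainsI)
  fix xs assume "c xs - d xs \<noteq> 0"
  then have "c xs \<noteq> 0 \<or> d xs \<noteq> 0" by auto
  then show "length xs = k + 1 \<and> set xs \<subseteq> \<Omega>" using chains_supp assms by metis
qed (simp add: chains_swap[OF assms(1)] chains_swap[OF assms(2)])

lemma chains_restrict:
  assumes "c \<in> chains \<Omega> k"
  shows "(\<lambda>xs. if P (set xs) then c xs else 0) \<in> chains \<Omega> k"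
proof (rule chainsI)
  fix xs :: "'a list" and i j assume ij: "i < j" "j < length xs"
  then show "(if P (set (xs[i := xs ! j, j := xs ! i])) then c (xs[i := xs ! j, j := xs ! i]) else 0) =
     - (if P (set xs) then c xs else 0)"
    by (simp add: chains_swap[OF assms] set_swap)
next
  fix xs assume "(if P (set xs) then c xs else 0) \<noteq> 0"
  then have "c xs \<noteq> 0" by (auto split: if_splits)
  then show "length xs = k + 1 \<and> set xs \<subseteq> \<Omega>" using chains_supp[OF assms] by auto
qed

lemma chains_boundary:
  assumes "c \<in> chains \<Omega> (Suc k)"
  shows "boundary \<Omega> c \<in> chains \<Omega> k"
proof (rule chainsI)
  fix xs assume "boundary \<Omega> c xs \<noteq> 0"
  then obtain v where "v \<in> \<Omega>" "c (v # xs) \<noteq> 0"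
    unfolding boundary_def by (meson sum.not_neutral_contains_not_neutral)
  then show "length xs = k + 1 \<and> set xs \<subseteq> \<Omega>" using chains_supp[OF assms, of "v # xs"] by auto
next
  fix xs :: "'a list" and i j assume ij: "i < j" "j < length xs"
  have "c (v # xs[i := xs ! j, j := xs ! i]) = - c (v # xs)" for v
    using chains_swap[OF assms, of "Suc i" "Suc j" "v # xs"] ij by simp
  then show "boundary \<Omega> c (xs[i := xs ! j, j := xs ! i]) = - boundary \<Omega> c xs"
    by (simp add: boundary_def sum_negf)
qed

lemma boundary_add: "boundary \<Omega> (\<lambda>xs. c xs + d xs) = (\<lambda>xs. boundary \<Omega> c xs + boundary \<Omega> d xs)"
  by (simp add: boundary_def sum.distrib)

lemma boundary_diff: "boundary \<Omega> (\<lambda>xs. c xs - d xs) = (\<lambda>xs. boundary \<Omega> c xs - boundary \<Omega> d xs)"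
  by (simp add: boundary_def sum_subtractf)

lemma boundary_nz:
  assumes "boundary \<Omega> c xs \<noteq> 0"
  obtains v where "v \<in> \<Omega>" "c (v # xs) \<noteq> 0"
  using assms unfolding boundary_def by (meson sum.not_neutral_contains_not_neutral)

lemma boundary_boundary3:
  assumes "c \<in> chains \<Omega> 3"
  shows "boundary \<Omega> (boundary \<Omega> c) = (\<lambda>_. 0)"
proof
  fix ys
  have sw: "c (u # v # ys) = - c (v # u # ys)" for u v
    using chains_swap[OF assms, of 0 1 "v # u # ys"] by simp
  have "(\<Sum>v\<in>\<Omega>. \<Sum>u\<in>\<Omega>. c (u # v # ys)) = (\<Sum>v\<in>\<Omega>. \<Sum>u\<in>\<Omega>. - c (v # u # ys))"
    by (intro sum.cong refl sw)
  also have "\<dots> = - (\<Sum>v\<in>\<Omega>. \<Sum>u\<in>\<Omega>. c (v # u # ys))" by (simp only: sum_negf)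
  also have "(\<Sum>v\<in>\<Omega>. \<Sum>u\<in>\<Omega>. c (v # u # ys)) = (\<Sum>v\<in>\<Omega>. \<Sum>u\<in>\<Omega>. c (u # v # ys))"
    by (rule sum.swap)
  finally show "boundary \<Omega> (boundary \<Omega> c) ys = 0"
    by (simp add: boundary_def)
qed

subsection \<open>Single simplices\<close>

text \<open>The elementary chain of one oriented simplex. For distinct \<open>xs\<close> the
  permutation under \<open>SOME\<close> is unique by \<open>permute_list_inj\<close>, so no real
  choice is made.\<close>

definition osimplex :: "'v list \<Rightarrow> 'v list \<Rightarrow> int" where
  "osimplex xs ys = (if \<exists>p. p permutes {..<length xs} \<and> ys = permute_list p xs
     then sign (SOME p. p permutes {..<length xs} \<and> ys = permute_list p xs) else 0)"

lemma permute_list_inj: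
  assumes "distinct xs" "p permutes {..<length xs}" "q permutes {..<length xs}"
    "permute_list p xs = permute_list q xs"
  shows "p = q"
proof
  fix i show "p i = q i"
  proof (cases "i < length xs")
    case True
    then have "xs ! p i = xs ! q i"
      using assms permute_list_nth[OF assms(2) True] permute_list_nth[OF assms(3) True] by simp
    moreover have "p i < length xs" "q i < length xs"
      using True assms permutes_in_image by fastforce+
    ultimately show ?thesis using assms(1) nth_eq_iff_index_eq by blast
  next
    case False
    then show ?thesis using assms(2,3) by (simp add: permutes_def)
  qed
qed

lemma osimplex_permute:
  assumes "distinct xs" "p permutes {..<length xs}"
  shows "osimplex xs (permute_list p xs) = sign p"
proof -
  have "(SOME q. q permutes {..<length xs} \<and> permute_list p xs = permute_list q xs) = p"
    using assms permute_list_inj[OF assms(1)] by (intro some_equality) auto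
  then show ?thesis using assms by (auto simp: osimplex_def)
qed

lemma osimplex_self: "distinct xs \<Longrightarrow> osimplex xs xs = 1"
  using osimplex_permute[of xs id] by (simp add: permutes_id)

lemma osimplex_zero: 
  assumes "osimplex xs ys \<noteq> 0"
  shows "set ys = set xs" "length ys = length xs"
proof -
  obtain p where "p permutes {..<length xs} \<and> ys = permute_list p xs"
    using assms by (auto simp: osimplex_def split: if_splits)
  then show "set ys = set xs" "length ys = length xs" by auto
qed

lemma permute_list_exists:
  assumes "distinct xs" "distinct ys" "set xs = set ys"
  obtains p where "p permutes {..<length xs}" "permute_list p xs = ys"
proof -
  have "mset ys = mset xs" using assms by (metis set_eq_iff_mset_eq_distinct)
  then show ?thesis using that mset_eq_permutation by metis
qed

lemma osimplex_abs:
  assumes "distinct xs" "distinct ys" "set xs = set ys"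
  shows "\<bar>osimplex xs ys\<bar> = 1"
proof -
  obtain p where "p permutes {..<length xs}" "permute_list p xs = ys"
    using permute_list_exists[OF assms] .
  then show ?thesis using osimplex_permute[OF assms(1)] by (auto simp: sign_def)
qed

lemma osimplex_chain:
  assumes "distinct xs" "length xs = Suc k" "set xs \<subseteq> \<Omega>"
  shows "osimplex xs \<in> chains \<Omega> k"
proof (rule chainsI)
  fix ys assume "osimplex xs ys \<noteq> 0"
  then show "length ys = k + 1 \<and> set ys \<subseteq> \<Omega>" using osimplex_zero[of xs ys] assms by simp
next
  fix ys :: "'a list" and i j assume ij: "i < j" "j < length ys"
  have eq: "ys[i := ys ! j, j := ys ! i] = permute_list (Transposition.transpose i j) ys"
    using ij by (simp add: permute_list_transpose)
  have t: "Transposition.transpose i j permutes {..<length ys}" using ij by (intro permutes_swap_id) auto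
  show "osimplex xs (ys[i := ys ! j, j := ys ! i]) = - osimplex xs ys"
  proof (cases "distinct ys \<and> set ys = set xs")
    case True
    then obtain p where p: "p permutes {..<length xs}" "permute_list p xs = ys"
      using permute_list_exists assms by metis
    then have len: "length ys = length xs" by auto
    have "permute_list (p \<circ> Transposition.transpose i j) xs = permute_list (Transposition.transpose i j) ys"
      using p t len by (simp add: permute_list_compose)
    moreover have "p \<circ> Transposition.transpose i j permutes {..<length xs}"
      using p t len by (simp add: permutes_compose)
    moreover have "permutation p" using p permutation_permutes by blast
    ultimately show ?thesis
      using osimplex_permute[OF assms(1), of p] osimplex_permute[OF assms(1), of "p \<circ> Transposition.transpose i j"] p ij eq
      by (simp add: sign_compose permutation_swap_id sign_swap_id)
  next
    case False
    have "\<not> (distinct (ys[i := ys ! j, j := ys ! i]) \<and> set (ys[i := ys ! j, j := ys ! i]) = set xs)"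
      using False ij by (metis eq t set_permute_list distinct_permute_list)
    moreover have "osimplex xs zs = 0" if "\<not> (distinct zs \<and> set zs = set xs)" for zs
    proof (rule ccontr)
      assume "osimplex xs zs \<noteq> 0"
      then obtain p where "p permutes {..<length xs}" "zs = permute_list p xs"
        by (auto simp: osimplex_def split: if_splits)
      with that assms show False by (simp add: distinct_permute_list)
    qed
    ultimately show ?thesis using False by simp
  qed
qed

subsection \<open>Norms as sums over tuples\<close>

lemma card_orderings:
  assumes "finite S" "\<And>s. s \<in> S \<Longrightarrow> finite s \<and> card s = n"
  shows "card {xs. distinct xs \<and> set xs \<in> S} = fact n * card S"
    and "finite {xs. distinct xs \<and> set xs \<in> S}"
proof -
  have eq: "{xs. distinct xs \<and> set xs \<in> S} = (\<Union>s\<in>S. permutations_of_set s)"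
    by (auto simp: permutations_of_set_def)
  show "finite {xs. distinct xs \<and> set xs \<in> S}"
    unfolding eq using assms by auto
  have "card (\<Union>s\<in>S. permutations_of_set s) = (\<Sum>s\<in>S. card (permutations_of_set s))"
    using assms by (intro card_UN_disjoint) (auto dest: permutations_of_setD)
  also have "\<dots> = fact n * card S" using assms by simp
  finally show "card {xs. distinct xs \<and> set xs \<in> S} = fact n * card S" by (simp add: eq)
qed

lemma abs_coeff_eq:
  assumes "c \<in> chains \<Omega> k" "distinct xs"
  shows "abs_coeff c (set xs) = \<bar>c xs\<bar>"
proof -
  define ys where "ys = (SOME ys. distinct ys \<and> set ys = set xs)"
  have ys: "distinct ys \<and> set ys = set xs"
    unfolding ys_def by (rule someI[of _ xs]) (use assms in simp)
  obtain p where "p permutes {..<length xs}" "permute_list p xs = ys"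
    using permute_list_exists[of xs ys] assms ys by metis
  then have "c ys = sign p * c xs" using chains_permute[OF assms(1)] by metis
  then show ?thesis unfolding abs_coeff_def ys_def[symmetric] by (simp add: abs_mult sign_def)
qed

lemma chains_abs_perm:
  assumes "c \<in> chains \<Omega> k" "set xs = set ys" "length xs = length ys" "distinct ys"
  shows "\<bar>c xs\<bar> = \<bar>c ys\<bar>"
proof -
  have "distinct xs" using assms by (metis card_distinct distinct_card)
  then show ?thesis using abs_coeff_eq[OF assms(1)] assms by metis
qed

text \<open>The (k + 1)! orderings of a set share one absolute value, and lists with repetitions
  contribute 0.\<close>

lemma l1_norm_tuples:
  assumes "finite \<Omega>" "c \<in> chains \<Omega> k"
  shows "fact (k + 1) * l1_norm \<Omega> k c = (\<Sum>xs\<in>tuples \<Omega> (k + 1). \<bar>c xs\<bar>)"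
proof -
  define S where "S = {s. s \<subseteq> \<Omega> \<and> card s = k + 1}"
  have fS: "finite S" unfolding S_def using assms(1) by simp
  have fs: "finite s \<and> card s = k + 1" if "s \<in> S" for s
    using that assms(1) finite_subset by (auto simp: S_def)
  have "(\<Sum>xs\<in>tuples \<Omega> (k + 1). \<bar>c xs\<bar>) = (\<Sum>xs\<in>(\<Union>s\<in>S. permutations_of_set s). \<bar>c xs\<bar>)"
  proof (rule sum.mono_neutral_right[OF finite_tuples[OF assms(1)]])
    show "(\<Union>s\<in>S. permutations_of_set s) \<subseteq> tuples \<Omega> (k + 1)"
      by (auto simp: S_def tuples_def permutations_of_set_def distinct_card)
    show "\<forall>xs\<in>tuples \<Omega> (k + 1) - (\<Union>s\<in>S. permutations_of_set s). \<bar>c xs\<bar> = 0"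
      using chains_supp[OF assms(2)] by (fastforce simp: S_def permutations_of_set_def distinct_card)
  qed
  also have "\<dots> = (\<Sum>s\<in>S. \<Sum>xs\<in>permutations_of_set s. \<bar>c xs\<bar>)"
    using fS fs by (intro sum.UNION_disjoint) (auto dest: permutations_of_setD)
  also have "\<dots> = (\<Sum>s\<in>S. fact (k + 1) * abs_coeff c s)"
  proof (rule sum.cong[OF refl])
    fix s assume s: "s \<in> S"
    have "(\<Sum>xs\<in>permutations_of_set s. \<bar>c xs\<bar>) = (\<Sum>xs\<in>permutations_of_set s. abs_coeff c s)"
      using abs_coeff_eq[OF assms(2)] by (intro sum.cong) (auto simp: permutations_of_set_def)
    also have "\<dots> = fact (k + 1) * abs_coeff c s"
      using fs[OF s] by (simp add: algebra_simps)
    finally show "(\<Sum>xs\<in>permutations_of_set s. \<bar>c xs\<bar>) = fact (k + 1) * abs_coeff c s" .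
  qed
  finally show ?thesis by (simp add: l1_norm_def S_def sum_distrib_left)
qed

section \<open>Taut chains and splitting\<close>

text \<open>On 3-chains this is 24 times the L1-norm. Summing over ordered tuples avoids choosing
  orderings and unfolds into iterated sums over \<Omega>.\<close>

definition mass :: "'v set \<Rightarrow> ('v list \<Rightarrow> int) \<Rightarrow> int" where
  "mass \<Omega> c = (\<Sum>xs\<in>tuples \<Omega> 4. \<bar>c xs\<bar>)"

text \<open>Refers to the chain's own boundary, so that a piece of a taut chain can be called taut
  before it is known what the piece fills.\<close>

definition taut :: "'v set \<Rightarrow> ('v list \<Rightarrow> int) \<Rightarrow> bool" where
  "taut \<Omega> M \<longleftrightarrow> M \<in> chains \<Omega> 3 \<and>
     (\<forall>N\<in>chains \<Omega> 3. boundary \<Omega> N = boundary \<Omega> M \<longrightarrow> mass \<Omega> M \<le> mass \<Omega> N)"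

lemma chains3_tuples: "M \<in> chains \<Omega> 3 \<Longrightarrow> M xs \<noteq> 0 \<Longrightarrow> xs \<in> tuples \<Omega> 4"
  using chains_supp[of M \<Omega> 3 xs] by (simp add: tuples_def)

lemma mass_nonneg: "0 \<le> mass \<Omega> c"
  by (simp add: mass_def sum_nonneg)

lemma mass_zero:
  assumes "finite \<Omega>" "c \<in> chains \<Omega> 3" "mass \<Omega> c \<le> 0"
  shows "c xs = 0"
proof (rule ccontr)
  assume "c xs \<noteq> 0"
  then have "xs \<in> tuples \<Omega> 4" using assms chains3_tuples by metis
  then have "\<bar>c xs\<bar> \<le> mass \<Omega> c"
    unfolding mass_def using finite_tuples[OF assms(1)] by (intro member_le_sum) auto
  then show False using assms(3) \<open>c xs \<noteq> 0\<close> by simp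
qed

lemma taut_zero:
  assumes "finite \<Omega>" "taut \<Omega> M" "boundary \<Omega> M = (\<lambda>_. 0)"
  shows "M xs = 0"
proof (rule mass_zero[OF assms(1)])
  show "M \<in> chains \<Omega> 3" using assms by (simp add: taut_def)
  have "(\<lambda>_. 0) \<in> chains \<Omega> 3" by (simp add: chains_def)
  moreover have "boundary \<Omega> (\<lambda>_. 0) = boundary \<Omega> M" unfolding assms(3) by (simp add: boundary_def)
  ultimately have "mass \<Omega> M \<le> mass \<Omega> (\<lambda>_. 0)" using assms(2) unfolding taut_def by blast
  then show "mass \<Omega> M \<le> 0" by (simp add: mass_def)
qed

text \<open>The hypothesis says that \<open>N\<close> and \<open>M - N\<close> add up without
  cancellation. A lighter chain with the boundary of \<open>N\<close> could therefore be exchanged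
  for \<open>N\<close> inside \<open>M\<close>, making \<open>M\<close> lighter.\<close>

lemma taut_part:
  assumes "taut \<Omega> M" "N \<in> chains \<Omega> 3" "\<And>xs. \<bar>M xs\<bar> = \<bar>N xs\<bar> + \<bar>M xs - N xs\<bar>"
  shows "taut \<Omega> N"
  unfolding taut_def
proof (intro conjI ballI impI)
  show "N \<in> chains \<Omega> 3" by fact
  have M: "M \<in> chains \<Omega> 3" using assms(1) by (simp add: taut_def)
  fix N' assume N': "N' \<in> chains \<Omega> 3" "boundary \<Omega> N' = boundary \<Omega> N"
  let ?K = "\<lambda>xs. (M xs - N xs) + N' xs"
  have "?K \<in> chains \<Omega> 3" using M assms(2) N' by (intro chains_add chains_diff)
  moreover have "boundary \<Omega> ?K = boundary \<Omega> M" by (simp add: boundary_add boundary_diff N')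
  ultimately have "mass \<Omega> M \<le> mass \<Omega> ?K" using assms(1) unfolding taut_def by blast
  moreover have "mass \<Omega> ?K \<le> mass \<Omega> (\<lambda>xs. M xs - N xs) + mass \<Omega> N'"
    unfolding mass_def sum.distrib[symmetric] by (intro sum_mono) simp
  moreover have "mass \<Omega> M = mass \<Omega> N + mass \<Omega> (\<lambda>xs. M xs - N xs)"
    unfolding mass_def sum.distrib[symmetric] by (intro sum.cong) (auto simp: assms(3))
  ultimately show "mass \<Omega> N \<le> mass \<Omega> N'" by linarith
qed

lemma taut_restrict:
  assumes "taut \<Omega> M"
  shows "taut \<Omega> (\<lambda>xs. if P (set xs) then M xs else 0)"
  using assms by (intro taut_part[OF assms] chains_restrict) (auto simp: taut_def)

section \<open>Push-forward of chains along vertex maps\<close>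

definition push :: "'v set \<Rightarrow> ('v \<Rightarrow> 'v) \<Rightarrow> ('v list \<Rightarrow> int) \<Rightarrow> 'v list \<Rightarrow> int" where
  "push \<Omega> p c ys = (\<Sum>xs | xs \<in> tuples \<Omega> (length ys) \<and> map p xs = ys. c xs)"

lemma push_nz:
  assumes "push \<Omega> p c ys \<noteq> 0"
  obtains xs where "xs \<in> tuples \<Omega> (length ys)" "map p xs = ys" "c xs \<noteq> 0"
proof -
  have "\<exists>xs. xs \<in> tuples \<Omega> (length ys) \<and> map p xs = ys \<and> c xs \<noteq> 0"
  proof (rule ccontr)
    assume "\<not> ?thesis"
    then have "push \<Omega> p c ys = 0" unfolding push_def by (intro sum.neutral) blast
    with assms show False by (rule notE)
  qed
  then show ?thesis using that by blast
qed

text \<open>Exchanging two positions is a bijection from the fibre over a list to the fibre over the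
  swapped list. Alternation also disposes of collapsed simplices: over a list with repetitions the
  contributions cancel.\<close>

lemma push_chain:
  assumes "c \<in> chains \<Omega> k" "p ` \<Omega> \<subseteq> \<Omega>"
  shows "push \<Omega> p c \<in> chains \<Omega> k"
proof (rule chainsI)
  fix ys assume "push \<Omega> p c ys \<noteq> 0"
  then obtain xs where xs: "map p xs = ys" "c xs \<noteq> 0" by (rule push_nz)
  have "length xs = k + 1" "p ` set xs \<subseteq> \<Omega>"
    using chains_supp(1,3)[OF assms(1) xs(2)] assms(2) by auto
  then show "length ys = k + 1 \<and> set ys \<subseteq> \<Omega>" unfolding xs(1)[symmetric] by simp
next
  fix ys :: "'a list" and i j assume ij: "i < j" "j < length ys"
  let ?s = "\<lambda>xs::'a list. xs[i := xs ! j, j := xs ! i]"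
  have ss: "?s (?s xs) = xs" if "length xs = length ys" for xs
    using that ij by (intro nth_equalityI) (auto simp: nth_list_update)
  have ms: "map p (?s xs) = ?s (map p xs)" if "length xs = length ys" for xs
    using that ij by (simp add: map_update)
  have "push \<Omega> p c (?s ys) = (\<Sum>xs | xs \<in> tuples \<Omega> (length ys) \<and> map p xs = ys. - c xs)"
    unfolding push_def
  proof (rule sum.reindex_bij_witness[of _ ?s ?s])
    fix xs assume "xs \<in> {xs \<in> tuples \<Omega> (length (?s ys)). map p xs = ?s ys}"
    then have xs: "length xs = length ys" "set xs \<subseteq> \<Omega>" "map p xs = ?s ys" by (auto simp: tuples_def)
    show "?s (?s xs) = xs" using ss xs by simp
    show "?s xs \<in> {xs \<in> tuples \<Omega> (length ys). map p xs = ys}"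
      using xs ms[of xs] ss[of ys] ij by (simp add: tuples_def set_swap)
    show "- c (?s xs) = c xs" using chains_swap[OF assms(1), of i j xs] ij xs by simp
  next
    fix xs assume "xs \<in> {xs \<in> tuples \<Omega> (length ys). map p xs = ys}"
    then have xs: "length xs = length ys" "set xs \<subseteq> \<Omega>" "map p xs = ys" by (auto simp: tuples_def)
    show "?s (?s xs) = xs" using ss xs by simp
    show "?s xs \<in> {xs \<in> tuples \<Omega> (length (?s ys)). map p xs = ?s ys}"
      using xs ms[of xs] ij by (simp add: tuples_def set_swap)
  qed
  then show "push \<Omega> p c (?s ys) = - push \<Omega> p c ys"
    by (simp add: push_def sum_negf)
qed

text \<open>The fibre over \<open>v # ys\<close> is the fibre over \<open>v\<close> times the fibre
  over \<open>ys\<close>, and as \<open>v\<close> varies the former partition \<Omega>.\<close>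

lemma boundary_push:
  assumes "finite \<Omega>" "p ` \<Omega> \<subseteq> \<Omega>"
  shows "boundary \<Omega> (push \<Omega> p c) = push \<Omega> p (boundary \<Omega> c)"
proof
  fix ys
  let ?T = "{xs \<in> tuples \<Omega> (length ys). map p xs = ys}"
  have fT: "finite ?T" using finite_tuples[OF assms(1)] by simp
  have "push \<Omega> p c (v # ys) = (\<Sum>x | x \<in> \<Omega> \<and> p x = v. \<Sum>xs\<in>?T. c (x # xs))" for v
  proof -
    have "push \<Omega> p c (v # ys) = (\<Sum>(x,xs)\<in>{x\<in>\<Omega>. p x = v} \<times> ?T. c (x # xs))"
      unfolding push_def
      by (rule sum.reindex_bij_witness[of _ "\<lambda>(x,xs). x # xs" "\<lambda>xs. (hd xs, tl xs)"])
        (auto simp: tuples_def length_Suc_conv)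
    then show ?thesis by (simp add: sum.cartesian_product)
  qed
  then have "boundary \<Omega> (push \<Omega> p c) ys = (\<Sum>v\<in>\<Omega>. \<Sum>x | x \<in> \<Omega> \<and> p x = v. \<Sum>xs\<in>?T. c (x # xs))"
    by (simp add: boundary_def)
  also have "\<dots> = (\<Sum>x\<in>\<Omega>. \<Sum>xs\<in>?T. c (x # xs))"
    by (rule sum.group) (use assms in auto)
  also have "\<dots> = (\<Sum>xs\<in>?T. \<Sum>x\<in>\<Omega>. c (x # xs))" by (rule sum.swap)
  finally show "boundary \<Omega> (push \<Omega> p c) ys = push \<Omega> p (boundary \<Omega> c) ys"
    by (simp add: push_def boundary_def)
qed

lemma push_ident:
  assumes "finite \<Omega>" "c \<in> chains \<Omega> k" "\<And>xs x. c xs \<noteq> 0 \<Longrightarrow> x \<in> set xs \<Longrightarrow> p x = x"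
  shows "push \<Omega> p c = c"
proof
  fix ys
  have eq: "xs = map p xs" if "c xs \<noteq> 0" for xs
    using assms(3)[OF that] by (simp add: map_idI)
  show "push \<Omega> p c ys = c ys"
  proof (cases "c ys = 0")
    case True
    have "c xs = 0" if "map p xs = ys" for xs
    proof (rule ccontr)
      assume "c xs \<noteq> 0"
      then have "xs = ys" using eq that by simp
      with True \<open>c xs \<noteq> 0\<close> show False by simp
    qed
    then show ?thesis using True by (simp add: push_def)
  next
    case False
    then have "set ys \<subseteq> \<Omega>" "map p ys = ys" using chains_supp(3)[OF assms(2) False] eq[OF False] by auto
    then have "push \<Omega> p c ys = (\<Sum>xs\<in>{ys}. c xs)"
      unfolding push_def
    proof (intro sum.mono_neutral_right)
      show "finite {xs \<in> tuples \<Omega> (length ys). map p xs = ys}"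
        using finite_tuples[OF assms(1)] by simp
      show "\<forall>i\<in>{xs \<in> tuples \<Omega> (length ys). map p xs = ys} - {ys}. c i = 0"
        using eq by force
    qed (auto simp: tuples_def)
    then show ?thesis by simp
  qed
qed

text \<open>Sharper than the triangle inequality: the push-forward is 0 on lists with repetitions,
  so collapsed simplices are not charged. The later comparisons owe their strictness to
  this.\<close>

lemma mass_push:
  assumes "finite \<Omega>" "M \<in> chains \<Omega> 3" "p ` \<Omega> \<subseteq> \<Omega>"
  shows "mass \<Omega> (push \<Omega> p M) \<le> (\<Sum>xs\<in>tuples \<Omega> 4. if distinct (map p xs) then \<bar>M xs\<bar> else 0)"
proof -
  have fin: "finite (tuples \<Omega> 4)" using finite_tuples[OF assms(1)] .
  have "\<bar>push \<Omega> p M ys\<bar> \<le> (\<Sum>xs | xs \<in> tuples \<Omega> 4 \<and> map p xs = ys. if distinct (map p xs) then \<bar>M xs\<bar> else 0)"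
    if "ys \<in> tuples \<Omega> 4" for ys
  proof (cases "distinct ys")
    case True
    have "length ys = 4" using that by (simp add: tuples_def)
    then have "\<bar>push \<Omega> p M ys\<bar> \<le> (\<Sum>xs | xs \<in> tuples \<Omega> 4 \<and> map p xs = ys. \<bar>M xs\<bar>)"
      unfolding push_def by (simp add: sum_abs)
    also have "\<dots> = (\<Sum>xs | xs \<in> tuples \<Omega> 4 \<and> map p xs = ys. if distinct (map p xs) then \<bar>M xs\<bar> else 0)"
      using True by (intro sum.cong) auto
    finally show ?thesis .
  next
    case False
    then have "push \<Omega> p M ys = 0" using chains_supp(2)[OF push_chain[OF assms(2,3)]] by blast
    then show ?thesis by (simp add: sum_nonneg)
  qed
  then have "mass \<Omega> (push \<Omega> p M) \<le> (\<Sum>ys\<in>tuples \<Omega> 4. \<Sum>xs | xs \<in> tuples \<Omega> 4 \<and> map p xs = ys.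
      if distinct (map p xs) then \<bar>M xs\<bar> else 0)"
    unfolding mass_def by (rule sum_mono)
  also have "\<dots> = (\<Sum>xs\<in>tuples \<Omega> 4. if distinct (map p xs) then \<bar>M xs\<bar> else 0)"
  proof (rule sum.group[OF fin fin])
    show "map p ` tuples \<Omega> 4 \<subseteq> tuples \<Omega> 4" using assms(3) by (auto simp: tuples_def image_subset_iff)
  qed
  finally show ?thesis .
qed

text \<open>The push-forward is a competing filling of the same boundary, and it would be strictly
  lighter if some simplex of the support collapsed.\<close>

lemma taut_push:
  assumes "finite \<Omega>" "taut \<Omega> M" "p ` \<Omega> \<subseteq> \<Omega>" "push \<Omega> p (boundary \<Omega> M) = boundary \<Omega> M" "M xs \<noteq> 0"
  shows "distinct (map p xs)"
proof (rule ccontr)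
  assume nd: "\<not> distinct (map p xs)"
  have M: "M \<in> chains \<Omega> 3" using assms(2) by (simp add: taut_def)
  have "mass \<Omega> M \<le> mass \<Omega> (push \<Omega> p M)"
    using assms(2,4) push_chain[OF M assms(3)] boundary_push[OF assms(1,3)] unfolding taut_def by metis
  also have "\<dots> \<le> (\<Sum>xs\<in>tuples \<Omega> 4. if distinct (map p xs) then \<bar>M xs\<bar> else 0)"
    by (rule mass_push[OF assms(1) M assms(3)])
  also have "\<dots> < mass \<Omega> M"
    unfolding mass_def
  proof (rule sum_strict_mono_ex1[OF finite_tuples[OF assms(1)]])
    show "\<exists>x\<in>tuples \<Omega> 4. (if distinct (map p x) then \<bar>M x\<bar> else 0) < \<bar>M x\<bar>"
      using chains3_tuples[OF M assms(5)] nd assms(5) by (intro bexI[of _ xs]) auto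
  qed simp
  finally show False by simp
qed

section \<open>Splitting a taut filling at three common vertices\<close>

text \<open>Only one triangle fits on three points, and its boundary is nonzero on each
  edge.\<close>

lemma cycle_on_three_points:
  assumes "finite \<Omega>" "Z \<in> chains \<Omega> 2" "boundary \<Omega> Z = (\<lambda>_. 0)"
    "\<And>xs. Z xs \<noteq> 0 \<Longrightarrow> set xs \<subseteq> C" "finite C" "card C \<le> 3"
  shows "Z = (\<lambda>_. 0)"
proof (rule ccontr)
  assume "Z \<noteq> (\<lambda>_. 0)"
  then obtain xs where nz: "Z xs \<noteq> 0" by auto
  then have "length xs = 3" using chains_supp(1)[OF assms(2)] by fastforce
  then obtain a b c where xs: "xs = [a,b,c]" by (rule length_3E)
  have d: "distinct [a,b,c]" "a \<in> \<Omega>" using chains_supp[OF assms(2) nz] xs by auto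
  have "{a,b,c} \<subseteq> C" using assms(4)[OF nz] xs by simp
  moreover have "card {a,b,c} = 3" using d by simp
  ultimately have C: "C = {a,b,c}" using assms(5,6) by (metis card_subset_eq card_mono le_antisym)
  have "Z [v,b,c] = 0" if "v \<noteq> a" for v
  proof (rule ccontr)
    assume "Z [v,b,c] \<noteq> 0"
    then show False using assms(4)[of "[v,b,c]"] chains_supp(2)[OF assms(2), of "[v,b,c]"] C that by auto
  qed
  then have "boundary \<Omega> Z [b,c] = (\<Sum>v\<in>{a}. Z [v,b,c])"
    unfolding boundary_def using assms(1) d by (intro sum.mono_neutral_right) auto
  then show False using assms(3) nz xs by simp
qed

text \<open>Three common vertices are the critical number: they may carry a triangle on which
  \<open>Y\<close> and \<open>Z\<close> cancel, while a cycle supported on them is still 0.\<close>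

locale almost_disjoint_sum =
  fixes \<Omega> :: "'v set" and M Y Z :: "'v list \<Rightarrow> int" and A B :: "'v set"
  assumes fin: "finite \<Omega>" and M: "taut \<Omega> M"
    and bd: "boundary \<Omega> M = (\<lambda>xs. Y xs + Z xs)"
    and Y: "Y \<in> chains \<Omega> 2" "boundary \<Omega> Y = (\<lambda>_. 0)" "\<forall>xs. Y xs \<noteq> 0 \<longrightarrow> set xs \<subseteq> A"
    and Z: "Z \<in> chains \<Omega> 2" "boundary \<Omega> Z = (\<lambda>_. 0)" "\<forall>xs. Z xs \<noteq> 0 \<longrightarrow> set xs \<subseteq> B"
    and AB: "A \<union> B = \<Omega>" "card (A \<inter> B) = 3"
begin

text \<open>No 4-set is mapped injectively by both retractions, because they collapse to different points.
  So the two push-forwards together are a filling no heavier than the original one.\<close>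

lemma split_survive:
  assumes w: "w \<in> A \<inter> B" "w' \<in> A \<inter> B" "w \<noteq> w'" and nz: "M xs \<noteq> 0"
  defines "p \<equiv> \<lambda>x. if x \<in> A then x else w" and "q \<equiv> \<lambda>x. if x \<in> B then x else w'"
  shows "inj_on p (set xs) \<or> inj_on q (set xs)"
proof (rule ccontr)
  assume neither: "\<not> ?thesis"
  have Mc: "M \<in> chains \<Omega> 3" using M by (simp add: taut_def)
  have p: "p ` \<Omega> \<subseteq> \<Omega>" and q: "q ` \<Omega> \<subseteq> \<Omega>" using AB w by (auto simp: p_def q_def)
  have finC: "finite (A \<inter> B)" by (rule card_ge_0_finite) (use AB in simp)
  have pY: "push \<Omega> p Y = Y" by (rule push_ident[OF fin Y(1)]) (use Y(3) in \<open>auto simp: p_def\<close>)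
  have qZ: "push \<Omega> q Z = Z" by (rule push_ident[OF fin Z(1)]) (use Z(3) in \<open>auto simp: q_def\<close>)
  have push0: "push \<Omega> f (\<lambda>_. 0) = (\<lambda>_. 0)" for f by (simp add: push_def fun_eq_iff)
  \<comment> \<open>\<open>p\<close> sends all of \<open>B\<close> into the three common points, so
    the pushed cycle vanishes; likewise \<open>q\<close> kills \<open>Y\<close>. Hence the two
    push-forwards of \<open>M\<close> add up to a filling of \<open>Y + Z\<close>.\<close>
  have pZ: "push \<Omega> p Z = (\<lambda>_. 0)"
  proof (rule cycle_on_three_points[OF fin push_chain[OF Z(1) p] _ _ finC])
    show "boundary \<Omega> (push \<Omega> p Z) = (\<lambda>_. 0)" using boundary_push[OF fin p] Z(2) push0 by simp
    fix ys assume "push \<Omega> p Z ys \<noteq> 0"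
    then obtain zs where "map p zs = ys" "Z zs \<noteq> 0" by (rule push_nz)
    then show "set ys \<subseteq> A \<inter> B" using spec[OF Z(3), of zs] w by (auto simp: p_def)
  qed (use AB in simp)
  have qY: "push \<Omega> q Y = (\<lambda>_. 0)"
  proof (rule cycle_on_three_points[OF fin push_chain[OF Y(1) q] _ _ finC])
    show "boundary \<Omega> (push \<Omega> q Y) = (\<lambda>_. 0)" using boundary_push[OF fin q] Y(2) push0 by simp
    fix ys assume "push \<Omega> q Y ys \<noteq> 0"
    then obtain zs where "map q zs = ys" "Y zs \<noteq> 0" by (rule push_nz)
    then show "set ys \<subseteq> A \<inter> B" using spec[OF Y(3), of zs] w by (auto simp: q_def)
  qed (use AB in simp)
  have push_add: "push \<Omega> f (\<lambda>xs. Y xs + Z xs) = (\<lambda>xs. push \<Omega> f Y xs + push \<Omega> f Z xs)" for f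
    by (simp add: push_def sum.distrib fun_eq_iff)
  let ?N = "\<lambda>xs. push \<Omega> p M xs + push \<Omega> q M xs"
  have "?N \<in> chains \<Omega> 3" using push_chain Mc p q by (intro chains_add) auto
  moreover have "boundary \<Omega> ?N = boundary \<Omega> M"
    by (simp add: boundary_add boundary_push[OF fin p] boundary_push[OF fin q] bd push_add pY qZ pZ qY)
  ultimately have le: "mass \<Omega> M \<le> mass \<Omega> ?N" using M unfolding taut_def by blast
  have notboth: "\<not> (distinct (map p ys) \<and> distinct (map q ys))" if "length ys = 4" for ys
  proof
    assume d: "distinct (map p ys) \<and> distinct (map q ys)"
    define t where "t = set ys"
    have ip: "inj_on p t" and iq: "inj_on q t" using d by (auto simp: t_def distinct_map)
    have "card t = 4" using d that by (simp add: t_def distinct_map distinct_card)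
    have ft: "finite t" by (simp add: t_def)
    \<comment> \<open>The count: injectivity of \<open>p\<close> admits at most one vertex of
      \<open>t\<close> outside \<open>A\<close>, and if there is one, then \<open>w\<close> is
      missing from \<open>t\<close>; similarly for \<open>q\<close>, \<open>B\<close> and
      \<open>w'\<close>. As \<open>w\<close> and \<open>w'\<close> differ, each outer vertex costs
      its own common vertex, which leaves at most three vertices.\<close>
    have U1: "card (t - A) \<le> 1"
      using ip by (subst card_le_Suc0_iff_eq[unfolded One_nat_def[symmetric]]) (auto simp: p_def inj_on_def ft)
    have V1: "card (t - B) \<le> 1"
      using iq by (subst card_le_Suc0_iff_eq[unfolded One_nat_def[symmetric]]) (auto simp: q_def inj_on_def ft)
    have wt: "w \<notin> t" if "t - A \<noteq> {}" using ip that w by (auto simp: p_def inj_on_def split: if_splits)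
    have wt': "w' \<notin> t" if "t - B \<noteq> {}" using iq that w by (auto simp: q_def inj_on_def split: if_splits)
    have "t = (t \<inter> (A \<inter> B)) \<union> (t - A) \<union> (t - B)" by auto
    then have "card t \<le> card (t \<inter> (A \<inter> B)) + card (t - A) + card (t - B)"
      by (metis card_Un_le le_trans add_le_mono1)
    moreover have "card (t \<inter> (A \<inter> B)) + card (t - A) + card (t - B) \<le> 3"
    proof -
      have "t \<inter> (A \<inter> B) \<subseteq> A \<inter> B - (if t - A \<noteq> {} then {w} else {}) - (if t - B \<noteq> {} then {w'} else {})"
        using wt wt' by auto
      then have "card (t \<inter> (A \<inter> B)) \<le>
          card (A \<inter> B - (if t - A \<noteq> {} then {w} else {}) - (if t - B \<noteq> {} then {w'} else {}))"
        using finC by (intro card_mono) auto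
      also have "\<dots> = 3 - (if t - A \<noteq> {} then 1 else 0) - (if t - B \<noteq> {} then 1 else 0)"
        using w AB(2) finC by auto
      finally have le: "card (t \<inter> (A \<inter> B)) \<le> 3 - (if t - A \<noteq> {} then 1 else 0) - (if t - B \<noteq> {} then 1 else 0)" .
      have "t - A = {} \<Longrightarrow> card (t - A) = 0" "t - B = {} \<Longrightarrow> card (t - B) = 0"
        by (simp_all only: card.empty)
      then show ?thesis using U1 V1 le by (cases "t - A \<noteq> {}"; cases "t - B \<noteq> {}"; simp only: if_True if_False not_False_eq_True; linarith)
    qed
    ultimately show False using \<open>card t = 4\<close> by simp
  qed
  have "mass \<Omega> ?N \<le> mass \<Omega> (push \<Omega> p M) + mass \<Omega> (push \<Omega> q M)"
    unfolding mass_def sum.distrib[symmetric] by (intro sum_mono) simp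
  also have "\<dots> \<le> (\<Sum>xs\<in>tuples \<Omega> 4. (if distinct (map p xs) then \<bar>M xs\<bar> else 0) +
      (if distinct (map q xs) then \<bar>M xs\<bar> else 0))"
    unfolding sum.distrib using mass_push[OF fin Mc p] mass_push[OF fin Mc q] by linarith
  also have "\<dots> < mass \<Omega> M"
    unfolding mass_def
  proof (rule sum_strict_mono_ex1[OF finite_tuples[OF fin]])
    show "\<forall>x\<in>tuples \<Omega> 4. (if distinct (map p x) then \<bar>M x\<bar> else 0) +
      (if distinct (map q x) then \<bar>M x\<bar> else 0) \<le> \<bar>M x\<bar>"
      using notboth by (auto simp: tuples_def)
    have "\<not> distinct (map p xs)" "\<not> distinct (map q xs)"
      using neither by (auto simp: distinct_map)
    then show "\<exists>x\<in>tuples \<Omega> 4. (if distinct (map p x) then \<bar>M x\<bar> else 0) +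
      (if distinct (map q x) then \<bar>M x\<bar> else 0) < \<bar>M x\<bar>"
      using chains3_tuples[OF Mc nz] nz by (intro bexI[of _ xs]) auto
  qed
  finally show False using le by simp
qed

text \<open>Uses \<open>split_survive\<close> for varying collapse points. If a mixed simplex
  contained a common vertex r, collapsing to r would not be injective on it from either side, so
  both collapses to any other common vertex would be. This leaves r, one vertex outside
  \<open>A\<close> and one outside \<open>B\<close>, too few for a tetrahedron.\<close>

lemma split_types:
  assumes nz: "M xs \<noteq> 0"
    and mixed: "\<not> set xs \<subseteq> A" "\<not> set xs \<subseteq> B"
  shows "set xs \<inter> (A \<inter> B) = {}"
    and "(\<exists>u. set xs - A = {u}) \<or> (\<exists>v. set xs - B = {v})"
proof -
  note surv = split_survive[OF _ _ _ nz]
  let ?t = "set xs"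
  obtain u v where u: "u \<in> ?t" "u \<notin> A" and v: "v \<in> ?t" "v \<notin> B" using mixed by auto
  have Mc: "M \<in> chains \<Omega> 3" using M by (simp add: taut_def)
  have sub: "?t \<subseteq> \<Omega>" "card ?t = 4"
    using chains_supp[OF Mc nz] distinct_card by force+
  have oneA: "?t - A = {u}" if "w \<in> A \<inter> B" "inj_on (\<lambda>x. if x \<in> A then x else w) ?t" for w
    using that u unfolding inj_on_def by auto
  have oneB: "?t - B = {v}" if "w \<in> A \<inter> B" "inj_on (\<lambda>x. if x \<in> B then x else w) ?t" for w
    using that v unfolding inj_on_def by auto
  have notA: "w \<notin> ?t" if "w \<in> A \<inter> B" "inj_on (\<lambda>x. if x \<in> A then x else w) ?t" for w
    using that u unfolding inj_on_def by auto
  have notB: "w \<notin> ?t" if "w \<in> A \<inter> B" "inj_on (\<lambda>x. if x \<in> B then x else w) ?t" for w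
    using that v unfolding inj_on_def by auto
  obtain x y z where xyz: "A \<inter> B = {x,y,z}" "x \<noteq> y" "x \<noteq> z" "y \<noteq> z"
    using AB(2) by (auto simp: card_3_iff)
  show disj: "?t \<inter> (A \<inter> B) = {}"
  proof (rule ccontr)
    assume "\<not> ?thesis"
    then obtain r where r: "r \<in> ?t" "r \<in> A \<inter> B" by auto
    have q: "inj_on (\<lambda>x. if x \<in> B then x else w') ?t" if "w' \<in> A \<inter> B" "w' \<noteq> r" for w'
      using surv[of r w'] notA[of r] r that by auto
    have p: "inj_on (\<lambda>x. if x \<in> A then x else w') ?t" if "w' \<in> A \<inter> B" "w' \<noteq> r" for w'
      using surv[of w' r] notB[of r] r that by auto
    obtain w' where w': "w' \<in> A \<inter> B" "w' \<noteq> r" using xyz by auto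
    have "?t - A = {u}" "?t - B = {v}" using p q oneA oneB w' by blast+
    moreover have "?t \<inter> (A \<inter> B) = {r}"
      using r q notB by auto
    moreover have "?t \<subseteq> (?t \<inter> (A \<inter> B)) \<union> (?t - A) \<union> (?t - B)" by auto
    ultimately have "?t \<subseteq> {r,u,v}" by auto
    then have "card ?t \<le> card {r,u,v}" by (intro card_mono) auto
    also have "\<dots> \<le> 3" by (simp add: card_insert_if)
    finally show False using sub by simp
  qed
  show "(\<exists>u. ?t - A = {u}) \<or> (\<exists>v. ?t - B = {v})"
    using surv[of x y] oneA[of x] oneB[of y] xyz by auto
qed

text \<open>The tetrahedra of this type at \<open>u\<close> form a taut chain whose boundary avoids
  \<open>u\<close>. Collapsing \<open>u\<close> to another vertex of \<open>xs\<close> then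
  preserves that boundary but degenerates \<open>xs\<close>, against
  \<open>taut_push\<close>.\<close>

lemma split_no_mixed:
  assumes nz: "M xs \<noteq> 0"
  shows "\<not> (set xs - A = {u} \<and> set xs \<inter> (A \<inter> B) = {})"
proof
  assume u: "set xs - A = {u} \<and> set xs \<inter> (A \<inter> B) = {}"
  note types = split_types
  have Mc: "M \<in> chains \<Omega> 3" using M by (simp add: taut_def)
  have uA: "u \<notin> A" "u \<in> set xs" "u \<in> \<Omega>" "u \<in> B" using u chains_supp(3)[OF Mc nz] AB by auto
  \<comment> \<open>Selects the tetrahedra at \<open>u\<close> all of whose other vertices lie
    outside \<open>B\<close>.\<close>
  define P where "P = (\<lambda>t. u \<in> t \<and> t \<inter> B \<subseteq> {u})"
  define N where "N = (\<lambda>xs. if P (set xs) then M xs else 0)"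
  have N: "taut \<Omega> N" unfolding N_def by (rule taut_restrict[OF M])
  have Pxs: "P (set xs)" using u by (auto simp: P_def)
  have "card (set xs - {u}) = 3"
    using chains_supp[OF Mc nz] uA distinct_card[of xs] by simp
  then obtain v where v: "v \<in> set xs" "v \<noteq> u" by (metis card.empty ex_in_conv Diff_iff singletonI zero_neq_numeral)
  define f where "f = (\<lambda>x. if x = u then v else x)"
  have f: "f ` \<Omega> \<subseteq> \<Omega>" using v chains_supp(3)[OF Mc nz] by (auto simp: f_def)
  have bN: "boundary \<Omega> N ys = 0" if "u \<in> set ys" for ys
  proof (rule ccontr)
    assume nzb: "boundary \<Omega> N ys \<noteq> 0"
    then obtain z where z: "z \<in> \<Omega>" "N (z # ys) \<noteq> 0" by (rule boundary_nz)
    then have Pz: "P (set (z # ys))" "M (z # ys) \<noteq> 0" by (auto simp: N_def split: if_splits)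
    then have dz: "distinct (z # ys)" "length ys = 3" "set ys \<subseteq> \<Omega>" using chains_supp[OF Mc Pz(2)] by auto
    have ysB: "set ys \<inter> B \<subseteq> {u}" using Pz by (auto simp: P_def)
    have "card (set ys - {u}) = 2" using dz that distinct_card[of ys] by simp
    then obtain y y' where yy: "set ys - {u} = {y,y'}" "y \<noteq> y'" by (auto simp: card_2_iff)
    then have ys: "set ys = {u,y,y'}" "y \<noteq> u" "y' \<noteq> u" using that by auto
    then have yB: "y \<notin> B" "y' \<notin> B" using ysB by auto
    \<comment> \<open>Across such a face the type persists. A fourth vertex in \<open>B\<close>
      would lie outside \<open>A\<close> by the first part of \<open>split_types\<close>; then two
      vertices lie outside \<open>A\<close> and two outside \<open>B\<close>, against the second
      part.\<close>
    have eq: "N (w # ys) = M (w # ys)" if "w \<in> \<Omega>" for w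
    proof (cases "M (w # ys) = 0")
      case False
      have mixed: "\<not> set (w # ys) \<subseteq> A" "\<not> set (w # ys) \<subseteq> B" using uA ys yB by auto
      have dw: "w \<notin> set ys" using chains_supp(2)[OF Mc False] by simp
      have "w \<notin> B"
      proof
        assume "w \<in> B"
        moreover have "w \<notin> A \<inter> B" using types(1)[OF False mixed] by auto
        ultimately have w: "w \<notin> A" by auto
        from types(2)[OF False mixed] show False
        proof
          assume "\<exists>t. set (w # ys) - A = {t}"
          then obtain t where "set (w # ys) - A = {t}" by auto
          moreover have "w \<in> set (w # ys) - A" "u \<in> set (w # ys) - A" using w uA ys by auto
          ultimately show False using dw ys by auto
        next
          assume "\<exists>t. set (w # ys) - B = {t}"
          then obtain t where "set (w # ys) - B = {t}" by auto
          moreover have "y \<in> set (w # ys) - B" "y' \<in> set (w # ys) - B" using yB ys by auto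
          ultimately show False using yy by auto
        qed
      qed
      then have "P (set (w # ys))" using ys ysB by (auto simp: P_def)
      then show ?thesis by (simp add: N_def)
    qed (simp add: N_def)
    \<comment> \<open>So the face would lie on the boundary of \<open>M\<close>. But
      \<open>u\<close> is outside \<open>A\<close> and \<open>y\<close> outside \<open>B\<close>,
      hence neither \<open>Y\<close> nor \<open>Z\<close> can be nonzero there.\<close>
    have "boundary \<Omega> N ys = boundary \<Omega> M ys" using eq by (simp add: boundary_def)
    then have "Y ys \<noteq> 0 \<or> Z ys \<noteq> 0" using nzb bd by auto
    then show False using spec[OF Y(3), of ys] spec[OF Z(3), of ys] ys uA yB by auto
  qed
  have "push \<Omega> f (boundary \<Omega> N) = boundary \<Omega> N"
  proof (rule push_ident[OF fin])
    show "boundary \<Omega> N \<in> chains \<Omega> 2"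
      using N chains_boundary[of N \<Omega> 2] by (simp add: taut_def)
    show "f x = x" if "boundary \<Omega> N xs \<noteq> 0" "x \<in> set xs" for xs x
      using bN[of xs] that by (auto simp: f_def)
  qed
  then have "distinct (map f xs)"
    using taut_push[OF fin N f] nz Pxs by (simp add: N_def)
  then show False using v uA by (auto simp: distinct_map f_def inj_on_def)
qed

lemma split_support:
  assumes nz: "M xs \<noteq> 0"
  shows "set xs \<subseteq> A \<or> set xs \<subseteq> B"
proof (rule ccontr)
  assume "\<not> ?thesis"
  then have mixed: "\<not> set xs \<subseteq> A" "\<not> set xs \<subseteq> B" by auto
  interpret mirror: almost_disjoint_sum \<Omega> M Z Y B A
    using fin M bd Y Z AB by unfold_locales (simp_all add: Un_commute Int_commute add.commute)
  show False
    using split_types[OF nz mixed] split_no_mixed[OF nz]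
      mirror.split_no_mixed[OF nz]
    by (auto simp: Int_commute)
qed

text \<open>The error \<open>boundary \<Omega> N - Y\<close> equals
  \<open>Z - boundary \<Omega> K\<close>. One form is supported in \<open>A\<close>, the other in
  \<open>B\<close>, so it is a cycle on the three common points and vanishes.\<close>

lemma split_taut:
  obtains N K where "taut \<Omega> N" "taut \<Omega> K" "boundary \<Omega> N = Y" "boundary \<Omega> K = Z"
    "M = (\<lambda>xs. N xs + K xs)" "mass \<Omega> M = mass \<Omega> N + mass \<Omega> K"
    "\<And>xs. N xs \<noteq> 0 \<Longrightarrow> set xs \<subseteq> A" "\<And>xs. K xs \<noteq> 0 \<Longrightarrow> set xs \<subseteq> B"
    "\<And>xs. N xs = 0 \<or> K xs = 0"
proof -
  note supp = split_support
  define N where "N = (\<lambda>xs. if set xs \<subseteq> A then M xs else 0)"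
  define K where "K = (\<lambda>xs. if \<not> set xs \<subseteq> A then M xs else 0)"
  have N: "taut \<Omega> N" unfolding N_def by (rule taut_restrict[OF M])
  have K: "taut \<Omega> K" unfolding K_def by (rule taut_restrict[OF M])
  have eq: "M = (\<lambda>xs. N xs + K xs)" by (auto simp: N_def K_def)
  have NA: "set xs \<subseteq> A" if "N xs \<noteq> 0" for xs using that by (auto simp: N_def split: if_splits)
  have KB: "set xs \<subseteq> B" if "K xs \<noteq> 0" for xs
    using that supp[of xs] by (auto simp: K_def split: if_splits)
  have mass: "mass \<Omega> M = mass \<Omega> N + mass \<Omega> K"
    unfolding mass_def sum.distrib[symmetric] by (intro sum.cong) (auto simp: N_def K_def)
  have sum: "boundary \<Omega> N xs + boundary \<Omega> K xs = Y xs + Z xs" for xs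
    using bd boundary_add[of \<Omega> N K] unfolding eq[symmetric] by metis
  have bN: "boundary \<Omega> N \<in> chains \<Omega> 2"
    using N chains_boundary[of N \<Omega> 2] by (simp add: taut_def)
  have "(\<lambda>xs. boundary \<Omega> N xs - Y xs) = (\<lambda>_. 0)"
  proof (rule cycle_on_three_points[OF fin chains_diff[OF bN Y(1)]])
    have "N \<in> chains \<Omega> 3" using N by (simp add: taut_def)
    then show "boundary \<Omega> (\<lambda>xs. boundary \<Omega> N xs - Y xs) = (\<lambda>_. 0)"
      by (simp add: boundary_diff boundary_boundary3 Y(2))
    show "finite (A \<inter> B)" by (rule card_ge_0_finite) (use AB in simp)
    show "card (A \<inter> B) \<le> 3" using AB by simp
    fix xs assume nz: "boundary \<Omega> N xs - Y xs \<noteq> 0"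
    have "set xs \<subseteq> A"
    proof (cases "Y xs = 0")
      case True
      then have "boundary \<Omega> N xs \<noteq> 0" using nz by simp
      then obtain v where "N (v # xs) \<noteq> 0" by (rule boundary_nz)
      then show ?thesis using NA[of "v # xs"] by simp
    qed (use Y(3) in auto)
    moreover have "set xs \<subseteq> B"
    proof (cases "Z xs = 0")
      case True
      then have "boundary \<Omega> K xs \<noteq> 0" using nz sum[of xs] by simp
      then obtain v where "K (v # xs) \<noteq> 0" by (rule boundary_nz)
      then show ?thesis using KB[of "v # xs"] by simp
    qed (use Z(3) in auto)
    ultimately show "set xs \<subseteq> A \<inter> B" by auto
  qed
  then have bNY: "boundary \<Omega> N xs = Y xs" for xs by (simp add: fun_eq_iff)
  then have "boundary \<Omega> K xs = Z xs" for xs using sum[of xs] by simp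
  then have bKZ: "boundary \<Omega> K = Z" by (simp add: fun_eq_iff)
  have bNY': "boundary \<Omega> N = Y" using bNY by (simp add: fun_eq_iff)
  show ?thesis
  proof (rule that[OF N K bNY' bKZ eq mass])
    show "N xs = 0 \<or> K xs = 0" for xs by (simp add: N_def K_def)
  qed (fact NA, fact KB)
qed

end

section \<open>Absence of interior vertices\<close>

definition verts :: "('v list \<Rightarrow> int) \<Rightarrow> 'v set" where
  "verts c = {v. \<exists>xs. c xs \<noteq> 0 \<and> v \<in> set xs}"

text \<open>Splits \<open>X\<close> as \<open>X + 0\<close>, with the vertices of \<open>X\<close>
  on one side and all others on the other; a face \<open>ys\<close> of \<open>X\<close>, added to
  the second side, supplies the three common vertices. The second part is a taut filling of 0, hence
  0.\<close>

lemma taut_verts: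
  assumes fin: "finite \<Omega>" and M: "taut \<Omega> M" and nz: "M xs \<noteq> 0"
  shows "set xs \<subseteq> verts (boundary \<Omega> M)"
proof -
  define X where "X = boundary \<Omega> M"
  have Mc: "M \<in> chains \<Omega> 3" using M by (simp add: taut_def)
  have X: "X \<in> chains \<Omega> 2" using Mc chains_boundary[of M \<Omega> 2] by (simp add: X_def)
  have "X \<noteq> (\<lambda>_. 0)" using taut_zero[OF fin M] nz by (auto simp: X_def)
  then obtain ys where ys: "X ys \<noteq> 0" by auto
  define A where "A = verts X"
  define B where "B = (\<Omega> - A) \<union> set ys"
  have ysA: "set ys \<subseteq> A" using ys by (auto simp: A_def verts_def)
  have A: "A \<subseteq> \<Omega>" using chains_supp(3)[OF X] by (auto simp: A_def verts_def)
  have AB: "A \<union> B = \<Omega>" "A \<inter> B = set ys" using A ysA chains_supp(3)[OF X ys] by (auto simp: B_def)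
  have c3: "card (A \<inter> B) = 3" using AB chains_supp[OF X ys] distinct_card[of ys] by simp
  have 0: "(\<lambda>_. 0) \<in> chains \<Omega> 2" "boundary \<Omega> (\<lambda>_. 0) = (\<lambda>_. 0)" by (simp_all add: chains_def boundary_def)
  have sum: "almost_disjoint_sum \<Omega> M X (\<lambda>_. 0) A B"
    using fin M X 0 AB(1) c3 boundary_boundary3[OF Mc]
    by unfold_locales (auto simp: X_def A_def verts_def)
  obtain N K where NK: "taut \<Omega> K" "boundary \<Omega> K = (\<lambda>_. 0)" "M = (\<lambda>xs. N xs + K xs)"
    "\<And>xs. N xs \<noteq> 0 \<Longrightarrow> set xs \<subseteq> A"
    by (rule almost_disjoint_sum.split_taut[OF sum]) (rule that)
  have "K xs = 0" using taut_zero[OF fin NK(1,2)] .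
  then have "N xs \<noteq> 0" using NK(3) nz by (metis add.right_neutral)
  then show ?thesis using NK(4) by (simp add: A_def X_def)
qed

subsection \<open>Cones\<close>

text \<open>The alternating form of the join of \<open>v\<close> with \<open>X\<close>: the apex may
  stand at any of the four positions, with the matching sign. Faces of \<open>X\<close> that contain
  \<open>v\<close> drop out, because their two terms cancel.\<close>

definition cone :: "'v \<Rightarrow> ('v list \<Rightarrow> int) \<Rightarrow> 'v list \<Rightarrow> int" where
  "cone v X xs = (if length xs = 4 then
      (if xs ! 0 = v then X [xs ! 1, xs ! 2, xs ! 3] else 0)
      - (if xs ! 1 = v then X [xs ! 0, xs ! 2, xs ! 3] else 0)
      + (if xs ! 2 = v then X [xs ! 0, xs ! 1, xs ! 3] else 0)
      - (if xs ! 3 = v then X [xs ! 0, xs ! 1, xs ! 2] else 0) else 0)"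

lemma cone_simp: "cone v X [a,b,c,d] =
   (if a = v then X [b,c,d] else 0) - (if b = v then X [a,c,d] else 0)
      + (if c = v then X [a,b,d] else 0) - (if d = v then X [a,b,c] else 0)"
  by (simp add: cone_def numeral_eq_Suc)

lemma cone_nz: "cone v X xs \<noteq> 0 \<Longrightarrow> length xs = 4"
  by (simp add: cone_def split: if_splits)

lemma cone_chain:
  assumes "X \<in> chains \<Omega> 2" "v \<in> \<Omega>"
  shows "cone v X \<in> chains \<Omega> 3"
proof (rule chains3I)
  note sw = chains2_swap[OF assms(1)]
  fix xs assume nz: "cone v X xs \<noteq> 0"
  then obtain a b c d where xs: "xs = [a,b,c,d]" using cone_nz length_4E by metis
  have "X zs = 0 \<or> set zs \<subseteq> \<Omega>" for zs using chains_supp(3)[OF assms(1)] by blast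
  from this[of "[b,c,d]"] this[of "[a,c,d]"] this[of "[a,b,d]"] this[of "[a,b,c]"]
  show "length xs = 4 \<and> set xs \<subseteq> \<Omega>"
    using nz assms(2) by (auto simp: cone_simp xs split: if_splits)
next
  have sw: "X [v,u,w] = - X [u,v,w]" "X [u,w,v] = - X [u,v,w]" for u v w
    by (rule chains2_swap[OF assms(1)])+
  fix a b c d
  show "cone v X [b,a,c,d] = - cone v X [a,b,c,d]"
    using sw(1)[of b a c] sw(1)[of b a d] by (simp add: cone_simp)
  show "cone v X [a,c,b,d] = - cone v X [a,b,c,d]"
    using sw(1)[of c b d] sw(2)[of a c b] by (simp add: cone_simp)
  show "cone v X [a,b,d,c] = - cone v X [a,b,c,d]"
    using sw(2)[of a d c] sw(2)[of b d c] by (simp add: cone_simp)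
qed

lemma boundary_cone:
  assumes fin: "finite \<Omega>" and X: "X \<in> chains \<Omega> 2" "v \<in> \<Omega>" "boundary \<Omega> X = (\<lambda>_. 0)"
  shows "boundary \<Omega> (cone v X) = X"
proof
  fix ys
  show "boundary \<Omega> (cone v X) ys = X ys"
  proof (cases "length ys = 3")
    case False
    have "boundary \<Omega> (cone v X) \<in> chains \<Omega> 2" using chains_boundary[of "cone v X" \<Omega> 2] cone_chain[OF X(1,2)] by simp
    then show ?thesis using False chains_supp(1)[OF X(1), of ys] chains_supp(1)[of _ \<Omega> 2 ys]
      by force
  next
    case True
    then obtain b c d where ys: "ys = [b,c,d]" by (rule length_3E)
    \<comment> \<open>The terms in which \<open>v\<close> is one of \<open>b\<close>,
      \<open>c\<close>, \<open>d\<close> sum to boundary coefficients of \<open>X\<close>; only the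
      term that adds \<open>v\<close> survives.\<close>
    have z: "(\<Sum>a\<in>\<Omega>. X [a,x,y]) = 0" for x y
      using X(3) by (auto simp: boundary_def fun_eq_iff)
    have z': "(\<Sum>a\<in>\<Omega>. if P then X [a,x,y] else 0) = 0" for x y P
      using z by (cases P) auto
    have "boundary \<Omega> (cone v X) ys = (\<Sum>a\<in>\<Omega>. if a = v then X [b,c,d] else 0)
       - (\<Sum>a\<in>\<Omega>. if b = v then X [a,c,d] else 0)
       + (\<Sum>a\<in>\<Omega>. if c = v then X [a,b,d] else 0) - (\<Sum>a\<in>\<Omega>. if d = v then X [a,b,c] else 0)"
      by (simp add: boundary_def ys cone_simp sum.distrib sum_subtractf)
    then show ?thesis using fin X(2) ys by (simp add: z')
  qed
qed

section \<open>Homological 2-spheres\<close>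

lemma chains2_values:
  assumes "X \<in> chains \<Omega> 2" "X [a,b,c] = k"
  shows "X [b,a,c] = - k" "X [a,c,b] = - k" "X [c,b,a] = - k" "X [b,c,a] = k" "X [c,a,b] = k" "X [a,b,c] = k"
  using chains2_swap[OF assms(1), of b a c] assms(2) by auto

lemma boundary_single:
  assumes "finite \<Omega>" "t \<in> \<Omega>" "\<And>s. s \<in> \<Omega> \<Longrightarrow> s \<noteq> t \<Longrightarrow> c (s # ys) = 0"
  shows "boundary \<Omega> c ys = c (t # ys)"
proof -
  have "boundary \<Omega> c ys = (\<Sum>s\<in>{t}. c (s # ys))"
    unfolding boundary_def using assms by (intro sum.mono_neutral_right) auto
  then show ?thesis by simp
qed

text \<open>The axiom link says that links of vertices are connected, and h1 that the first integral
  cohomology group of the surface vanishes.\<close>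

locale sphere_cycle =
  fixes \<Omega> :: "'v set" and X :: "'v list \<Rightarrow> int"
  assumes fin: "finite \<Omega>"
    and X: "X \<in> chains \<Omega> 2"
    and cyc: "boundary \<Omega> X = (\<lambda>_. 0)"
    and le1: "\<bar>X xs\<bar> \<le> 1"
    and uniq: "X [u,v,w] = 1 \<Longrightarrow> X [u,v,w'] = 1 \<Longrightarrow> w = w'"
    and link: "(\<And>a b. X [v,a,b] \<noteq> 0 \<Longrightarrow> g a = g b) \<Longrightarrow> X [v,u,u'] \<noteq> 0 \<Longrightarrow> X [v,w,w'] \<noteq> 0
       \<Longrightarrow> (g :: 'v \<Rightarrow> bool) u = g w"
    and h1: "(\<And>u v. \<phi> v u = - \<phi> u v) \<Longrightarrow> (\<And>u v w. X [u,v,w] \<noteq> 0 \<Longrightarrow> \<phi> u v + \<phi> v w + \<phi> w u = 0)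
       \<Longrightarrow> \<exists>h :: 'v \<Rightarrow> int. \<forall>u v w. X [u,v,w] \<noteq> 0 \<longrightarrow> \<phi> u v = h v - h u"
begin

lemmas sw = chains2_swap[OF X]
lemmas vals = chains2_values[OF X]

lemma nzD:
  assumes "X [u,v,w] \<noteq> 0"
  shows "u \<noteq> v" "u \<noteq> w" "v \<noteq> w" "u \<in> \<Omega>" "v \<in> \<Omega>" "w \<in> \<Omega>" "X [u,v,w] = 1 \<or> X [u,v,w] = -1"
  using chains_supp[OF X assms] le1[of "[u,v,w]"] assms by auto

lemma nz_perm:
  assumes "X [u,v,w] \<noteq> 0"
  shows "X [v,u,w] \<noteq> 0" "X [u,w,v] \<noteq> 0" "X [w,v,u] \<noteq> 0" "X [v,w,u] \<noteq> 0" "X [w,u,v] \<noteq> 0"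
  using assms vals[of u v w "X [u,v,w]"] by auto

lemma set_perm:
  assumes "{u,v,w} = {a,b,c}" "distinct [a,b,c]"
  shows "(X [u,v,w] \<noteq> 0) = (X [a,b,c] \<noteq> 0)"
proof -
  have "card (set [u,v,w]) = length [u,v,w]" using assms by simp
  then have "distinct [u,v,w]" by (rule card_distinct)
  then have "\<bar>X [u,v,w]\<bar> = \<bar>X [a,b,c]\<bar>"
    using abs_coeff_eq[OF X, of "[u,v,w]"] abs_coeff_eq[OF X assms(2)] assms(1) by simp
  then show ?thesis by auto
qed

lemma uniq': "X [u,v,w] = -1 \<Longrightarrow> X [u,v,w'] = -1 \<Longrightarrow> w = w'"
  using uniq[of v u w w'] sw(1)[of v u w] sw(1)[of v u w'] by auto

section \<open>Links of vertices and a discrete Jordan curve theorem\<close>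

lemma opp:
  assumes "X [u,v,w] = 1"
  obtains w' where "X [u,v,w'] = -1"
proof -
  have "\<exists>t\<in>\<Omega>. X [t,u,v] < 0"
  proof (rule ccontr)
    assume "\<not> ?thesis"
    then have nn: "\<forall>t\<in>\<Omega>. 0 \<le> X [t,u,v]" by auto
    have "(\<Sum>t\<in>\<Omega>. X [t,u,v]) = 0" using cyc by (auto simp: boundary_def fun_eq_iff)
    then have "\<forall>t\<in>\<Omega>. X [t,u,v] = 0" using nn fin by (simp add: sum_nonneg_eq_0_iff)
    moreover have "X [w,u,v] = 1" "w \<in> \<Omega>" using vals[OF assms] nzD[of u v w] assms by auto
    ultimately show False by auto
  qed
  then obtain t where "X [t,u,v] < 0" by auto
  then have "X [t,u,v] = -1" using le1[of "[t,u,v]"] by auto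
  then show ?thesis using that vals(4) by blast
qed

lemma edge_pm:
  assumes "X [u,v,w] \<noteq> 0"
  obtains p q where "X [u,v,p] = 1" "X [u,v,q] = -1"
proof (cases "X [u,v,w] = 1")
  case True
  then show ?thesis using opp that by metis
next
  case False
  then have m: "X [u,v,w] = -1" using nzD(7)[OF assms] by auto
  have "X [v,u,w] = 1" using vals(1)[OF m] by simp
  then obtain w' where w': "X [v,u,w'] = -1" by (rule opp)
  have "X [u,v,w'] = 1" using vals(1)[OF w'] by simp
  then show ?thesis using m that by blast
qed

text \<open>The positive triangles at \<open>v\<close> define a successor map on the link, injective
  by \<open>uniq\<close>, and \<open>link\<close> makes it one cycle. \<open>L\<close> is the open
  arc from \<open>x\<close> forward to \<open>b\<close>. Thus the successor of \<open>x\<close> and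
  the predecessor of \<open>b\<close> belong to it unless the arc is empty, while the successor of
  \<open>b\<close> and the predecessor of \<open>x\<close> do not.\<close>

lemma link_arc:
  assumes b: "X [v,b,b'] \<noteq> 0" and x: "X [v,x,x'] \<noteq> 0" and bx: "b \<noteq> x"
  obtains L where "v \<notin> L" "b \<notin> L" "x \<notin> L"
    "\<And>a c. X [v,a,c] \<noteq> 0 \<Longrightarrow> a \<notin> {b,x} \<Longrightarrow> c \<notin> {b,x} \<Longrightarrow> a \<in> L \<longleftrightarrow> c \<in> L"
    "\<And>p. X [v,x,p] = 1 \<Longrightarrow> p \<noteq> b \<Longrightarrow> p \<in> L" "\<And>p. X [v,p,b] = 1 \<Longrightarrow> p \<noteq> x \<Longrightarrow> p \<in> L"
    "\<And>q. X [v,b,q] = 1 \<Longrightarrow> q \<notin> L" "\<And>q. X [v,q,x] = 1 \<Longrightarrow> q \<notin> L"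
proof -
  define s where "s u = (SOME w. X [v,u,w] = 1)" for u
  have s_eq: "s u = w" if "X [v,u,w] = 1" for u w
    unfolding s_def using that uniq by (intro some_equality) auto
  have s1: "X [v,u,s u] = 1" if nzu: "X [v,u,w] \<noteq> 0" for u w
  proof -
    obtain p q where "X [v,u,p] = 1" "X [v,u,q] = -1" using nzu by (rule edge_pm)
    then show ?thesis using s_eq by blast
  qed
  have pre: "a = a'" if "X [v,a,c] = 1" "X [v,a',c] = 1" for a a' c
    using uniq[of c v a a'] vals(5) that by blast
  define f where "f i = (s ^^ i) x" for i
  have f0: "f 0 = x" and fS: "f (Suc i) = s (f i)" for i by (simp_all add: f_def)
  have nz: "X [v, f i, f (Suc i)] = 1" for i
  proof (induction i)
    case 0 then show ?case using s1[OF x] by (simp add: f0 fS)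
  next
    case (Suc i)
    then have "X [v, f (Suc i), f i] \<noteq> 0" using vals(2)[OF Suc] by simp
    from s1[OF this] show ?case by (simp add: fS)
  qed
  define R where "R = range f"
  have RO: "R \<subseteq> \<Omega>"
  proof
    fix r assume "r \<in> R"
    then obtain i where "r = f i" by (auto simp: R_def)
    then show "r \<in> \<Omega>" using nzD(5)[of v "f i" "f (Suc i)"] nz[of i] by simp
  qed
  have finR: "finite R" using finite_subset[OF RO fin] .
  have sR: "s ` R \<subseteq> R" using fS by (auto simp: R_def) (metis rangeI)
  \<comment> \<open>An injective self-map of a finite set is onto, so the forward orbit of
    \<open>x\<close> is closed under predecessors too.\<close>
  have "inj_on s R"
  proof (rule inj_onI)
    fix r r' assume "r \<in> R" "r' \<in> R" "s r = s r'"
    then obtain i j where "r = f i" "r' = f j" "f (Suc i) = f (Suc j)" by (auto simp: R_def fS)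
    then show "r = r'" using nz[of i] nz[of j] pre by metis
  qed
  then have surj: "s ` R = R" using endo_inj_surj[OF finR sR] by simp
  have step: "a \<in> R \<longleftrightarrow> c \<in> R" if ac: "X [v,a,c] = 1" for a c
  proof
    assume "a \<in> R" then show "c \<in> R" using s_eq[OF ac] sR by auto
  next
    assume "c \<in> R"
    then obtain i where "c = s (f i)" using surj by (auto simp: R_def)
    then have "X [v, f i, c] = 1" using nz[of i] by (simp add: fS)
    then show "a \<in> R" using pre[OF ac] by (simp add: R_def)
  qed
  \<comment> \<open>Membership in the orbit is constant along link edges; connectedness of the link
    therefore puts \<open>b\<close> on the orbit.\<close>
  have "(b \<in> R) = (x \<in> R)"
  proof (rule link[where g = "\<lambda>t. t \<in> R", OF _ b x])
    fix a c assume nzac: "X [v,a,c] \<noteq> 0"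
    then consider "X [v,a,c] = 1" | "X [v,a,c] = -1" using nzD(7) by blast
    then show "(a \<in> R) = (c \<in> R)"
    proof cases
      case 2
      then have "X [v,c,a] = 1" using vals(2)[OF 2] by simp
      then show ?thesis using step by blast
    qed (use step in blast)
  qed
  then have "\<exists>k. f k = b" using f0 by (auto simp: R_def)
  define k where "k = (LEAST k. f k = b)"
  have k: "f k = b" unfolding k_def using \<open>\<exists>k. f k = b\<close> by (rule LeastI_ex)
  have kmin: "f i \<noteq> b" if "i < k" for i using that not_less_Least unfolding k_def by blast
  have k0: "k \<noteq> 0" using k f0 bx by (metis)
  have shift: "f (i + n) = f (j + n)" if "f i = f j" for i j n
    using that by (induction n) (simp_all add: fS)
  define L where "L = f ` {0<..<k}"
  \<comment> \<open>Returning to \<open>x\<close> by the time \<open>b\<close> is first reached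
    would make \<open>b\<close> occur earlier still.\<close>
  have xL: "f j \<noteq> x" if "0 < j" "j \<le> k" for j
  proof
    assume "f j = x"
    then have "f (0 + (k - j)) = f (j + (k - j))" using f0 by (intro shift) simp
    then show False using kmin[of "k - j"] k that by simp
  qed
  have edge: "a \<in> L \<longleftrightarrow> c \<in> L" if ac: "X [v,a,c] = 1" "a \<notin> {b,x}" "c \<notin> {b,x}" for a c
  proof
    assume "a \<in> L"
    then obtain i where i: "0 < i" "i < k" "a = f i" by (auto simp: L_def)
    then have c: "c = f (Suc i)" using s_eq[OF ac(1)] by (simp add: fS)
    then have "Suc i \<noteq> k" using ac k by auto
    then show "c \<in> L" using c i by (auto simp: L_def)
  next
    assume "c \<in> L"
    then obtain i where i: "0 < i" "i < k" "c = f i" by (auto simp: L_def)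
    then obtain j where j: "i = Suc j" by (metis gr0_conv_Suc)
    then have "a = f j" using pre[OF ac(1)] nz[of j] i by simp
    moreover then have "j \<noteq> 0" using ac(2) by (intro notI) (simp add: f0)
    ultimately show "a \<in> L" using i j by (auto simp: L_def)
  qed
  show ?thesis
  proof (rule that[of L])
    have "v \<noteq> f i" for i using nz[of i] nzD(1)[of v "f i" "f (Suc i)"] by simp
    then show "v \<notin> L" by (auto simp: L_def)
    show "b \<notin> L"
    proof
      assume "b \<in> L"
      then obtain i where "i < k" "b = f i" by (auto simp: L_def)
      then show False using kmin[of i] by simp
    qed
    show "x \<notin> L"
    proof
      assume "x \<in> L"
      then obtain i where "0 < i" "i < k" "x = f i" by (auto simp: L_def)
      then show False using xL[of i] by simp
    qed
    show "a \<in> L \<longleftrightarrow> c \<in> L" if "X [v,a,c] \<noteq> 0" "a \<notin> {b,x}" "c \<notin> {b,x}" for a c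
    proof (cases "X [v,a,c] = 1")
      case False
      then have m: "X [v,a,c] = -1" using nzD(7)[OF that(1)] by simp
      have "X [v,c,a] = 1" using vals(2)[OF m] by simp
      then show ?thesis using edge that by blast
    qed (use edge that in blast)
    show "p \<in> L" if "X [v,x,p] = 1" "p \<noteq> b" for p
    proof -
      have p: "p = f 1" using s_eq[OF that(1)] fS[of 0] f0 by simp
      then have "k \<noteq> 1" using k that by auto
      then show ?thesis using p k0 by (auto simp: L_def)
    qed
    show "p \<in> L" if "X [v,p,b] = 1" "p \<noteq> x" for p
    proof -
      obtain j where j: "k = Suc j" using k0 by (metis not0_implies_Suc)
      then have "p = f j" using pre[OF that(1)] nz[of j] k by simp
      moreover then have "j \<noteq> 0" using that(2) by (intro notI) (simp add: f0)
      ultimately show ?thesis using j by (auto simp: L_def)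
    qed
    show "q \<notin> L" if "X [v,b,q] = 1" for q
    proof
      assume "q \<in> L"
      then obtain i where i: "0 < i" "i < k" "q = f i" by (auto simp: L_def)
      then obtain j where j: "i = Suc j" by (metis gr0_conv_Suc)
      then have "b = f j" using pre[OF that] nz[of j] i by simp
      then show False using kmin[of j] i j by simp
    qed
    show "q \<notin> L" if "X [v,q,x] = 1" for q
    proof
      assume "q \<in> L"
      then obtain i where i: "0 < i" "i < k" "q = f i" by (auto simp: L_def)
      then have "x = f (Suc i)" using s_eq[OF that] by (simp add: fS)
      then show False using xL[of "Suc i"] i by simp
    qed
  qed
qed

text \<open>The cocycle counts crossings of an edge path with the triangle pushed off to its left; its
  potential distinguishes the two sides.\<close>

lemma separation:
  assumes bc: "X [b,c,t1] \<noteq> 0" and cx: "X [c,x,t2] \<noteq> 0" and xb: "X [x,b,t3] \<noteq> 0"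
    and empty: "X [b,c,x] = 0"
  obtains H where "b \<notin> H" "c \<notin> H" "x \<notin> H"
    "\<And>u v w. X [u,v,w] \<noteq> 0 \<Longrightarrow> u \<in> H \<Longrightarrow> v \<notin> {b,c,x} \<Longrightarrow> v \<in> H"
    "\<And>u v p. (u,v) \<in> {(b,c),(c,x),(x,b)} \<Longrightarrow> X [u,v,p] = 1 \<Longrightarrow> p \<in> H"
    "\<And>u v p. (u,v) \<in> {(b,c),(c,x),(x,b)} \<Longrightarrow> X [u,v,p] = -1 \<Longrightarrow> p \<notin> H"
proof -
  have d: "b \<noteq> c" "c \<noteq> x" "b \<noteq> x" using nzD(1)[OF bc] nzD(1)[OF cx] nzD(1)[OF xb] by auto
  note em = vals[OF empty]
  \<comment> \<open>The arc in the link of \<open>b\<close> from \<open>c\<close> to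
    \<open>x\<close>. This order of the arguments, and its two rotations below, put all three arcs
    on the left of the path from \<open>b\<close> via \<open>c\<close> and \<open>x\<close> back to
    \<open>b\<close>.\<close>
  obtain Lb where Lb: "b \<notin> Lb" "x \<notin> Lb" "c \<notin> Lb"
    "\<And>a d. X [b,a,d] \<noteq> 0 \<Longrightarrow> a \<notin> {x,c} \<Longrightarrow> d \<notin> {x,c} \<Longrightarrow> a \<in> Lb \<longleftrightarrow> d \<in> Lb"
    "\<And>p. X [b,c,p] = 1 \<Longrightarrow> p \<noteq> x \<Longrightarrow> p \<in> Lb" "\<And>p. X [b,p,x] = 1 \<Longrightarrow> p \<noteq> c \<Longrightarrow> p \<in> Lb"
    "\<And>q. X [b,x,q] = 1 \<Longrightarrow> q \<notin> Lb" "\<And>q. X [b,q,c] = 1 \<Longrightarrow> q \<notin> Lb"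
    by (rule link_arc[OF nz_perm(1)[OF xb] bc d(2)[symmetric]]) (rule that)
  obtain Lc where Lc: "c \<notin> Lc" "b \<notin> Lc" "x \<notin> Lc"
    "\<And>a d. X [c,a,d] \<noteq> 0 \<Longrightarrow> a \<notin> {b,x} \<Longrightarrow> d \<notin> {b,x} \<Longrightarrow> a \<in> Lc \<longleftrightarrow> d \<in> Lc"
    "\<And>p. X [c,x,p] = 1 \<Longrightarrow> p \<noteq> b \<Longrightarrow> p \<in> Lc" "\<And>p. X [c,p,b] = 1 \<Longrightarrow> p \<noteq> x \<Longrightarrow> p \<in> Lc"
    "\<And>q. X [c,b,q] = 1 \<Longrightarrow> q \<notin> Lc" "\<And>q. X [c,q,x] = 1 \<Longrightarrow> q \<notin> Lc"
    by (rule link_arc[OF nz_perm(1)[OF bc] cx d(3)]) (rule that)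
  obtain Lx where Lx: "x \<notin> Lx" "c \<notin> Lx" "b \<notin> Lx"
    "\<And>a d. X [x,a,d] \<noteq> 0 \<Longrightarrow> a \<notin> {c,b} \<Longrightarrow> d \<notin> {c,b} \<Longrightarrow> a \<in> Lx \<longleftrightarrow> d \<in> Lx"
    "\<And>p. X [x,b,p] = 1 \<Longrightarrow> p \<noteq> c \<Longrightarrow> p \<in> Lx" "\<And>p. X [x,p,c] = 1 \<Longrightarrow> p \<noteq> b \<Longrightarrow> p \<in> Lx"
    "\<And>q. X [x,c,q] = 1 \<Longrightarrow> q \<notin> Lx" "\<And>q. X [x,q,b] = 1 \<Longrightarrow> q \<notin> Lx"
    by (rule link_arc[OF nz_perm(1)[OF cx] xb d(1)[symmetric]]) (rule that)
  define G where "G = {b,c,x}"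
  define L where "L u = (if u = b then Lb else if u = c then Lc else if u = x then Lx else {})" for u
  have L_simps: "L b = Lb" "L c = Lc" "L x = Lx" using d by (auto simp: L_def)
  have third: "w \<notin> G" if "(u,v) \<in> {(b,c),(c,x),(x,b)}" "X [u,v,w] \<noteq> 0" for u v w
    using that em nzD(1-3)[OF that(2)] by (auto simp: G_def)
  have left: "w \<in> L u \<and> w \<in> L v" if "(u,v) \<in> {(b,c),(c,x),(x,b)}" "X [u,v,w] = 1" for u v w
  proof -
    have "w \<notin> G" using third[OF that(1)] that(2) by simp
    then show ?thesis using that(1) vals[OF that(2)] that(2) Lb(5,6) Lc(5,6) Lx(5,6)
      by (auto simp: L_simps G_def)
  qed
  have right: "w \<notin> L u \<and> w \<notin> L v" if "(u,v) \<in> {(b,c),(c,x),(x,b)}" "X [u,v,w] = -1" for u v w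
    using that(1) vals[OF that(2)] Lb(7,8) Lc(7,8) Lx(7,8)
    by (auto simp: L_simps)
  have F2': "w \<in> L u \<longleftrightarrow> w \<in> L v" if "(u,v) \<in> {(b,c),(c,x),(x,b)}" "X [u,v,w] \<noteq> 0" for u v w
    using nzD(7)[OF that(2)] left[OF that(1)] right[OF that(1)] by blast
  have F2: "w \<in> L u \<longleftrightarrow> w \<in> L v" if "u \<in> G" "v \<in> G" "X [u,v,w] \<noteq> 0" for u v w
  proof -
    have "(u,v) \<in> {(b,c),(c,x),(x,b)} \<or> (v,u) \<in> {(b,c),(c,x),(x,b)}"
      using that nzD(1)[OF that(3)] by (auto simp: G_def)
    then show ?thesis using F2'[of u v w] F2'[of v u w] that(3) nz_perm(1)[OF that(3)] by blast
  qed
  have F2G: "w \<notin> G" if "u \<in> G" "v \<in> G" "X [u,v,w] \<noteq> 0" for u v w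
  proof -
    have "(u,v) \<in> {(b,c),(c,x),(x,b)} \<or> (v,u) \<in> {(b,c),(c,x),(x,b)}"
      using that nzD(1)[OF that(3)] by (auto simp: G_def)
    then show ?thesis using third[of u v w] third[of v u w] that(3) nz_perm(1)[OF that(3)] by blast
  qed
  have F1: "v \<in> L u \<longleftrightarrow> w \<in> L u" if "u \<in> G" "v \<notin> G" "w \<notin> G" "X [u,v,w] \<noteq> 0" for u v w
    using that Lb(4) Lc(4) Lx(4) by (auto simp: G_def L_simps)
  have F3: "a \<notin> L u" if "a \<in> G" for a u
    using that Lb Lc Lx by (auto simp: G_def L_def)
  have F4: "L u = {}" if "u \<notin> G" for u
    using that by (auto simp: G_def L_def)
  define \<phi> :: "'v \<Rightarrow> 'v \<Rightarrow> int" where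
    "\<phi> u v = (if v \<in> L u then 1 else 0) - (if u \<in> L v then 1 else 0)" for u v
  have "\<exists>h :: 'v \<Rightarrow> int. \<forall>u v w. X [u,v,w] \<noteq> 0 \<longrightarrow> \<phi> u v = h v - h u"
  proof (rule h1)
    fix u v w assume nz: "X [u,v,w] \<noteq> 0"
    note nzs = nz nz_perm[OF nz]
    \<comment> \<open>By \<open>F2G\<close> no face has all its vertices in \<open>G\<close>, so
      every face can be rotated until its last vertex lies outside \<open>G\<close>; this case
      suffices.\<close>
    have rel: "\<phi> u v + \<phi> v w + \<phi> w u = 0" if nz: "X [u,v,w] \<noteq> 0" and w: "w \<notin> G" for u v w
    proof -
      consider "u \<in> G" "v \<in> G" | "u \<in> G" "v \<notin> G" | "u \<notin> G" "v \<in> G" | "u \<notin> G" "v \<notin> G" by blast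
      then show ?thesis
      proof cases
        case 1
        then show ?thesis using F2[OF 1 nz] F3[OF 1(1)] F3[OF 1(2)] F4[OF w] by (simp add: \<phi>_def)
      next
        case 2
        then show ?thesis using F1[OF 2 w nz] F4[OF 2(2)] F4[OF w] by (simp add: \<phi>_def)
      next
        case 3
        then show ?thesis using F1[OF 3(2,1) w nz_perm(1)[OF nz]] F4[OF 3(1)] F4[OF w]
          by (simp add: \<phi>_def)
      next
        case 4
        then show ?thesis using F4[OF 4(1)] F4[OF 4(2)] F4[OF w] by (simp add: \<phi>_def)
      qed
    qed
    show "\<phi> u v + \<phi> v w + \<phi> w u = 0"
    proof (cases "w \<in> G")
      case False
      then show ?thesis using rel nz by blast
    next
      case w: True
      show ?thesis
      proof (cases "u \<in> G")
        case True
        then have "v \<notin> G" using F2G[of w u v] w nzs by auto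
        then show ?thesis using rel[of w u v] nzs by auto
      next
        case False
        then show ?thesis using rel[of v w u] nzs by auto
      qed
    qed
  qed (simp add: \<phi>_def)
  then obtain h :: "'v \<Rightarrow> int" where h: "\<And>u v w. X [u,v,w] \<noteq> 0 \<Longrightarrow> \<phi> u v = h v - h u" by blast
  have hG: "h u = h b" if "u \<in> G" for u
  proof -
    have "\<phi> b c = 0" "\<phi> x b = 0" using F3 by (auto simp: \<phi>_def G_def)
    then show ?thesis using h[OF bc] h[OF xb] that by (auto simp: G_def)
  qed
  \<comment> \<open>The potential is constant on the triangle, because \<phi> vanishes on its edges,
    and rises by 1 on stepping off to the left. Away from the triangle \<phi> is 0, so the level set
    cannot be left except through the triangle.\<close>
  define H where "H = {v. v \<notin> G \<and> h v = h b + 1}"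
  show ?thesis
  proof (rule that[of H])
    show "b \<notin> H" "c \<notin> H" "x \<notin> H" by (auto simp: H_def G_def)
    show "v \<in> H" if "X [u,v,w] \<noteq> 0" "u \<in> H" "v \<notin> {b,c,x}" for u v w
    proof -
      have "u \<notin> G" "v \<notin> G" using that by (auto simp: H_def G_def)
      then have "\<phi> u v = 0" using F4 by (simp add: \<phi>_def)
      then show ?thesis using h[OF that(1)] that \<open>v \<notin> G\<close> by (simp add: H_def)
    qed
    show "p \<in> H" if uv: "(u,v) \<in> {(b,c),(c,x),(x,b)}" and 1: "X [u,v,p] = 1" for u v p
    proof -
      have p: "p \<notin> G" using third[OF uv] 1 by simp
      have "X [u,p,v] \<noteq> 0" using vals[OF 1] by simp
      moreover have "\<phi> u p = 1" using left[OF uv 1] F4[OF p] by (simp add: \<phi>_def)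
      moreover have "u \<in> G" using uv by (auto simp: G_def)
      ultimately show ?thesis using h[of u p v] hG[of u] p by (simp add: H_def)
    qed
    show "p \<notin> H" if uv: "(u,v) \<in> {(b,c),(c,x),(x,b)}" and 1: "X [u,v,p] = -1" for u v p
    proof -
      have p: "p \<notin> G" using third[OF uv] 1 by simp
      have "X [u,p,v] \<noteq> 0" using vals[OF 1] by simp
      moreover have "\<phi> u p = 0" using right[OF uv 1] F4[OF p] by (simp add: \<phi>_def)
      moreover have "u \<in> G" using uv by (auto simp: G_def)
      ultimately show ?thesis using h[of u p v] hG[of u] p by (simp add: H_def)
    qed
  qed
qed

section \<open>Cutting a sphere along an empty triangle\<close>

text \<open>\<open>E\<close> is the triangle, oriented so that subtracting it closes the part of
  \<open>X\<close> in \<open>A\<close>. The link and cohomology axioms are inherited by extending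
  functions and cocycles from this capped side to all of \<open>X\<close>. Its orientation is left
  open, as the two sides need opposite ones.\<close>

lemma sphere_cycle_side:
  assumes faces: "\<And>xs. X xs \<noteq> 0 \<Longrightarrow> set xs \<subseteq> A \<or> set xs \<subseteq> B" and AB: "A \<inter> B = {b,c,x}"
    and E: "E \<in> chains \<Omega> 2" "\<And>xs. E xs \<noteq> 0 \<Longrightarrow> set xs = {b,c,x}" "\<And>xs. \<bar>E xs\<bar> \<le> 1" "E [b,c,x] \<noteq> 0"
    and empty: "X [b,c,x] = 0"
    and edges: "X [b,c,t1] \<noteq> 0" "X [c,x,t2] \<noteq> 0" "X [x,b,t3] \<noteq> 0"
    and bd: "boundary \<Omega> (\<lambda>xs. if set xs \<subseteq> A then X xs else 0) = boundary \<Omega> E"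
  shows "sphere_cycle \<Omega> (\<lambda>xs. (if set xs \<subseteq> A then X xs else 0) - E xs)"
proof -
  define Y where "Y = (\<lambda>xs. if set xs \<subseteq> A then X xs else 0)"
  define Y' where "Y' = (\<lambda>xs. Y xs - E xs)"
  have Yc: "Y \<in> chains \<Omega> 2" unfolding Y_def by (rule chains_restrict[OF X])
  have Y'c: "Y' \<in> chains \<Omega> 2" unfolding Y'_def by (rule chains_diff[OF Yc E(1)])
  note Esw = chains2_swap[OF E(1)] and Evals = chains2_values[OF E(1)]
  define G where "G = {b,c,x}"
  have d: "distinct [b,c,x]" using chains_supp(2)[OF E(1) E(4)] .
  have GA: "G \<subseteq> A" using AB by (auto simp: G_def)
  have XG: "X xs = 0" if "set xs \<subseteq> G" for xs
  proof (rule ccontr)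
    assume nz: "X xs \<noteq> 0"
    then have "distinct xs" "length xs = 3" using chains_supp[OF X nz] by auto
    moreover then have "set xs = G" using that d by (intro card_subset_eq) (auto simp: G_def distinct_card)
    ultimately show False using abs_coeff_eq[OF X, of xs] abs_coeff_eq[OF X d] nz empty by (simp add: G_def)
  qed
  have EG: "E [u,v,w] \<noteq> 0" if "u \<in> G" "v \<in> G" "w \<in> G" "distinct [u,v,w]" for u v w
  proof -
    have "set [u,v,w] = G" using that d by (intro card_subset_eq) (auto simp: G_def)
    then show ?thesis using abs_coeff_eq[OF E(1) that(4)] abs_coeff_eq[OF E(1) d] E(4) by (simp add: G_def)
  qed
  have EnG: "set xs = G" if "E xs \<noteq> 0" for xs using E(2)[OF that] by (simp add: G_def)
  have Y'_cases: "Y' xs = (if set xs \<subseteq> G then - E xs else if set xs \<subseteq> A then X xs else 0)" for xs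
    using XG[of xs] EnG[of xs] GA by (auto simp: Y'_def Y_def)
  have XA: "set xs \<subseteq> A" if "X xs \<noteq> 0" "t \<in> set xs" "t \<notin> B" for xs t using faces[OF that(1)] that by auto
  have edgeG: "\<exists>t. X [u,v,t] \<noteq> 0" if "u \<in> G" "v \<in> G" "u \<noteq> v" for u v
    using that edges nz_perm(1)[OF edges(1)] nz_perm(1)[OF edges(2)] nz_perm(1)[OF edges(3)]
    by (auto simp: G_def)
  have "sphere_cycle \<Omega> Y'"
  proof
    show "finite \<Omega>" by (rule fin)
    show "Y' \<in> chains \<Omega> 2" by (rule Y'c)
    show "boundary \<Omega> Y' = (\<lambda>_. 0)" using bd by (simp add: Y'_def Y_def boundary_diff)
    show "\<bar>Y' xs\<bar> \<le> 1" for xs using le1[of xs] E(3)[of xs] by (auto simp: Y'_cases)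
  next
    fix u v w w' assume w: "Y' [u,v,w] = 1" and w': "Y' [u,v,w'] = 1"
    \<comment> \<open>The cap and a face of the side cannot carry the same sign on an edge: the cap
      forces boundary coefficient -1 of \<open>Y\<close> there, yet the face contributes 1 and the
      only other face at the edge at least -1.\<close>
    have key: False if w: "Y' [u,v,w] = 1" "{u,v,w} \<subseteq> G" and w': "Y' [u,v,w'] = 1" "\<not> {u,v,w'} \<subseteq> G" for w w'
    proof -
      have E1: "E [u,v,w] = -1" using w by (simp add: Y'_cases)
      have X1: "X [u,v,w'] = 1" "w' \<in> A" using w' by (auto simp: Y'_cases split: if_splits)
      obtain q where q: "X [u,v,q] = -1" using X1(1) by (rule opp)
      have "E [w,u,v] = -1" "w \<in> \<Omega>" using Evals(5)[OF E1] chains_supp(3)[OF E(1), of "[u,v,w]"] E1 by auto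
      moreover have "E [t,u,v] = 0" if "t \<noteq> w" for t
      proof (rule ccontr)
        assume nz: "E [t,u,v] \<noteq> 0"
        have "set [t,u,v] = set [w,u,v]" using EnG[OF nz] EnG[of "[w,u,v]"] \<open>E [w,u,v] = -1\<close> by simp
        then show False using that chains_supp(2)[OF E(1) nz] by auto
      qed
      ultimately have "boundary \<Omega> E [u,v] = -1" using boundary_single[of \<Omega> w E "[u,v]"] fin by simp
      then have "boundary \<Omega> Y [u,v] = -1" using bd by (simp add: Y_def)
      moreover have "boundary \<Omega> Y [u,v] \<ge> 0"
      proof -
        have "boundary \<Omega> Y [u,v] = (\<Sum>t\<in>{w',q}. Y [t,u,v])"
          unfolding boundary_def
        proof (rule sum.mono_neutral_right[OF fin])
          show "{w',q} \<subseteq> \<Omega>" using nzD(6)[of u v w'] nzD(6)[of u v q] X1 q by auto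
          show "\<forall>t\<in>\<Omega> - {w',q}. Y [t,u,v] = 0"
          proof
            fix t assume t: "t \<in> \<Omega> - {w',q}"
            have "X [u,v,t] = 0"
            proof (rule ccontr)
              assume "X [u,v,t] \<noteq> 0"
              then have "t = w' \<or> t = q" using nzD(7) uniq[OF X1(1)] uniq'[OF q] by blast
              then show False using t by auto
            qed
            then show "Y [t,u,v] = 0" using vals(5)[of u v t] by (simp add: Y_def)
          qed
        qed
        moreover have "w' \<noteq> q" using X1 q by auto
        moreover have "Y [w',u,v] = 1"
          using w' X1 vals(5)[OF X1(1)] GA that by (auto simp: Y_def Y'_cases split: if_splits)
        moreover have "Y [q,u,v] \<ge> -1" using vals(5)[OF q] by (simp add: Y_def)
        ultimately show ?thesis by simp
      qed
      ultimately show False by simp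
    qed
    show "w = w'"
    proof (cases "{u,v,w} \<subseteq> G")
      case True
      then have wG': "{u,v,w'} \<subseteq> G" using key[OF w True w'] by blast
      have "E [u,v,w] \<noteq> 0" "E [u,v,w'] \<noteq> 0" using w w' True wG' by (auto simp: Y'_cases)
      then have "set [u,v,w] = set [u,v,w']" "distinct [u,v,w]" "distinct [u,v,w']"
        using EnG chains_supp(2)[OF E(1)] by metis+
      then show ?thesis by auto
    next
      case False
      then have "\<not> {u,v,w'} \<subseteq> G" using key[OF w' _ w] by blast
      then have "X [u,v,w] = 1" "X [u,v,w'] = 1" using False w w' by (auto simp: Y'_cases split: if_splits)
      then show ?thesis by (rule uniq)
    qed
  next
    fix v u u' w w' and g :: "'v \<Rightarrow> bool"
    assume g: "\<And>a b. Y' [v,a,b] \<noteq> 0 \<Longrightarrow> g a = g b" and nz: "Y' [v,u,u'] \<noteq> 0" "Y' [v,w,w'] \<noteq> 0"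
    show "g u = g w"
    proof (cases "v \<in> G")
      case False
      then have vX: "X [v,p,q] \<noteq> 0" "v \<in> A" if "Y' [v,p,q] \<noteq> 0" for p q
        using that by (auto simp: Y'_cases split: if_splits)
      have vB: "v \<notin> B" using vX(2)[OF nz(1)] False AB by (auto simp: G_def)
      have "Y' [v,p,q] \<noteq> 0" if "X [v,p,q] \<noteq> 0" for p q
        using that False XA[OF that _ vB] by (auto simp: Y'_cases)
      then show ?thesis using link[of v g u u' w w'] vX nz g by blast
    next
      case True
      obtain y where y: "y \<in> G" "y \<noteq> v" using True d by (auto simp: G_def)
      have gy: "g z = g y" if "z \<in> G" "z \<noteq> v" for z
      proof (cases "z = y")
        case False
        then have "E [v,z,y] \<noteq> 0" using EG[of v z y] that y True by simp
        then have "Y' [v,z,y] \<noteq> 0" using that y True by (simp add: Y'_cases)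
        then show ?thesis by (rule g)
      qed simp
      \<comment> \<open>The cap joins the two other corners in the link of \<open>v\<close>, so
        \<open>g\<close> agrees on them. Continuing it by this value stays constant along the other
        side, which meets \<open>A\<close> only in corners.\<close>
      define g' where "g' t = (if t \<in> A then g t else g y)" for t
      have g'const: "g' p = g' q" if nz: "X [v,p,q] \<noteq> 0" for p q
      proof (cases "{v,p,q} \<subseteq> A")
        case True
        then have "Y' [v,p,q] \<noteq> 0" using nz XG[of "[v,p,q]"] by (auto simp: Y'_cases)
        then show ?thesis using g True by (simp add: g'_def)
      next
        case False
        then have "{v,p,q} \<subseteq> B" using faces[OF nz] by auto
        then have "p \<in> A \<Longrightarrow> p \<in> G" "q \<in> A \<Longrightarrow> q \<in> G" using AB by (auto simp: G_def)
        then show ?thesis using gy nzD(1,2)[OF nz] by (auto simp: g'_def)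
      qed
      have "\<exists>p. X [v,u,p] \<noteq> 0 \<and> u \<in> A" if "Y' [v,u,u'] \<noteq> 0" for u u'
      proof (cases "{v,u,u'} \<subseteq> G")
        case True
        then have "u \<noteq> v" using chains_supp(2)[OF Y'c that] by auto
        then show ?thesis using edgeG[of v u] True GA by auto
      next
        case False
        then show ?thesis using that by (auto simp: Y'_cases split: if_splits)
      qed
      then obtain p q where "X [v,u,p] \<noteq> 0" "u \<in> A" "X [v,w,q] \<noteq> 0" "w \<in> A" using nz by blast
      then show ?thesis using link[of v g' u p w q] g'const by (simp add: g'_def)
    qed
  next
    fix \<phi> :: "'v \<Rightarrow> 'v \<Rightarrow> int"
    assume anti: "\<And>u v. \<phi> v u = - \<phi> u v"
      and co: "\<And>u v w. Y' [u,v,w] \<noteq> 0 \<Longrightarrow> \<phi> u v + \<phi> v w + \<phi> w u = 0"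
    have z: "\<phi> u u = 0" for u using anti[of u u] by simp
    have coG: "\<phi> u v + \<phi> v w + \<phi> w u = 0" if "u \<in> G" "v \<in> G" "w \<in> G" for u v w
    proof (cases "distinct [u,v,w]")
      case True
      then have "Y' [u,v,w] \<noteq> 0" using EG[OF that True] that by (simp add: Y'_cases)
      then show ?thesis by (rule co)
    next
      case False
      then show ?thesis using z anti[of u v] anti[of u w] anti[of v w] by auto
    qed
    \<comment> \<open>Collapsing everything off \<open>A\<close> to the corner \<open>b\<close>
      sends the faces of the other side to triples of corners, where the cocycle condition is the
      one for the cap.\<close>
    define p where "p t = (if t \<in> A then t else b)" for t
    have "\<exists>h :: 'v \<Rightarrow> int. \<forall>u v w. X [u,v,w] \<noteq> 0 \<longrightarrow> \<phi> (p u) (p v) = h v - h u"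
    proof (rule h1)
      fix u v w assume nz: "X [u,v,w] \<noteq> 0"
      show "\<phi> (p u) (p v) + \<phi> (p v) (p w) + \<phi> (p w) (p u) = 0"
      proof (cases "{u,v,w} \<subseteq> A")
        case True
        then have "Y' [u,v,w] \<noteq> 0" using nz XG[of "[u,v,w]"] by (auto simp: Y'_cases)
        then show ?thesis using co True by (simp add: p_def)
      next
        case False
        then have "{u,v,w} \<subseteq> B" using faces[OF nz] by auto
        then have "p u \<in> G" "p v \<in> G" "p w \<in> G" using AB by (auto simp: G_def p_def)
        then show ?thesis by (rule coG)
      qed
    qed (rule anti)
    then obtain h :: "'v \<Rightarrow> int" where h: "\<And>u v w. X [u,v,w] \<noteq> 0 \<Longrightarrow> \<phi> (p u) (p v) = h v - h u" by blast
    have "\<phi> u v = h v - h u" if nz: "Y' [u,v,w] \<noteq> 0" for u v w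
    proof (cases "{u,v,w} \<subseteq> G")
      case True
      then have "u \<noteq> v" using chains_supp(2)[OF Y'c nz] by auto
      then obtain t where "X [u,v,t] \<noteq> 0" using edgeG[of u v] True by auto
      then show ?thesis using h[of u v t] True GA by (simp add: p_def subset_iff)
    next
      case False
      then have "X [u,v,w] \<noteq> 0" "u \<in> A" "v \<in> A" using nz by (auto simp: Y'_cases split: if_splits)
      then show ?thesis using h[of u v w] by (simp add: p_def)
    qed
    then show "\<exists>h :: 'v \<Rightarrow> int. \<forall>u v w. Y' [u,v,w] \<noteq> 0 \<longrightarrow> \<phi> u v = h v - h u" by blast
  qed
  then show ?thesis by (simp add: Y'_def Y_def)
qed

text \<open>\<open>A\<close> is the left side from \<open>separation\<close> together with the
  triangle. Along each edge of the triangle the left face lies in \<open>A\<close> and the right one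
  does not, so the faces in \<open>A\<close> have the boundary of \<open>[b,c,x]\<close>. Capping
  both sides with opposite copies of the triangle gives two cycles, and the caps cancel in the
  sum.\<close>

lemma split_triangle:
  assumes bc: "X [b,c,t1] \<noteq> 0" and cx: "X [c,x,t2] \<noteq> 0" and xb: "X [x,b,t3] \<noteq> 0"
    and empty: "X [b,c,x] = 0"
  obtains A B Y Z where "A \<union> B = \<Omega>" "A \<inter> B = {b,c,x}" "card (A \<inter> B) = 3"
    "sphere_cycle \<Omega> Y" "sphere_cycle \<Omega> Z" "X = (\<lambda>xs. Y xs + Z xs)"
    "\<forall>xs. Y xs \<noteq> 0 \<longrightarrow> set xs \<subseteq> A" "\<forall>xs. Z xs \<noteq> 0 \<longrightarrow> set xs \<subseteq> B"
    "Y [b,c,x] \<noteq> 0" "Z [b,c,x] \<noteq> 0"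
proof -
  obtain H where HG: "b \<notin> H" "c \<notin> H" "x \<notin> H"
    and Hadj: "\<And>u v w. X [u,v,w] \<noteq> 0 \<Longrightarrow> u \<in> H \<Longrightarrow> v \<notin> {b,c,x} \<Longrightarrow> v \<in> H"
    and left: "\<And>u v p. (u,v) \<in> {(b,c),(c,x),(x,b)} \<Longrightarrow> X [u,v,p] = 1 \<Longrightarrow> p \<in> H"
    and right: "\<And>u v p. (u,v) \<in> {(b,c),(c,x),(x,b)} \<Longrightarrow> X [u,v,p] = -1 \<Longrightarrow> p \<notin> H"
    by (rule separation[OF bc cx xb empty]) (rule that)
  have d: "distinct [b,c,x]" using nzD(1)[OF bc] nzD(1)[OF cx] nzD(1)[OF xb] by auto
  define G where "G = {b,c,x}"
  have G\<Omega>: "G \<subseteq> \<Omega>" using nzD[OF bc] nzD[OF cx] by (auto simp: G_def)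
  define A where "A = G \<union> (H \<inter> \<Omega>)"
  define B where "B = \<Omega> - H"
  have AB: "A \<union> B = \<Omega>" "A \<inter> B = {b,c,x}" using G\<Omega> HG by (auto simp: A_def B_def G_def)
  have c3: "card (A \<inter> B) = 3" using AB d by simp
  have Hface: "set xs \<subseteq> A" if nz: "X xs \<noteq> 0" and t: "t \<in> set xs" "t \<in> H" for xs t
  proof -
    have "length xs = 3" using chains_supp(1)[OF X nz] by simp
    then obtain u v w where xs: "xs = [u,v,w]" by (rule length_3E)
    note p = nz[unfolded xs] nz_perm[OF nz[unfolded xs]]
    have "s \<in> G \<or> s \<in> H" if "s \<in> set xs" for s
      using that t p Hadj unfolding xs G_def[symmetric] by auto
    then show ?thesis using chains_supp(3)[OF X nz] by (auto simp: A_def)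
  qed
  have faces: "set xs \<subseteq> A \<or> set xs \<subseteq> B" if "X xs \<noteq> 0" for xs
    using Hface[OF that] chains_supp(3)[OF X that] by (auto simp: B_def)
  define E where "E = osimplex [b,c,x]"
  have Ec: "E \<in> chains \<Omega> 2" unfolding E_def using d G\<Omega> by (intro osimplex_chain) (auto simp: G_def)
  have E1: "E [b,c,x] = 1" unfolding E_def by (rule osimplex_self[OF d])
  have ES: "set xs = {b,c,x}" if "E xs \<noteq> 0" for xs using osimplex_zero(1) that by (fastforce simp: E_def)
  have Ele: "\<bar>E xs\<bar> \<le> 1" for xs
  proof (cases "E xs = 0")
    case False
    then show ?thesis using osimplex_abs[OF d, of xs] chains_supp(2)[OF Ec False] ES[OF False] by (simp add: E_def)
  qed simp
  define Y where "Y = (\<lambda>xs. if set xs \<subseteq> A then X xs else 0)"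
  have Yc: "Y \<in> chains \<Omega> 2" unfolding Y_def by (rule chains_restrict[OF X])
  have Ep: "boundary \<Omega> E [u,v] = 1" if "(u,v) \<in> {(b,c),(c,x),(x,b)}" for u v
  proof -
    have "u = b \<and> v = c \<or> u = c \<and> v = x \<or> u = x \<and> v = b" using that by auto
    moreover have "b \<in> \<Omega>" "c \<in> \<Omega>" "x \<in> \<Omega>" using G\<Omega> by (auto simp: G_def)
    ultimately obtain w where w: "E [w,u,v] = 1" "w \<in> \<Omega>"
      using E1 chains2_values(4,5)[OF Ec E1] by metis
    have "E [t,u,v] = 0" if "t \<noteq> w" for t
    proof (rule ccontr)
      assume nz: "E [t,u,v] \<noteq> 0"
      have "set [t,u,v] = set [w,u,v]" using ES[OF nz] ES[of "[w,u,v]"] w by simp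
      then show False using that chains_supp(2)[OF Ec nz] by auto
    qed
    then show ?thesis using boundary_single[of \<Omega> w E "[u,v]"] fin w by simp
  qed
  have Yp: "boundary \<Omega> Y [u,v] = 1" if uv: "(u,v) \<in> {(b,c),(c,x),(x,b)}" for u v
  proof -
    obtain t where "X [u,v,t] \<noteq> 0" using uv bc cx xb by auto
    then obtain p q where p: "X [u,v,p] = 1" and q: "X [u,v,q] = -1" by (rule edge_pm)
    have uvG: "u \<in> G" "v \<in> G" "u \<noteq> v" using uv d by (auto simp: G_def)
    have pA: "p \<in> A" "p \<in> \<Omega>" using left[OF uv p] nzD(6)[of u v p] p by (auto simp: A_def)
    have "q \<notin> G"
    proof
      assume "q \<in> G"
      then have "{u,v,q} = {b,c,x}" using uv nzD[of u v q] q by (auto simp: G_def)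
      then show False using set_perm[OF _ d] q empty by auto
    qed
    then have qA: "q \<notin> A" using right[OF uv q] by (simp add: A_def)
    have "Y [t,u,v] = 0" if "t \<noteq> p" for t
    proof (rule ccontr)
      assume nz: "Y [t,u,v] \<noteq> 0"
      then have "t \<in> A" "X [t,u,v] \<noteq> 0" by (auto simp: Y_def split: if_splits)
      then have "X [u,v,t] \<noteq> 0" using nz_perm(4) by blast
      then show False using nzD(7) uniq[OF p] uniq'[OF q] that qA \<open>t \<in> A\<close> by blast
    qed
    moreover have "Y [p,u,v] = 1" using vals(5)[OF p] pA uvG by (auto simp: Y_def A_def)
    ultimately show ?thesis using boundary_single[of \<Omega> p Y "[u,v]"] fin pA by simp
  qed
  have bYc: "boundary \<Omega> Y \<in> chains \<Omega> 1" and bEc: "boundary \<Omega> E \<in> chains \<Omega> 1"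
    using Yc Ec chains_boundary[of _ \<Omega> 1] by (simp_all add: numeral_2_eq_2)
  have bd: "boundary \<Omega> Y = boundary \<Omega> E"
  proof
    fix ys
    show "boundary \<Omega> Y ys = boundary \<Omega> E ys"
    proof (cases "set ys \<subseteq> G")
      case False
      have E0: "boundary \<Omega> E ys = 0"
      proof (rule ccontr)
        assume "boundary \<Omega> E ys \<noteq> 0"
        then obtain t where "E (t # ys) \<noteq> 0" by (rule boundary_nz)
        then show False using ES False by (force simp: G_def)
      qed
      obtain s where s: "s \<in> set ys" "s \<notin> G" using False by auto
      show ?thesis
      proof (cases "s \<in> H")
        case True
        then have "Y (t # ys) = X (t # ys)" for t using Hface[of "t # ys" s] s by (auto simp: Y_def)
        then have "boundary \<Omega> Y ys = boundary \<Omega> X ys" by (simp add: boundary_def)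
        then show ?thesis using cyc E0 by simp
      next
        case False
        then have "Y (t # ys) = 0" for t using s by (auto simp: Y_def A_def)
        then show ?thesis using E0 by (simp add: boundary_def)
      qed
    next
      case True
      show ?thesis
      proof (cases "length ys = 2 \<and> distinct ys")
        case False
        then have "boundary \<Omega> Y ys = 0" "boundary \<Omega> E ys = 0"
          using chains_supp(1,2)[OF bYc, of ys] chains_supp(1,2)[OF bEc, of ys] by fastforce+
        then show ?thesis by simp
      next
        case l2: True
        then obtain u v where ys: "ys = [u,v]" by (auto simp: numeral_2_eq_2 length_Suc_conv)
        have "u \<noteq> v" using l2 ys by simp
        then have "(u,v) \<in> {(b,c),(c,x),(x,b)} \<or> (v,u) \<in> {(b,c),(c,x),(x,b)}"
          using True ys by (auto simp: G_def)
        then show ?thesis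
        proof
          assume "(u,v) \<in> {(b,c),(c,x),(x,b)}"
          then show ?thesis using Yp Ep ys by metis
        next
          assume vu: "(v,u) \<in> {(b,c),(c,x),(x,b)}"
          show ?thesis using chains_swap[OF bYc, of 0 1 "[v,u]"] chains_swap[OF bEc, of 0 1 "[v,u]"]
              Yp[OF vu] Ep[OF vu] ys by simp
        qed
      qed
    qed
  qed
  have YE: "sphere_cycle \<Omega> (\<lambda>xs. (if set xs \<subseteq> A then X xs else 0) - E xs)"
    using bd E1 by (intro sphere_cycle_side[OF faces AB(2) Ec ES Ele _ empty bc cx xb]) (auto simp: Y_def)
  \<comment> \<open>A face inside both sides would have the vertices \<open>b\<close>,
    \<open>c\<close>, \<open>x\<close>, and that triangle is empty.\<close>
  have XB: "(if set xs \<subseteq> B then X xs else 0) = X xs - Y xs" for xs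
  proof (cases "set xs \<subseteq> A \<and> set xs \<subseteq> B")
    case True
    have "X xs = 0"
    proof (rule ccontr)
      assume nz: "X xs \<noteq> 0"
      have "length xs = 3" using chains_supp(1)[OF X nz] by simp
      then obtain u v w where xs: "xs = [u,v,w]" by (rule length_3E)
      have "set xs = {b,c,x}" using True AB d chains_supp(2)[OF X nz] xs
        by (intro card_subset_eq) auto
      then show False using set_perm[OF _ d] nz empty xs by auto
    qed
    then show ?thesis by (simp add: Y_def)
  qed (use faces[of xs] in \<open>auto simp: Y_def\<close>)
  define mE where "mE = (\<lambda>xs. - E xs)"
  have mEc: "mE \<in> chains \<Omega> 2" using chains_diff[of "\<lambda>_. 0" \<Omega> 2 E] Ec by (simp add: mE_def chains_def)
  have bdZ: "boundary \<Omega> (\<lambda>xs. if set xs \<subseteq> B then X xs else 0) = boundary \<Omega> mE"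
  proof -
    have "boundary \<Omega> mE = (\<lambda>xs. - boundary \<Omega> E xs)" by (simp add: mE_def boundary_def sum_negf)
    then show ?thesis unfolding XB by (simp add: boundary_diff cyc bd)
  qed
  have ZE: "sphere_cycle \<Omega> (\<lambda>xs. (if set xs \<subseteq> B then X xs else 0) - mE xs)"
  proof (rule sphere_cycle_side[OF _ _ mEc _ _ _ empty bc cx xb bdZ])
    show "set xs \<subseteq> B \<or> set xs \<subseteq> A" if "X xs \<noteq> 0" for xs using faces[OF that] by auto
    show "B \<inter> A = {b,c,x}" using AB by auto
  qed (use ES Ele E1 in \<open>auto simp: mE_def\<close>)
  show ?thesis
  proof (rule that[OF AB c3 YE ZE])
    show "X = (\<lambda>xs. (if set xs \<subseteq> A then X xs else 0) - E xs + ((if set xs \<subseteq> B then X xs else 0) - mE xs))"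
      unfolding XB by (simp add: Y_def mE_def)
    have EA: "set xs \<subseteq> A \<inter> B" if "E xs \<noteq> 0" for xs using ES[OF that] AB by simp
    show "\<forall>xs. (if set xs \<subseteq> A then X xs else 0) - E xs \<noteq> 0 \<longrightarrow> set xs \<subseteq> A"
    proof (intro allI impI)
      fix xs assume "(if set xs \<subseteq> A then X xs else 0) - E xs \<noteq> 0"
      then show "set xs \<subseteq> A" using EA[of xs] by (cases "E xs = 0") (auto split: if_splits)
    qed
    show "\<forall>xs. (if set xs \<subseteq> B then X xs else 0) - mE xs \<noteq> 0 \<longrightarrow> set xs \<subseteq> B"
    proof (intro allI impI)
      fix xs assume "(if set xs \<subseteq> B then X xs else 0) - mE xs \<noteq> 0"
      then show "set xs \<subseteq> B" using EA[of xs] by (cases "E xs = 0") (auto simp: mE_def split: if_splits)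
    qed
    show "(if set [b,c,x] \<subseteq> A then X [b,c,x] else 0) - E [b,c,x] \<noteq> 0"
      "(if set [b,c,x] \<subseteq> B then X [b,c,x] else 0) - mE [b,c,x] \<noteq> 0"
      using empty E1 by (auto simp: mE_def)
  qed
qed

end

section \<open>Removing one tetrahedron: components and flips\<close>

lemma triple_mem: "{u,v,w} = S \<Longrightarrow> u \<in> S \<and> v \<in> S \<and> w \<in> S"
  by blast

text \<open>Fixes the convention for what follows: \<open>[b,c,d]\<close>, \<open>[a,d,c]\<close>,
  \<open>[a,b,d]\<close>, \<open>[a,c,b]\<close> are the faces in the orientation that the boundary
  counts as 1.\<close>

lemma boundary_tetrahedron:
  assumes fin: "finite \<Omega>" and d: "distinct [a,b,c,d]" and sub: "{a,b,c,d} \<subseteq> \<Omega>"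
  defines "T \<equiv> boundary \<Omega> (osimplex [a,b,c,d])"
  shows "T \<in> chains \<Omega> 2" "T [b,c,d] = 1" "T [a,d,c] = 1" "T [a,b,d] = 1" "T [a,c,b] = 1"
    "\<And>xs. T xs \<noteq> 0 \<Longrightarrow> set xs \<in> {{b,c,d},{a,c,d},{a,b,d},{a,b,c}}"
proof -
  define \<tau> where "\<tau> = osimplex [a,b,c,d]"
  have tc: "\<tau> \<in> chains \<Omega> 3" unfolding \<tau>_def using d sub by (intro osimplex_chain) auto
  then show Tc: "T \<in> chains \<Omega> 2" using chains_boundary[of \<tau> \<Omega> 2] by (simp add: T_def \<tau>_def)
  have tS: "set xs = {a,b,c,d}" if "\<tau> xs \<noteq> 0" for xs using osimplex_zero(1)[of "[a,b,c,d]" xs] that by (simp add: \<tau>_def)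
  have t0: "\<tau> [a,b,c,d] = 1" unfolding \<tau>_def by (rule osimplex_self[OF d])
  note s = chains3_swap[OF tc]
  have t1: "\<tau> [b,a,d,c] = 1" using s(1)[of b a d c] s(3)[of a b d c] t0 by simp
  have t2: "\<tau> [c,a,b,d] = 1" using s(1)[of c a b d] s(2)[of a c b d] t0 by simp
  have t3: "\<tau> [d,a,c,b] = 1"
    using s(1)[of d a c b] s(2)[of a d c b] s(3)[of a c d b] s(2)[of a c b d] t0 by simp
  have Tval: "T ys = 1" if "\<tau> (t # ys) = 1" for t ys
  proof -
    have "\<tau> (t' # ys) = 0" if "t' \<noteq> t" for t'
    proof (rule ccontr)
      assume nz: "\<tau> (t' # ys) \<noteq> 0"
      have "set (t' # ys) = set (t # ys)" using tS[OF nz] tS[of "t # ys"] \<open>\<tau> (t # ys) = 1\<close> by simp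
      moreover have "t' \<notin> set ys" "t \<notin> set ys"
        using chains_supp(2)[OF tc nz] chains_supp(2)[OF tc, of "t # ys"] \<open>\<tau> (t # ys) = 1\<close> by auto
      ultimately show False using that by auto
    qed
    moreover have "t \<in> \<Omega>" using chains_supp(3)[OF tc, of "t # ys"] that by auto
    ultimately show ?thesis using boundary_single[of \<Omega> t \<tau> ys] fin that by (simp add: T_def \<tau>_def)
  qed
  show "T [b,c,d] = 1" "T [a,d,c] = 1" "T [a,b,d] = 1" "T [a,c,b] = 1"
    using Tval[OF t0] Tval[OF t1] Tval[OF t2] Tval[OF t3] by simp_all
  fix xs assume "T xs \<noteq> 0"
  then obtain t where nz: "\<tau> (t # xs) \<noteq> 0" unfolding T_def \<tau>_def[symmetric] by (rule boundary_nz)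
  have "t \<notin> set xs" "insert t (set xs) = {a,b,c,d}" using tS[OF nz] chains_supp(2)[OF tc nz] by auto
  then have "t \<in> {a,b,c,d}" "set xs = {a,b,c,d} - {t}" by auto
  then show "set xs \<in> {{b,c,d},{a,c,d},{a,b,d},{a,b,c}}" using d by (elim insertE emptyE) auto
qed

context sphere_cycle
begin

text \<open>Each edge of the tetrahedron already has its two triangles among the four faces, so by
  \<open>uniq\<close> no other triangle contains it. By \<open>link\<close> no other triangle even
  touches one of its vertices: the four faces are a whole component.\<close>

lemma remove_component:
  assumes Q: "X [b,c,d] = 1" "X [a,d,c] = 1" "X [a,b,d] = 1" "X [a,c,b] = 1"
    and X'_def: "X' = (\<lambda>xs. X xs - boundary \<Omega> (osimplex [a,b,c,d]) xs)"
  shows "sphere_cycle \<Omega> X'" and "verts X' \<inter> {a,b,c,d} = {}"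
proof -
  have dist: "distinct [a,b,c,d]" and sub: "{a,b,c,d} \<subseteq> \<Omega>"
    using nzD[of b c d] nzD[of a d c] nzD[of a b d] Q by auto
  define T where "T = boundary \<Omega> (osimplex [a,b,c,d])"
  note T = boundary_tetrahedron[OF fin dist sub, folded T_def]
  define S where "S = {a,b,c,d}"
  note q = vals[OF Q(1)] vals[OF Q(2)] vals[OF Q(3)] vals[OF Q(4)]
  have ex: "\<exists>p\<in>S. X [u,v,p] = 1" "\<exists>p\<in>S. X [u,v,p] = -1" if "u \<in> S" "v \<in> S" "u \<noteq> v" for u v
    using that unfolding S_def by (elim insertE emptyE; simp add: q)+
  have adj: "t \<in> S" if "u \<in> S" "v \<in> S" "X [u,v,t] \<noteq> 0" for u v t
    using ex[OF that(1,2) nzD(1)[OF that(3)]] nzD(7)[OF that(3)] uniq uniq' by metis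
  have star: "t \<in> S" if uS: "u \<in> S" and nzt: "X [u,t,s] \<noteq> 0" for u t s
  proof -
    have "\<exists>p\<in>S. u \<noteq> p" using dist by (auto simp: S_def)
    then obtain p where p: "p \<in> S" "u \<noteq> p" by blast
    obtain p' where "X [u,p,p'] = 1" using ex(1)[OF uS p] by blast
    then have p': "X [u,p,p'] \<noteq> 0" by simp
    have "(t \<in> S) = (p \<in> S)"
    proof (rule link[OF _ nzt p'])
      fix a' b' assume nz: "X [u,a',b'] \<noteq> 0"
      show "(a' \<in> S) = (b' \<in> S)"
        using adj[OF uS _ nz] adj[OF uS _ nz_perm(2)[OF nz]] by blast
    qed
    then show ?thesis using p by simp
  qed
  have all: "{u,v,w} \<subseteq> S" if nza: "X [u,v,w] \<noteq> 0" and meet: "{u,v,w} \<inter> S \<noteq> {}" for u v w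
  proof -
    have r: "{u,v,w} \<subseteq> S" if "X [u,v,w] \<noteq> 0" "u \<in> S" for u v w
      using star[OF that(2,1)] star[OF that(2) nz_perm(2)[OF that(1)]] that by auto
    consider "u \<in> S" | "v \<in> S" | "w \<in> S" using meet by blast
    then show ?thesis
    proof cases
      case 1 then show ?thesis by (rule r[OF nza])
    next
      case 2 then show ?thesis using r[OF nz_perm(4)[OF nza]] by auto
    next
      case 3 then show ?thesis using r[OF nz_perm(5)[OF nza]] by auto
    qed
  qed
  note tv = chains2_values[OF T(1) T(2)] chains2_values[OF T(1) T(3)]
     chains2_values[OF T(1) T(4)] chains2_values[OF T(1) T(5)]
  have TX: "T [u,v,w] = X [u,v,w]" if S: "u \<in> S" "v \<in> S" "w \<in> S" for u v w
  proof (cases "distinct [u,v,w]")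
    case True
    then show ?thesis using S[unfolded S_def] dist
      by (elim insertE emptyE) (simp_all add: q tv)
  next
    case False
    then show ?thesis using chains_supp(2)[OF T(1)] chains_supp(2)[OF X] by metis
  qed
  have T0: "T [u,v,w] = 0" if "\<not> {u,v,w} \<subseteq> S" for u v w
    using T(6)[of "[u,v,w]"] that by (auto simp: S_def)
  have X'_eq: "X' [u,v,w] = (if {u,v,w} \<inter> S = {} then X [u,v,w] else 0)" for u v w
  proof (cases "{u,v,w} \<subseteq> S")
    case True
    then show ?thesis using TX by (auto simp: X'_def T_def[symmetric])
  next
    case False
    then show ?thesis using T0[OF False] all[of u v w] by (auto simp: X'_def T_def[symmetric])
  qed
  have X'c: "X' \<in> chains \<Omega> 2" unfolding X'_def T_def[symmetric] by (rule chains_diff[OF X T(1)])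
  show "sphere_cycle \<Omega> X'"
  proof
    show "finite \<Omega>" by (rule fin)
    show "X' \<in> chains \<Omega> 2" by (rule X'c)
    have "osimplex [a,b,c,d] \<in> chains \<Omega> 3" using dist sub by (intro osimplex_chain) auto
    then show "boundary \<Omega> X' = (\<lambda>_. 0)" by (simp add: X'_def boundary_diff cyc boundary_boundary3)
    show "\<bar>X' xs\<bar> \<le> 1" for xs
    proof (cases "length xs = 3")
      case True
      then obtain u v w where "xs = [u,v,w]" by (rule length_3E)
      then show ?thesis using X'_eq le1 by simp
    next
      case False
      then have "X' xs = 0" using chains_supp(1)[OF X'c, of xs] by auto
      then show ?thesis by simp
    qed
    show "w = w'" if "X' [u,v,w] = 1" "X' [u,v,w'] = 1" for u v w w'
      using that uniq[of u v w w'] by (auto simp: X'_eq split: if_splits)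
  next
    fix v u u' w w' and g :: "'v \<Rightarrow> bool"
    assume g: "\<And>a b. X' [v,a,b] \<noteq> 0 \<Longrightarrow> g a = g b" and nz: "X' [v,u,u'] \<noteq> 0" "X' [v,w,w'] \<noteq> 0"
    have nzX: "X [v,u,u'] \<noteq> 0" "X [v,w,w'] \<noteq> 0" "v \<notin> S" using nz by (auto simp: X'_eq split: if_splits)
    show "g u = g w"
    proof (rule link[OF _ nzX(1,2)])
      fix a b assume "X [v,a,b] \<noteq> 0"
      then have "X' [v,a,b] \<noteq> 0" using all[of v a b] nzX by (auto simp: X'_eq)
      then show "g a = g b" by (rule g)
    qed
  next
    fix \<phi> :: "'v \<Rightarrow> 'v \<Rightarrow> int"
    assume anti: "\<And>u v. \<phi> v u = - \<phi> u v"
      and co: "\<And>u v w. X' [u,v,w] \<noteq> 0 \<Longrightarrow> \<phi> u v + \<phi> v w + \<phi> w u = 0"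
    \<comment> \<open>Extension of the cocycle by 0 over the deleted component, which shares no
      vertex with the rest.\<close>
    define \<psi> where "\<psi> u v = (if u \<in> S \<or> v \<in> S then 0 else \<phi> u v)" for u v
    have "\<exists>h :: 'v \<Rightarrow> int. \<forall>u v w. X [u,v,w] \<noteq> 0 \<longrightarrow> \<psi> u v = h v - h u"
    proof (rule h1)
      show "\<psi> v u = - \<psi> u v" for u v using anti[of v u] by (auto simp: \<psi>_def)
      fix u v w assume nz: "X [u,v,w] \<noteq> 0"
      show "\<psi> u v + \<psi> v w + \<psi> w u = 0"
        using all[OF nz] co[of u v w] nz by (auto simp: \<psi>_def X'_eq)
    qed
    then obtain h :: "'v \<Rightarrow> int" where h: "\<And>u v w. X [u,v,w] \<noteq> 0 \<Longrightarrow> \<psi> u v = h v - h u" by blast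
    have "\<phi> u v = h v - h u" if "X' [u,v,w] \<noteq> 0" for u v w
      using that h[of u v w] by (auto simp: X'_eq \<psi>_def split: if_splits)
    then show "\<exists>h :: 'v \<Rightarrow> int. \<forall>u v w. X' [u,v,w] \<noteq> 0 \<longrightarrow> \<phi> u v = h v - h u" by blast
  qed
  show "verts X' \<inter> {a,b,c,d} = {}"
  proof (rule ccontr)
    assume "\<not> ?thesis"
    then obtain t xs where t: "t \<in> S" "X' xs \<noteq> 0" "t \<in> set xs" by (auto simp: verts_def S_def)
    moreover obtain u v w where "xs = [u,v,w]" using chains_supp(1)[OF X'c t(2)] length_3E by fastforce
    ultimately show False by (auto simp: X'_eq split: if_splits)
  qed
qed

text \<open>The move that replaces the edge \<open>cd\<close> by \<open>ab\<close>: the two faces at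
  \<open>cd\<close> disappear and the other two faces of the tetrahedron take their place.
  \<open>ab\<close> says that the new edge is absent, so it will lie in exactly the two new
  triangles. The last claim says that only \<open>cd\<close> is lost.\<close>

lemma flip:
  assumes Q: "X [b,c,d] = 1" "X [a,d,c] = 1" and ab: "\<And>t. X [a,b,t] = 0"
    and X'_def: "X' = (\<lambda>xs. X xs - boundary \<Omega> (osimplex [a,b,c,d]) xs)"
  shows "sphere_cycle \<Omega> X'" "distinct [a,b,c,d]" "{a,b,c,d} \<subseteq> \<Omega>"
    and "\<And>u v t. u \<noteq> v \<Longrightarrow> u \<in> {a,b,c,d} \<Longrightarrow> v \<in> {a,b,c,d} \<Longrightarrow> {u,v} \<noteq> {c,d} \<Longrightarrow> \<exists>t. X' [u,v,t] \<noteq> 0"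
proof -
  have ne: "a \<noteq> b"
  proof
    assume "a = b"
    then show False using Q sw(2)[of b c d] by simp
  qed
  show dist: "distinct [a,b,c,d]" and sub: "{a,b,c,d} \<subseteq> \<Omega>"
    using nzD[of b c d] nzD[of a d c] Q ne by auto
  define T where "T = boundary \<Omega> (osimplex [a,b,c,d])"
  note T = boundary_tetrahedron[OF fin dist sub, folded T_def]
  note q = vals[OF Q(1)] vals[OF Q(2)]
  note tv = chains2_values[OF T(1) T(2)] chains2_values[OF T(1) T(3)]
     chains2_values[OF T(1) T(4)] chains2_values[OF T(1) T(5)]
  note z1 = vals[OF ab[of d]] and z2 = vals[OF ab[of c]]
  have d3: "distinct [b,c,d]" "distinct [a,d,c]" "distinct [a,b,d]" "distinct [a,c,b]" using dist by auto
  have X'c: "X' \<in> chains \<Omega> 2" unfolding X'_def T_def[symmetric] by (rule chains_diff[OF X T(1)])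
  have XX': "X' xs = X xs - T xs" for xs by (simp add: X'_def T_def)
  note xv = XX'[of "[b,c,d]"] XX'[of "[a,d,c]"] XX'[of "[a,b,d]"] XX'[of "[a,c,b]"]
  have xv1: "X' [b,c,d] = 0" "X' [a,d,c] = 0" "X' [a,b,d] = -1" "X' [a,c,b] = -1"
    using xv T Q z1 z2 by simp_all
  note xq = chains2_values[OF X'c xv1(1)] chains2_values[OF X'c xv1(2)]
     chains2_values[OF X'c xv1(3)] chains2_values[OF X'c xv1(4)]
  have rem: "X' xs = 0" if "set xs = {b,c,d} \<or> set xs = {a,c,d}" for xs
  proof (cases "length xs = 3")
    case True
    have "\<bar>X' xs\<bar> = 0"
      using chains_abs_perm[OF X'c, of xs "[b,c,d]"] chains_abs_perm[OF X'c, of xs "[a,d,c]"] that True d3 xv1 by auto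
    then show ?thesis by simp
  qed (use chains_supp(1)[OF X'c, of xs] in auto)
  have new: "\<bar>X' xs\<bar> = 1" if "set xs = {a,b,d} \<or> set xs = {a,b,c}" "length xs = 3" for xs
    using chains_abs_perm[OF X'c, of xs "[a,b,d]"] chains_abs_perm[OF X'c, of xs "[a,c,b]"] that d3 xv1 by auto
  have newX: "X xs = 0" if "{a,b} \<subseteq> set xs" for xs
  proof (rule ccontr)
    assume nz: "X xs \<noteq> 0"
    then have "length xs = 3" "distinct xs" using chains_supp[OF X nz] by auto
    then have "card (set xs - {a,b}) = 1" using that ne by (simp add: card_Diff_subset distinct_card)
    then obtain t where t: "set xs - {a,b} = {t}" by (rule card_1_singletonE)
    then have "set xs = set [a,b,t]" "distinct [a,b,t]" using that ne by auto
    then have "X [a,b,t] \<noteq> 0" using chains_abs_perm[OF X, of xs "[a,b,t]"] nz \<open>length xs = 3\<close> by simp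
    then show False using ab by simp
  qed
  have old: "X' xs = X xs"
    if "set xs \<noteq> {b,c,d}" "set xs \<noteq> {a,c,d}" "set xs \<noteq> {a,b,d}" "set xs \<noteq> {a,b,c}" for xs
    using T(6)[of xs] that XX'[of xs] by auto
  have iff: "X' [u,v,w] \<noteq> 0 \<longleftrightarrow> X [u,v,w] \<noteq> 0 \<and> {u,v,w} \<noteq> {b,c,d} \<and> {u,v,w} \<noteq> {a,c,d}
      \<or> {u,v,w} = {a,b,d} \<or> {u,v,w} = {a,b,c}" for u v w
  proof -
    have neq: "{b,c,d} \<noteq> {a,b,d}" "{b,c,d} \<noteq> {a,b,c}" "{a,c,d} \<noteq> {a,b,d}" "{a,c,d} \<noteq> {a,b,c}"
    proof -
      have "c \<notin> {a,b,d}" "d \<notin> {a,b,c}" using dist by auto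
      then show "{b,c,d} \<noteq> {a,b,d}" "{b,c,d} \<noteq> {a,b,c}" "{a,c,d} \<noteq> {a,b,d}" "{a,c,d} \<noteq> {a,b,c}"
        by blast+
    qed
    consider "{u,v,w} = {b,c,d} \<or> {u,v,w} = {a,c,d}" | "{u,v,w} = {a,b,d} \<or> {u,v,w} = {a,b,c}"
      | "{u,v,w} \<noteq> {b,c,d}" "{u,v,w} \<noteq> {a,c,d}" "{u,v,w} \<noteq> {a,b,d}" "{u,v,w} \<noteq> {a,b,c}" by metis
    then show ?thesis
    proof cases
      case 1
      then have "X' [u,v,w] = 0" using rem[of "[u,v,w]"] by simp
      then show ?thesis using 1 neq by metis
    next
      case 2
      then have "X' [u,v,w] \<noteq> 0" using new[of "[u,v,w]"] by simp
      then show ?thesis using 2 by blast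
    next
      case 3
      then have "X' [u,v,w] = X [u,v,w]" using old[of "[u,v,w]"] by simp
      then show ?thesis using 3 by metis
    qed
  qed
  have nbr: "q = a \<or> q = b" if "X [c,d,q] \<noteq> 0" for q
    using that nzD(7)[OF that] uniq[of c d q b] uniq'[of c d q a] q by auto
  have cd: "X' [c,d,t] = 0" "X' [d,c,t] = 0" for t
  proof -
    show *: "X' [c,d,t] = 0"
    proof (rule ccontr)
      assume nz: "X' [c,d,t] \<noteq> 0"
      then have "X [c,d,t] \<noteq> 0 \<or> {c,d,t} = {a,b,d} \<or> {c,d,t} = {a,b,c}" using iff by blast
      moreover have "{c,d,t} \<noteq> {a,b,d}" "{c,d,t} \<noteq> {a,b,c}" using dist by auto
      ultimately have "t = a \<or> t = b" using nbr by blast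
      then show False using nz rem[of "[c,d,t]"] by (auto simp: insert_commute)
    qed
    then show "X' [d,c,t] = 0" using chains2_values(1)[OF X'c *] by simp
  qed
  have val1: "X [u,v,w] = 1 \<and> {u,v,w} \<noteq> {b,c,d} \<and> {u,v,w} \<noteq> {a,c,d}
      \<or> (u,v,w) \<in> {(a,d,b),(d,b,a),(b,a,d),(a,b,c),(b,c,a),(c,a,b)}" if X1: "X' [u,v,w] = 1" for u v w
  proof -
    have d: "distinct [u,v,w]" using chains_supp(2)[OF X'c, of "[u,v,w]"] X1 by simp
    consider "{u,v,w} = {a,b,d}" | "{u,v,w} = {a,b,c}" | "{u,v,w} = {b,c,d} \<or> {u,v,w} = {a,c,d}"
      | "{u,v,w} \<noteq> {b,c,d}" "{u,v,w} \<noteq> {a,c,d}" "{u,v,w} \<noteq> {a,b,d}" "{u,v,w} \<noteq> {a,b,c}"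
      by metis
    then show ?thesis
    proof cases
      case 1
      then have "u \<in> {a,b,d}" "v \<in> {a,b,d}" "w \<in> {a,b,d}" by blast+
      then show ?thesis using d X1 xq by (elim insertE emptyE) simp_all
    next
      case 2
      then have "u \<in> {a,b,c}" "v \<in> {a,b,c}" "w \<in> {a,b,c}" by blast+
      then show ?thesis using d X1 xq by (elim insertE emptyE) simp_all
    next
      case 3
      then show ?thesis using rem[of "[u,v,w]"] X1 by simp
    next
      case 4
      then show ?thesis using old[of "[u,v,w]"] X1 by simp
    qed
  qed
  show "sphere_cycle \<Omega> X'"
  proof
    show "finite \<Omega>" by (rule fin)
    show "X' \<in> chains \<Omega> 2" by (rule X'c)
    have "osimplex [a,b,c,d] \<in> chains \<Omega> 3" using dist sub by (intro osimplex_chain) auto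
    then show "boundary \<Omega> X' = (\<lambda>_. 0)" by (simp add: X'_def boundary_diff cyc boundary_boundary3)
    show "\<bar>X' xs\<bar> \<le> 1" for xs
    proof (cases "length xs = 3")
      case True
      consider "set xs = {b,c,d} \<or> set xs = {a,c,d}" | "set xs = {a,b,d} \<or> set xs = {a,b,c}"
        | "set xs \<noteq> {b,c,d}" "set xs \<noteq> {a,c,d}" "set xs \<noteq> {a,b,d}" "set xs \<noteq> {a,b,c}" by metis
      then show ?thesis
      proof cases
        case 1 then show ?thesis using rem[of xs] by simp
      next
        case 2 then show ?thesis using new[of xs] True by simp
      next
        case 3 then show ?thesis using old[of xs] le1[of xs] by simp
      qed
    next
      case False
      then have "X' xs = 0" using chains_supp(1)[OF X'c, of xs] by auto
      then show ?thesis by simp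
    qed
  next
    fix u v w w' assume w: "X' [u,v,w] = 1" "X' [u,v,w'] = 1"
    \<comment> \<open>If a surviving triangle shared an oriented edge with a new one, it would by
      \<open>uniq\<close> be one of the two removed triangles, or it would contain the absent edge
      \<open>ab\<close>.\<close>
    have mixed: False if old: "X [u,v,w] = 1" "{u,v,w} \<noteq> {b,c,d}" "{u,v,w} \<noteq> {a,c,d}"
      and new: "(u,v,w') \<in> {(a,d,b),(d,b,a),(b,a,d),(a,b,c),(b,c,a),(c,a,b)}" for w w'
    proof -
      have "(u,v) \<in> {(a,d),(d,b),(b,a),(a,b),(b,c),(c,a)}" using new by auto
      then consider "u = a" "v = d" | "u = d" "v = b" | "{u,v} = {a,b}" | "u = b" "v = c" | "u = c" "v = a"
        by auto
      then show False
      proof cases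
        case 1
        then have "w = c" using uniq[of a d w c] old q by auto
        then show False using old 1 by (auto simp: insert_commute)
      next
        case 2
        then have "w = c" using uniq[of d b w c] old q by auto
        then show False using old 2 by (auto simp: insert_commute)
      next
        case 3
        then show False using newX[of "[u,v,w]"] old by auto
      next
        case 4
        then have "w = d" using uniq[of b c w d] old q by auto
        then show False using old 4 by (auto simp: insert_commute)
      next
        case 5
        then have "w = d" using uniq[of c a w d] old q by auto
        then show False using old 5 by (auto simp: insert_commute)
      qed
    qed
    show "w = w'"
      using val1[OF w(1)] val1[OF w(2)]
    proof (elim disjE)
      assume "X [u,v,w] = 1 \<and> {u,v,w} \<noteq> {b,c,d} \<and> {u,v,w} \<noteq> {a,c,d}"
        "X [u,v,w'] = 1 \<and> {u,v,w'} \<noteq> {b,c,d} \<and> {u,v,w'} \<noteq> {a,c,d}"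
      then show ?thesis using uniq by blast
    next
      assume "(u,v,w) \<in> {(a,d,b),(d,b,a),(b,a,d),(a,b,c),(b,c,a),(c,a,b)}"
       "(u,v,w') \<in> {(a,d,b),(d,b,a),(b,a,d),(a,b,c),(b,c,a),(c,a,b)}"
      then show ?thesis using dist by auto
    qed (use mixed in blast)+
  next
    fix v u u' w w' and g :: "'v \<Rightarrow> bool"
    assume g: "\<And>a b. X' [v,a,b] \<noteq> 0 \<Longrightarrow> g a = g b" and nz: "X' [v,u,u'] \<noteq> 0" "X' [v,w,w'] \<noteq> 0"
    \<comment> \<open>In the link of \<open>c\<close> the path from \<open>a\<close> over
      \<open>d\<close> to \<open>b\<close> has been shortened to the edge \<open>ab\<close>; the
      lost vertex \<open>d\<close> receives the common value of its neighbours. The link of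
      \<open>d\<close> is treated in the same way.\<close>
    define g' where "g' t = (if v = c \<and> t = d \<or> v = d \<and> t = c then g a else g t)" for t
    have g'X: "g' p = g' r" if nzX: "X [v,p,r] \<noteq> 0" for p r
    proof (cases "X' [v,p,r] = 0")
      case False
      then have ng: "\<not> (v = c \<and> p = d \<or> v = d \<and> p = c)" "\<not> (v = c \<and> r = d \<or> v = d \<and> r = c)"
        using cd chains2_values(2)[OF X'c, of v p r] by force+
      have "g' p = g p" unfolding g'_def by (rule if_not_P[OF ng(1)])
      moreover have "g' r = g r" unfolding g'_def by (rule if_not_P[OF ng(2)])
      ultimately show ?thesis using g[OF False] by simp
    next
      case True
      then have "{v,p,r} = {b,c,d} \<or> {v,p,r} = {a,c,d}" using iff[of v p r] nzX by metis
      then have "(v \<in> {b,c,d} \<and> p \<in> {b,c,d} \<and> r \<in> {b,c,d}) \<or> (v \<in> {a,c,d} \<and> p \<in> {a,c,d} \<and> r \<in> {a,c,d})"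
        using triple_mem[of v p r "{b,c,d}"] triple_mem[of v p r "{a,c,d}"] by argo
      moreover have "v \<noteq> p" "v \<noteq> r" "p \<noteq> r" using nzD[OF nzX] by auto
      moreover have "v = a \<Longrightarrow> g c = g d" "v = b \<Longrightarrow> g c = g d" "v = c \<Longrightarrow> g a = g b" "v = d \<Longrightarrow> g a = g b"
        using g[of b c] g[of b d] g[of a c] g[of a d] g[of a b] xq by auto
      ultimately show ?thesis using dist unfolding g'_def
        by (elim disjE conjE insertE emptyE) simp_all
    qed
    have ex: "\<exists>t t'. X [v,t,t'] \<noteq> 0 \<and> g' t = g u" if nz: "X' [v,u,u'] \<noteq> 0" for u u'
    proof -
      have gu: "g' u = g u" using nz cd by (auto simp: g'_def)
      show ?thesis
      proof (cases "X [v,u,u'] = 0")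
        case False
        then show ?thesis using gu by blast
      next
        case True
        then have "{v,u,u'} = {a,b,d} \<or> {v,u,u'} = {a,b,c}" using iff[of v u u'] nz by metis
        then have m: "v \<in> {a,b,d} \<and> u \<in> {a,b,d} \<or> v \<in> {a,b,c} \<and> u \<in> {a,b,c}"
        using triple_mem[of v u u' "{a,b,d}"] triple_mem[of v u u' "{a,b,c}"] by argo
        have vu: "v \<noteq> u" using chains_supp(2)[OF X'c nz] by auto
        show ?thesis
        proof (cases "{v,u} = {a,b}")
          \<comment> \<open>Along the new edge there is no old triangle; the value is read off at
            \<open>c\<close> instead, a neighbour of both \<open>a\<close> and \<open>b\<close>
            before and after the flip.\<close>
          case True
          have nz2: "X' [a,b,c] \<noteq> 0" "X' [b,a,c] \<noteq> 0" "X [a,c,d] \<noteq> 0" "X [b,c,d] \<noteq> 0"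
            by (simp_all add: xq q)
          from True consider "v = a" "u = b" | "v = b" "u = a" by (auto simp: doubleton_eq_iff)
          then have "g c = g u \<and> X [v,c,d] \<noteq> 0 \<and> v \<noteq> d \<and> v \<noteq> c"
          proof cases
            case 1 then show ?thesis using g[of b c] nz2 dist by simp
          next
            case 2 then show ?thesis using g[of a c] nz2 dist by simp
          qed
          then show ?thesis by (intro exI[of _ c] exI[of _ d]) (simp add: g'_def)
        next
          case False
          have "\<exists>t'. X [v,u,t'] \<noteq> 0"
          proof -
            have "(v,u) \<in> {(a,d),(d,a),(b,d),(d,b),(a,c),(c,a),(b,c),(c,b)}"
              using m vu False by (elim disjE conjE insertE emptyE; simp add: insert_commute)
            moreover have "X [a,d,c] \<noteq> 0" "X [d,a,c] \<noteq> 0" "X [b,d,c] \<noteq> 0" "X [d,b,c] \<noteq> 0"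
                "X [a,c,d] \<noteq> 0" "X [c,a,d] \<noteq> 0" "X [b,c,d] \<noteq> 0" "X [c,b,d] \<noteq> 0"
              by (simp_all add: q)
            ultimately show ?thesis by (elim insertE emptyE Pair_inject; simp only:; blast)
          qed
          then show ?thesis using gu by blast
        qed
      qed
    qed
    obtain t t' s s' where "X [v,t,t'] \<noteq> 0" "g' t = g u" "X [v,s,s'] \<noteq> 0" "g' s = g w"
      using ex[OF nz(1)] ex[OF nz(2)] by blast
    then show "g u = g w" using link[of v g' t t' s s'] g'X by metis
  next
    fix \<phi> :: "'v \<Rightarrow> 'v \<Rightarrow> int"
    assume anti: "\<And>u v. \<phi> v u = - \<phi> u v"
      and co: "\<And>u v w. X' [u,v,w] \<noteq> 0 \<Longrightarrow> \<phi> u v + \<phi> v w + \<phi> w u = 0"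
    \<comment> \<open>The value on the lost edge \<open>cd\<close> is forced by the removed face
      \<open>adc\<close>; the relation on the other removed face then follows from those on the two
      new faces.\<close>
    define \<psi> where "\<psi> u v = (if u = c \<and> v = d then \<phi> c a + \<phi> a d
       else if u = d \<and> v = c then - (\<phi> c a + \<phi> a d) else \<phi> u v)" for u v
    have r1: "\<phi> a b + \<phi> b c + \<phi> c a = 0" "\<phi> a b + \<phi> b d + \<phi> d a = 0"
      using co[of a b c] co[of a b d] xq by auto
    have psi: "\<psi> s t = \<phi> s t" if nzs: "X' [s,t,r] \<noteq> 0" for s t r
    proof -
      have "\<not> (s = c \<and> t = d)" "\<not> (s = d \<and> t = c)" using nzs cd by blast+
      then show ?thesis unfolding \<psi>_def by (simp only: if_False)
    qed
    have panti: "\<psi> v u = - \<psi> u v" for u v using anti[of v u] dist by (auto simp: \<psi>_def)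
    have base: "\<psi> b c + \<psi> c d + \<psi> d b = 0" "\<psi> a c + \<psi> c d + \<psi> d a = 0"
      using r1 anti[of a c] anti[of a d] anti[of b d] dist by (simp_all add: \<psi>_def)
    have "\<exists>h :: 'v \<Rightarrow> int. \<forall>u v w. X [u,v,w] \<noteq> 0 \<longrightarrow> \<psi> u v = h v - h u"
    proof (rule h1)
      show "\<psi> v u = - \<psi> u v" for u v by (rule panti)
      fix u v w assume nz: "X [u,v,w] \<noteq> 0"
      have dd: "u \<noteq> v" "u \<noteq> w" "v \<noteq> w" using nzD[OF nz] by auto
      show "\<psi> u v + \<psi> v w + \<psi> w u = 0"
      proof (cases "X' [u,v,w] = 0")
        case False
        have "X' [v,w,u] \<noteq> 0" "X' [w,u,v] \<noteq> 0"
          using chains2_values(4,5)[OF X'c, of u v w] False by auto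
        then show ?thesis using co[OF False] psi[OF False] psi by metis
      next
        case True
        then have "{u,v,w} = {b,c,d} \<or> {u,v,w} = {a,c,d}" using iff[of u v w] nz by metis
        then have "(u \<in> {b,c,d} \<and> v \<in> {b,c,d} \<and> w \<in> {b,c,d}) \<or> (u \<in> {a,c,d} \<and> v \<in> {a,c,d} \<and> w \<in> {a,c,d})"
        using triple_mem[of u v w "{b,c,d}"] triple_mem[of u v w "{a,c,d}"] by argo
        then show ?thesis using dd base panti[of b c] panti[of c d] panti[of b d] panti[of a c] panti[of a d]
          by (elim disjE conjE insertE emptyE) simp_all
      qed
    qed
    then obtain h :: "'v \<Rightarrow> int" where h: "\<And>u v w. X [u,v,w] \<noteq> 0 \<Longrightarrow> \<psi> u v = h v - h u" by blast
    have he: "\<phi> a d = h d - h a" "\<phi> a c = h c - h a" "\<phi> b c = h c - h b" "\<phi> b d = h d - h b"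
      using h[of a d c] h[of a c d] h[of b c d] h[of b d c] q dist by (auto simp: \<psi>_def)
    have hab: "\<phi> a b = h b - h a" using r1 he anti[of a c] by simp
    have "\<phi> u v = h v - h u" if nz: "X' [u,v,w] \<noteq> 0" for u v w
    proof (cases "X [u,v,w] = 0")
      case False
      then show ?thesis using h[OF False] psi[OF nz] by simp
    next
      case True
      then have "{u,v,w} = {a,b,d} \<or> {u,v,w} = {a,b,c}" using iff[of u v w] nz by metis
      then have "u \<in> {a,b,d} \<and> v \<in> {a,b,d} \<or> u \<in> {a,b,c} \<and> v \<in> {a,b,c}"
        using triple_mem[of u v w "{a,b,d}"] triple_mem[of u v w "{a,b,c}"] by argo
      moreover have "u \<noteq> v" using chains_supp(2)[OF X'c nz] by auto
      ultimately show ?thesis using he hab anti[of a d] anti[of a c] anti[of b c] anti[of b d]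
          anti[of a b] by (elim disjE conjE insertE emptyE) simp_all
    qed
    then show "\<exists>h :: 'v \<Rightarrow> int. \<forall>u v w. X' [u,v,w] \<noteq> 0 \<longrightarrow> \<phi> u v = h v - h u" by blast
  qed
  show "\<exists>t. X' [u,v,t] \<noteq> 0" if "u \<noteq> v" "u \<in> {a,b,c,d}" "v \<in> {a,b,c,d}" "{u,v} \<noteq> {c,d}" for u v
  proof -
    have "(u,v) \<in> {(a,b),(b,a),(a,d),(d,a),(b,d),(d,b),(a,c),(c,a),(b,c),(c,b)}"
      using that by (elim insertE emptyE; simp add: insert_commute)
    moreover have "X' [a,b,c] \<noteq> 0" "X' [b,a,c] \<noteq> 0" "X' [a,d,b] \<noteq> 0" "X' [d,a,b] \<noteq> 0"
        "X' [b,d,a] \<noteq> 0" "X' [d,b,a] \<noteq> 0" "X' [a,c,b] \<noteq> 0" "X' [c,a,b] \<noteq> 0"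
        "X' [b,c,a] \<noteq> 0" "X' [c,b,a] \<noteq> 0"
      by (simp_all add: xq)
    ultimately show ?thesis by (elim insertE emptyE Pair_inject; simp only:; blast)
  qed
qed

end

section \<open>Flagness of taut fillings\<close>

definition spans :: "('v list \<Rightarrow> int) \<Rightarrow> 'v set \<Rightarrow> bool" where
  "spans M s \<longleftrightarrow> (\<exists>xs. M xs \<noteq> 0 \<and> s \<subseteq> set xs)"

text \<open>The case \<open>u = v\<close> forces every point of \<open>s\<close> to be a vertex. The
  empty set is excluded because the zero chain, on which the induction ends, spans nothing.\<close>

definition flagged :: "('v list \<Rightarrow> int) \<Rightarrow> bool" where
  "flagged M \<longleftrightarrow> (\<forall>s. s \<noteq> {} \<longrightarrow> (\<forall>u\<in>s. \<forall>v\<in>s. spans M {u,v}) \<longrightarrow> spans M s)"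

lemma spans_boundary:
  assumes "boundary \<Omega> M xs \<noteq> 0"
  shows "spans M (set xs)"
proof -
  obtain t where "M (t # xs) \<noteq> 0" using assms by (rule boundary_nz)
  then show ?thesis unfolding spans_def by (intro exI[of _ "t # xs"]) auto
qed

lemma spans_mono: "spans M s \<Longrightarrow> t \<subseteq> s \<Longrightarrow> spans M t"
  unfolding spans_def by blast

lemma flagged_triangle:
  assumes "flagged M" and s: "spans M {u,v}" "spans M {v,w}" "spans M {u,w}"
  shows "spans M {u,v,w}"
proof -
  have sym: "spans M {v,u}" "spans M {w,v}" "spans M {w,u}"
    using s by (simp_all only: insert_commute)
  have "spans M {u,u}" "spans M {v,v}" "spans M {w,w}"
    by (rule spans_mono[OF s(1)], blast, rule spans_mono[OF s(2)], blast, rule spans_mono[OF s(2)], blast)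
  then have "\<forall>x\<in>{u,v,w}. \<forall>y\<in>{u,v,w}. spans M {x,y}"
    using s sym by (intro ballI; elim insertE emptyE; simp only:)
  then show ?thesis
    by (rule mp[OF mp[OF spec[OF assms(1)[unfolded flagged_def]] insert_not_empty]])
qed

text \<open>A clique cannot have one vertex outside \<open>A\<close> and another outside
  \<open>B\<close>, as each edge comes from one side. So it lies in one side, and an edge coming
  from the other side lies in \<open>A \<inter> B\<close>, where both chains span it.\<close>

lemma flagged_glue:
  assumes N: "flagged N" "\<And>xs. N xs \<noteq> 0 \<Longrightarrow> set xs \<subseteq> A"
    and K: "flagged K" "\<And>xs. K xs \<noteq> 0 \<Longrightarrow> set xs \<subseteq> B"
    and M: "\<And>xs. M xs \<noteq> 0 \<longleftrightarrow> N xs \<noteq> 0 \<or> K xs \<noteq> 0"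
    and AB: "\<And>s. s \<noteq> {} \<Longrightarrow> s \<subseteq> A \<inter> B \<Longrightarrow> spans N s \<and> spans K s"
  shows "flagged M"
  unfolding flagged_def
proof (intro allI impI)
  fix s :: "'a set" assume s: "s \<noteq> {}" "\<forall>u\<in>s. \<forall>v\<in>s. spans M {u,v}"
  have Ms: "spans M t \<longleftrightarrow> spans N t \<or> spans K t" for t unfolding spans_def using M by blast
  have NA: "t \<subseteq> A" if "spans N t" for t using that N(2) unfolding spans_def by blast
  have KB: "t \<subseteq> B" if "spans K t" for t using that K(2) unfolding spans_def by blast
  have sides: "u \<in> A \<or> v \<in> B" if "u \<in> s" "v \<in> s" for u v
    using s(2) that Ms[of "{u,v}"] NA[of "{u,v}"] KB[of "{u,v}"] by auto
  show "spans M s"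
  proof (cases "s \<subseteq> A")
    case True
    have "spans N {u,v}" if "u \<in> s" "v \<in> s" for u v
    proof (cases "spans N {u,v}")
      case False
      then have "spans K {u,v}" using s(2) that Ms by blast
      then have "{u,v} \<subseteq> A \<inter> B" using KB[of "{u,v}"] True that by auto
      then show ?thesis using AB[of "{u,v}"] by blast
    qed
    then have "spans N s" using N(1) s(1) unfolding flagged_def by blast
    then show ?thesis using Ms by blast
  next
    case False
    then have sB: "s \<subseteq> B" using sides by blast
    have "spans K {u,v}" if "u \<in> s" "v \<in> s" for u v
    proof (cases "spans K {u,v}")
      case False
      then have "spans N {u,v}" using s(2) that Ms by blast
      then have "{u,v} \<subseteq> A \<inter> B" using NA[of "{u,v}"] sB that by auto
      then show ?thesis using AB[of "{u,v}"] by blast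
    qed
    then have "spans K s" using K(1) s(1) unfolding flagged_def by blast
    then show ?thesis using Ms by blast
  qed
qed

text \<open>A clique that is not one of \<open>M'\<close> has an edge spanned only by
  \<open>t\<close>. Each triangle of the clique on that edge is then spanned only by
  \<open>t\<close>, so the whole clique lies in \<open>t\<close>.\<close>

lemma flagged_add_simplex:
  assumes M': "flagged M'" and t: "spans M t"
    and M: "\<And>xs. M xs \<noteq> 0 \<Longrightarrow> M' xs \<noteq> 0 \<or> set xs = t" "\<And>xs. M' xs \<noteq> 0 \<Longrightarrow> M xs \<noteq> 0"
    and tri: "\<And>u v w. spans M {u,v} \<Longrightarrow> spans M {v,w} \<Longrightarrow> spans M {u,w} \<Longrightarrow> spans M {u,v,w}"
  shows "flagged M"
  unfolding flagged_def
proof (intro allI impI)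
  fix s :: "'a set" assume s: "s \<noteq> {}" "\<forall>u\<in>s. \<forall>v\<in>s. spans M {u,v}"
  show "spans M s"
  proof (cases "\<forall>u\<in>s. \<forall>v\<in>s. spans M' {u,v}")
    case True
    then have "spans M' s" using M' s(1) unfolding flagged_def by blast
    then show ?thesis using M(2) unfolding spans_def by blast
  next
    case False
    then obtain u v where uv: "u \<in> s" "v \<in> s" "\<not> spans M' {u,v}" by blast
    have "w \<in> t" if w: "w \<in> s" for w
    proof -
      have "spans M {u,v,w}" using s(2) uv w by (intro tri) auto
      then obtain xs where xs: "M xs \<noteq> 0" "{u,v,w} \<subseteq> set xs" unfolding spans_def by blast
      then have "M' xs = 0" using uv(3) unfolding spans_def by blast
      then show ?thesis using M(1)[OF xs(1)] xs by blast
    qed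
    then show ?thesis using t spans_mono by blast
  qed
qed

text \<open>A single copy is taken off a positive coefficient, so nothing cancels and
  \<open>taut_part\<close> applies. A tetrahedron of multiplicity above 1 stays in the support,
  which is the last claim.\<close>

lemma remove_simplex:
  assumes fin: "finite \<Omega>" and M: "taut \<Omega> M" and pos: "M zs > 0"
    and M'_def: "M' = (\<lambda>xs. M xs - osimplex zs xs)"
  shows "taut \<Omega> M'" "mass \<Omega> M' < mass \<Omega> M" "boundary \<Omega> M' = (\<lambda>xs. boundary \<Omega> M xs - boundary \<Omega> (osimplex zs) xs)"
    "\<And>xs. M xs \<noteq> 0 \<Longrightarrow> M' xs \<noteq> 0 \<or> set xs = set zs" "\<And>xs. M' xs \<noteq> 0 \<Longrightarrow> M xs \<noteq> 0"
    "M zs \<noteq> 1 \<Longrightarrow> M xs \<noteq> 0 \<Longrightarrow> M' xs \<noteq> 0"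
proof -
  have Mc: "M \<in> chains \<Omega> 3" using M by (simp add: taut_def)
  have nz: "M zs \<noteq> 0" using pos by simp
  have d: "distinct zs" "length zs = 4" "set zs \<subseteq> \<Omega>" using chains_supp[OF Mc nz] by auto
  have oc: "osimplex zs \<in> chains \<Omega> 3" using d by (intro osimplex_chain) auto
  have val: "osimplex zs xs = 0 \<or> osimplex zs xs = 1 \<and> M xs = M zs \<or> osimplex zs xs = -1 \<and> M xs = - M zs" for xs
  proof (cases "\<exists>p. p permutes {..<length zs} \<and> xs = permute_list p zs")
    case True
    then obtain p where p: "p permutes {..<length zs}" "xs = permute_list p zs" by blast
    have "osimplex zs xs = sign p" "M xs = sign p * M zs"
      using osimplex_permute[OF d(1) p(1)] chains_permute[OF Mc p(1)] p(2) by simp_all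
    then show ?thesis by (cases "evenperm p") (simp_all add: sign_def)
  next
    case False
    then have "osimplex zs xs = 0" unfolding osimplex_def by (rule if_not_P)
    then show ?thesis by simp
  qed
  have abs: "\<bar>M xs\<bar> = \<bar>M' xs\<bar> + \<bar>osimplex zs xs\<bar>" for xs
    using val[of xs] pos by (auto simp: M'_def)
  have M'c: "M' \<in> chains \<Omega> 3" unfolding M'_def by (rule chains_diff[OF Mc oc])
  show "taut \<Omega> M'"
  proof (rule taut_part[OF M M'c])
    show "\<bar>M xs\<bar> = \<bar>M' xs\<bar> + \<bar>M xs - M' xs\<bar>" for xs using abs[of xs] by (simp add: M'_def)
  qed
  have "mass \<Omega> M = mass \<Omega> M' + mass \<Omega> (osimplex zs)"
    unfolding mass_def sum.distrib[symmetric] by (intro sum.cong) (auto simp: abs)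
  moreover have "\<not> mass \<Omega> (osimplex zs) \<le> 0"
    using mass_zero[OF fin oc, of zs] osimplex_self[OF d(1)] by auto
  ultimately show "mass \<Omega> M' < mass \<Omega> M" by linarith
  show "boundary \<Omega> M' = (\<lambda>xs. boundary \<Omega> M xs - boundary \<Omega> (osimplex zs) xs)"
    unfolding M'_def by (rule boundary_diff)
  show "M' xs \<noteq> 0 \<or> set xs = set zs" if "M xs \<noteq> 0" for xs
    using that osimplex_zero(1)[of zs xs] by (auto simp: M'_def)
  show "M xs \<noteq> 0" if "M' xs \<noteq> 0" for xs using abs[of xs] that by auto
  show "M' xs \<noteq> 0" if "M zs \<noteq> 1" "M xs \<noteq> 0"
    using val[of xs] that by (auto simp: M'_def)
qed

subsection \<open>Counting boundary faces\<close>

text \<open>This product form is what admitting repetitions in \<open>tuples\<close> buys.\<close>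

lemma sum_tuples_Suc:
  assumes "finite \<Omega>"
  shows "(\<Sum>xs\<in>tuples \<Omega> (Suc n). f xs) = (\<Sum>a\<in>\<Omega>. \<Sum>xs\<in>tuples \<Omega> n. f (a # xs))"
proof -
  have "(\<Sum>xs\<in>tuples \<Omega> (Suc n). f xs) = (\<Sum>(a,xs)\<in>\<Omega> \<times> tuples \<Omega> n. f (a # xs))"
    by (rule sum.reindex_bij_witness[of _ "\<lambda>(a,xs). a # xs" "\<lambda>xs. (hd xs, tl xs)"])
      (auto simp: tuples_def length_Suc_conv)
  then show ?thesis by (simp add: sum.cartesian_product)
qed

lemma tuples_0: "tuples \<Omega> 0 = {[]}"
  by (auto simp: tuples_def)

lemma sum_tuples3:
  assumes "finite \<Omega>"
  shows "(\<Sum>xs\<in>tuples \<Omega> 3. f xs) = (\<Sum>a\<in>\<Omega>. \<Sum>b\<in>\<Omega>. \<Sum>c\<in>\<Omega>. f [a,b,c])"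
  using assms by (simp add: numeral_eq_Suc sum_tuples_Suc tuples_0)

lemma sum_tuples4:
  assumes "finite \<Omega>"
  shows "(\<Sum>xs\<in>tuples \<Omega> 4. f xs) = (\<Sum>a\<in>\<Omega>. \<Sum>b\<in>\<Omega>. \<Sum>c\<in>\<Omega>. \<Sum>d\<in>\<Omega>. f [a,b,c,d])"
  using assms by (simp add: numeral_eq_Suc sum_tuples_Suc tuples_0)

text \<open>For an oriented tetrahedron and a cycle with coefficients in -1, 0, 1, this is the
  number of faces that agree with the cycle minus the number that disagree.\<close>

definition coboundary :: "('v list \<Rightarrow> int) \<Rightarrow> 'v list \<Rightarrow> int" where
  "coboundary X xs = X [xs ! 1, xs ! 2, xs ! 3] - X [xs ! 0, xs ! 2, xs ! 3]
     + X [xs ! 0, xs ! 1, xs ! 3] - X [xs ! 0, xs ! 1, xs ! 2]"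

lemma coboundary_simp: "coboundary X [a,b,c,d] = X [b,c,d] - X [a,c,d] + X [a,b,d] - X [a,b,c]"
  by (simp add: coboundary_def numeral_eq_Suc)

text \<open>Adjointness of boundary and coboundary; the factor 4 is the ratio of 24 orderings of a
  tetrahedron to 6 of a triangle. Adjacent swaps carry the four terms of the coboundary into one
  another, with a sign that \<open>M\<close> absorbs.\<close>

lemma sum_coboundary:
  assumes fin: "finite \<Omega>" and M: "M \<in> chains \<Omega> 3"
  shows "(\<Sum>xs\<in>tuples \<Omega> 4. M xs * coboundary X xs) = 4 * (\<Sum>ys\<in>tuples \<Omega> 3. X ys * boundary \<Omega> M ys)"
proof -
  note s = chains3_swap[OF M]
  define F where "F f = (\<Sum>a\<in>\<Omega>. \<Sum>b\<in>\<Omega>. \<Sum>c\<in>\<Omega>. \<Sum>d\<in>\<Omega>. f a b c d)" for f :: "'a \<Rightarrow> 'a \<Rightarrow> 'a \<Rightarrow> 'a \<Rightarrow> int"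
  have F1: "F f = F (\<lambda>a b c d. f b a c d)" for f unfolding F_def by (rule sum.swap)
  have F2: "F f = F (\<lambda>a b c d. f a c b d)" for f unfolding F_def by (intro sum.cong refl sum.swap)
  have F3: "F f = F (\<lambda>a b c d. f a b d c)" for f unfolding F_def by (intro sum.cong refl sum.swap)
  have Fneg: "F (\<lambda>a b c d. - f a b c d) = - F f" for f by (simp add: F_def sum_negf)
  have e1: "M [b,a,c,d] * k = - (M [a,b,c,d] * k)" for a b c d k using s(1)[of a b c d] by simp
  have e2: "M [a,c,b,d] * k = - (M [a,b,c,d] * k)" for a b c d k using s(2)[of a b c d] by simp
  have e3: "M [a,b,d,c] * k = - (M [a,b,c,d] * k)" for a b c d k using s(3)[of a b c d] by simp
  let ?S = "F (\<lambda>a b c d. M [a,b,c,d] * X [b,c,d])"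
  have S2: "F (\<lambda>a b c d. M [a,b,c,d] * X [a,c,d]) = - ?S"
    unfolding F1[of "\<lambda>a b c d. M [a,b,c,d] * X [a,c,d]"] Fneg[symmetric]
    by (intro arg_cong[where f = F] ext e1)
  have S3: "F (\<lambda>a b c d. M [a,b,c,d] * X [a,b,d]) = - F (\<lambda>a b c d. M [a,b,c,d] * X [a,c,d])"
    unfolding F2[of "\<lambda>a b c d. M [a,b,c,d] * X [a,b,d]"] Fneg[symmetric]
    by (intro arg_cong[where f = F] ext e2)
  have S4: "F (\<lambda>a b c d. M [a,b,c,d] * X [a,b,c]) = - F (\<lambda>a b c d. M [a,b,c,d] * X [a,b,d])"
    unfolding F3[of "\<lambda>a b c d. M [a,b,c,d] * X [a,b,c]"] Fneg[symmetric]
    by (intro arg_cong[where f = F] ext e3)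
  have "(\<Sum>xs\<in>tuples \<Omega> 4. M xs * coboundary X xs) = F (\<lambda>a b c d. M [a,b,c,d] * X [b,c,d])
      - F (\<lambda>a b c d. M [a,b,c,d] * X [a,c,d]) + F (\<lambda>a b c d. M [a,b,c,d] * X [a,b,d])
      - F (\<lambda>a b c d. M [a,b,c,d] * X [a,b,c])"
    unfolding F_def sum_tuples4[OF fin] coboundary_simp
    by (simp add: algebra_simps sum.distrib sum_subtractf)
  also have "\<dots> = 4 * ?S" using S2 S3 S4 by simp
  also have "?S = (\<Sum>ys\<in>tuples \<Omega> 3. X ys * boundary \<Omega> M ys)"
  proof -
    have "(\<Sum>ys\<in>tuples \<Omega> 3. X ys * boundary \<Omega> M ys)
        = (\<Sum>ys\<in>tuples \<Omega> 3. \<Sum>a\<in>\<Omega>. M (a # ys) * X ys)"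
      by (simp add: boundary_def sum_distrib_left mult.commute)
    also have "\<dots> = (\<Sum>a\<in>\<Omega>. \<Sum>ys\<in>tuples \<Omega> 3. M (a # ys) * X ys)" by (rule sum.swap)
    finally show ?thesis by (simp add: F_def sum_tuples3[OF fin])
  qed
  finally show ?thesis .
qed

text \<open>Only faces away from the apex give tetrahedra, and the apex may stand at any of four
  positions.\<close>

lemma mass_cone:
  assumes fin: "finite \<Omega>" and X: "X \<in> chains \<Omega> 2" "v \<in> \<Omega>"
  shows "mass \<Omega> (cone v X) \<le> 4 * (\<Sum>ys\<in>tuples \<Omega> 3. if v \<in> set ys then 0 else \<bar>X ys\<bar>)"
proof -
  define g where "g ys = (if v \<in> set ys then 0 else \<bar>X ys\<bar>)" for ys
  have g0: "0 \<le> g ys" for ys by (simp add: g_def)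
  have le: "\<bar>cone v X [a,b,c,d]\<bar> \<le> (if a = v then g [b,c,d] else 0) + (if b = v then g [a,c,d] else 0)
      + (if c = v then g [a,b,d] else 0) + (if d = v then g [a,b,c] else 0)" for a b c d
  proof (cases "cone v X [a,b,c,d] = 0")
    case False
    then have "distinct [a,b,c,d]" using chains_supp(2)[OF cone_chain[OF X]] by blast
    then show ?thesis using False by (auto simp: cone_simp g_def)
  qed (use g0 in simp)
  let ?G = "\<Sum>a\<in>\<Omega>. \<Sum>b\<in>\<Omega>. \<Sum>c\<in>\<Omega>. g [a,b,c]"
  have sing: "(\<Sum>a\<in>\<Omega>. if a = v then K else 0) = K" for K :: int using fin X(2) by simp
  have c0: "(\<Sum>a\<in>\<Omega>. \<Sum>b\<in>\<Omega>. \<Sum>c\<in>\<Omega>. \<Sum>d\<in>\<Omega>. if d = v then g [a,b,c] else 0) = ?G"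
    by (simp add: sing)
  have c1: "(\<Sum>a\<in>\<Omega>. \<Sum>b\<in>\<Omega>. \<Sum>c\<in>\<Omega>. \<Sum>d\<in>\<Omega>. if c = v then g [a,b,d] else 0) = ?G"
  proof -
    have "(\<Sum>c\<in>\<Omega>. \<Sum>d\<in>\<Omega>. if c = v then g [a,b,d] else 0) = (\<Sum>d\<in>\<Omega>. g [a,b,d])" for a b
      by (subst sum.swap) (simp add: sing)
    then show ?thesis by simp
  qed
  have c2: "(\<Sum>a\<in>\<Omega>. \<Sum>b\<in>\<Omega>. \<Sum>c\<in>\<Omega>. \<Sum>d\<in>\<Omega>. if b = v then g [a,c,d] else 0) = ?G"
  proof -
    have "(\<Sum>b\<in>\<Omega>. \<Sum>c\<in>\<Omega>. \<Sum>d\<in>\<Omega>. if b = v then g [a,c,d] else 0)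
        = (\<Sum>b\<in>\<Omega>. if b = v then (\<Sum>c\<in>\<Omega>. \<Sum>d\<in>\<Omega>. g [a,c,d]) else 0)" for a
      by (intro sum.cong) auto
    then show ?thesis by (simp add: sing)
  qed
  have c3: "(\<Sum>a\<in>\<Omega>. \<Sum>b\<in>\<Omega>. \<Sum>c\<in>\<Omega>. \<Sum>d\<in>\<Omega>. if a = v then g [b,c,d] else 0) = ?G"
  proof -
    have "(\<Sum>a\<in>\<Omega>. \<Sum>b\<in>\<Omega>. \<Sum>c\<in>\<Omega>. \<Sum>d\<in>\<Omega>. if a = v then g [b,c,d] else 0)
        = (\<Sum>a\<in>\<Omega>. if a = v then ?G else 0)"
      by (intro sum.cong) auto
    then show ?thesis by (simp add: sing)
  qed
  have "mass \<Omega> (cone v X) \<le> (\<Sum>a\<in>\<Omega>. \<Sum>b\<in>\<Omega>. \<Sum>c\<in>\<Omega>. \<Sum>d\<in>\<Omega>.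
      (if a = v then g [b,c,d] else 0) + (if b = v then g [a,c,d] else 0)
      + (if c = v then g [a,b,d] else 0) + (if d = v then g [a,b,c] else 0))"
    unfolding mass_def sum_tuples4[OF fin] by (intro sum_mono le)
  also have "\<dots> = 4 * ?G" by (simp add: sum.distrib c0 c1 c2 c3)
  finally show ?thesis by (simp add: sum_tuples3[OF fin] g_def)
qed

definition triangles_filled :: "('v list \<Rightarrow> int) \<Rightarrow> bool" where
  "triangles_filled X \<longleftrightarrow> (\<forall>b c x t1 t2 t3.
     X [b,c,t1] \<noteq> 0 \<longrightarrow> X [c,x,t2] \<noteq> 0 \<longrightarrow> X [x,b,t3] \<noteq> 0 \<longrightarrow> X [b,c,x] \<noteq> 0)"

context sphere_cycle
begin

text \<open>At least three triangles meet at \<open>v\<close>, each with 6 orderings. They are found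
  by walking along the link; \<open>u3\<close> may coincide with \<open>u0\<close>, as it does in a
  link of length three.\<close>

lemma star_count:
  assumes "X [v,u0,u1] = 1"
  shows "(\<Sum>ys\<in>tuples \<Omega> 3. if v \<in> set ys then \<bar>X ys\<bar> else 0) \<ge> 18"
proof -
  have nz1: "X [v,u1,u0] \<noteq> 0" using vals[OF assms] by simp
  obtain u2 where u2: "X [v,u1,u2] = 1" using nz1 by (rule edge_pm)
  have nz2: "X [v,u2,u1] \<noteq> 0" using vals[OF u2] by simp
  obtain u3 where u3: "X [v,u2,u3] = 1" using nz2 by (rule edge_pm)
  have d: "distinct [v,u0,u1]" "distinct [v,u1,u2]" "distinct [v,u2,u3]"
    using nzD[of v u0 u1] nzD[of v u1 u2] nzD[of v u2 u3] assms u2 u3 by auto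
  have n1: "u2 \<noteq> u0" using vals[OF assms] u2 by auto
  have n2: "u3 \<noteq> u1" using vals[OF u2] u3 by auto
  define S where "S = {{v,u0,u1},{v,u1,u2},{v,u2,u3}}"
  have "{v,u0,u1} \<noteq> {v,u1,u2}" "{v,u0,u1} \<noteq> {v,u2,u3}" "{v,u1,u2} \<noteq> {v,u2,u3}"
  proof -
    have "u2 \<notin> {v,u0,u1}" "u1 \<notin> {v,u2,u3}" using d n1 n2 by auto
    then show "{v,u0,u1} \<noteq> {v,u1,u2}" "{v,u0,u1} \<noteq> {v,u2,u3}" "{v,u1,u2} \<noteq> {v,u2,u3}" by blast+
  qed
  then have "card S = 3" by (simp add: S_def)
  have S3: "finite s \<and> card s = 3" if "s \<in> S" for s using that d by (auto simp: S_def)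
  have "finite S" by (simp add: S_def)
  note co = card_orderings[OF this S3]
  have sub: "{xs. distinct xs \<and> set xs \<in> S} \<subseteq> tuples \<Omega> 3"
  proof
    fix xs assume "xs \<in> {xs. distinct xs \<and> set xs \<in> S}"
    then have xs: "distinct xs" "set xs \<in> S" by auto
    then have "length xs = 3" using S3[OF xs(2)] distinct_card[OF xs(1)] by simp
    moreover have "set xs \<subseteq> \<Omega>" using xs(2) nzD[of v u0 u1] nzD[of v u1 u2] nzD[of v u2 u3] assms u2 u3
      by (auto simp: S_def)
    ultimately show "xs \<in> tuples \<Omega> 3" by (simp add: tuples_def)
  qed
  have one: "(if v \<in> set xs then \<bar>X xs\<bar> else 0) = 1" if "distinct xs" "set xs \<in> S" for xs
  proof -
    have len: "length xs = 3" using S3[OF that(2)] distinct_card[OF that(1)] by simp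
    from that(2) have "\<bar>X xs\<bar> = 1"
      unfolding S_def using chains_abs_perm[OF X, of xs "[v,u0,u1]"] chains_abs_perm[OF X, of xs "[v,u1,u2]"]
        chains_abs_perm[OF X, of xs "[v,u2,u3]"] d assms u2 u3 len by auto
    moreover have "v \<in> set xs" using that(2) by (auto simp: S_def)
    ultimately show ?thesis by simp
  qed
  have "18 = (\<Sum>xs | distinct xs \<and> set xs \<in> S. (if v \<in> set xs then \<bar>X xs\<bar> else 0))"
    using one co \<open>card S = 3\<close> by (simp add: fact_numeral)
  also have "\<dots> \<le> (\<Sum>ys\<in>tuples \<Omega> 3. if v \<in> set ys then \<bar>X ys\<bar> else 0)"
    by (rule sum_mono2[OF finite_tuples[OF fin] sub]) simp
  finally show ?thesis .
qed

text \<open>The coefficients of \<open>X\<close> are -1, 0 or 1, so its pairing with itself counts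
  the faces; the cone bounds the mass by the faces away from \<open>v\<close>. What remains is 4
  times the star of \<open>v\<close>, and 72 is 4 times 18.\<close>

lemma surplus:
  assumes M: "taut \<Omega> M" "boundary \<Omega> M = X" and v: "X [v,u0,u1] = 1"
  shows "(\<Sum>xs\<in>tuples \<Omega> 4. M xs * coboundary X xs - \<bar>M xs\<bar>) \<ge> 72"
proof -
  have Mc: "M \<in> chains \<Omega> 3" using M by (simp add: taut_def)
  have v\<Omega>: "v \<in> \<Omega>" using nzD[of v u0 u1] v by simp
  have sq: "X ys * X ys = \<bar>X ys\<bar>" for ys
  proof -
    have "X ys = 0 \<or> X ys = 1 \<or> X ys = -1" using le1[of ys] by linarith
    then show ?thesis by auto
  qed
  have "(\<Sum>xs\<in>tuples \<Omega> 4. M xs * coboundary X xs) = 4 * (\<Sum>ys\<in>tuples \<Omega> 3. \<bar>X ys\<bar>)"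
    using sum_coboundary[OF fin Mc, of X] M(2) sq by simp
  moreover have "mass \<Omega> M \<le> 4 * (\<Sum>ys\<in>tuples \<Omega> 3. if v \<in> set ys then 0 else \<bar>X ys\<bar>)"
  proof -
    have "mass \<Omega> M \<le> mass \<Omega> (cone v X)"
      using M cone_chain[OF X v\<Omega>] boundary_cone[OF fin X v\<Omega> cyc] unfolding taut_def by blast
    then show ?thesis using mass_cone[OF fin X v\<Omega>] by linarith
  qed
  moreover have "(\<Sum>ys\<in>tuples \<Omega> 3. \<bar>X ys\<bar>) = (\<Sum>ys\<in>tuples \<Omega> 3. if v \<in> set ys then 0 else \<bar>X ys\<bar>)
     + (\<Sum>ys\<in>tuples \<Omega> 3. if v \<in> set ys then \<bar>X ys\<bar> else 0)"
    unfolding sum.distrib[symmetric] by (intro sum.cong) auto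
  ultimately show ?thesis using star_count[OF v] by (simp add: mass_def sum_subtractf)
qed

text \<open>A tetrahedron of surplus sign meets the sphere in two faces; up to an even relabelling these
  are the faces opposite its first two vertices.\<close>

lemma surplus_two_faces:
  assumes M: "M \<in> chains \<Omega> 3" and xs: "M xs \<noteq> 0" and D: "M xs * coboundary X xs > \<bar>M xs\<bar>"
  obtains a b c d where "M [a,b,c,d] > 0" "X [b,c,d] = 1" "X [a,d,c] = 1" "set xs = {a,b,c,d}"
    "M [a,b,c,d] = \<bar>M xs\<bar>" "M [a,b,c,d] * coboundary X [a,b,c,d] = M xs * coboundary X xs"
proof -
  note result = that
  note ms = chains3_swap[OF M]
  have X1: "X ys \<le> 1" for ys using le1[of ys] by linarith
  \<comment> \<open>If at most one of four integers bounded by 1 equals 1, the others are at most 0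
    and the sum is at most 1.\<close>
  have two: "p = 1 \<and> q = 1 \<or> p = 1 \<and> r = 1 \<or> p = 1 \<and> s = 1 \<or> q = 1 \<and> r = 1 \<or> q = 1 \<and> s = 1 \<or> r = 1 \<and> s = 1"
    if "p \<le> 1" "q \<le> 1" "r \<le> 1" "s \<le> 1" "p + q + r + s \<ge> 2" for p q r s :: int
    using that by presburger
  have pos: thesis if m: "M [a,b,c,d] > 0" and c2: "coboundary X [a,b,c,d] \<ge> 2"
    and s: "set xs = {a,b,c,d}" "M [a,b,c,d] = \<bar>M xs\<bar>" "M [a,b,c,d] * coboundary X [a,b,c,d] = M xs * coboundary X xs"
    for a b c d
  proof -
    have co: "coboundary X [a,b,c,d] = X [b,c,d] + X [a,d,c] + X [a,b,d] + X [a,c,b]"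
      using sw(2)[of a d c] sw(2)[of a c b] by (simp add: coboundary_simp)
    have m1: "M [a,c,d,b] = M [a,b,c,d]" using ms(3)[of a c b d] ms(2)[of a b c d] by simp
    have m2: "M [a,d,b,c] = M [a,b,c,d]" using ms(2)[of a d b c] ms(3)[of a b d c] by simp
    have m3: "M [b,c,a,d] = M [a,b,c,d]" using ms(2)[of b a c d] ms(1)[of a b c d] by simp
    have m4: "M [b,d,c,a] = M [a,b,c,d]"
      using ms(3)[of b d a c] ms(2)[of b a d c] ms(1)[of a b d c] ms(3)[of a b c d] by simp
    have m5: "M [c,d,a,b] = M [a,b,c,d]"
      using ms(2)[of c a d b] ms(1)[of a c d b] m1 by simp
    have c1: "coboundary X [a,c,d,b] = coboundary X [a,b,c,d]"
      using sw[of b c d] sw[of a b d] sw[of a c d] sw[of a b c] by (simp add: coboundary_simp)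
    have c2': "coboundary X [a,d,b,c] = coboundary X [a,b,c,d]"
      using sw[of b c d] sw[of a b d] sw[of a c d] sw[of a b c] by (simp add: coboundary_simp)
    have c3: "coboundary X [b,c,a,d] = coboundary X [a,b,c,d]"
      using sw[of b c d] sw[of a b d] sw[of a c d] sw[of a b c] by (simp add: coboundary_simp)
    have c4: "coboundary X [b,d,c,a] = coboundary X [a,b,c,d]"
      using sw[of b c d] sw[of a b d] sw[of a c d] sw[of a b c] by (simp add: coboundary_simp)
    have c5: "coboundary X [c,d,a,b] = coboundary X [a,b,c,d]"
      using sw[of b c d] sw[of a b d] sw[of a c d] sw[of a b c] by (simp add: coboundary_simp)
    have "X [b,c,d] = 1 \<and> X [a,d,c] = 1 \<or> X [b,c,d] = 1 \<and> X [a,b,d] = 1 \<or> X [b,c,d] = 1 \<and> X [a,c,b] = 1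
      \<or> X [a,d,c] = 1 \<and> X [a,b,d] = 1 \<or> X [a,d,c] = 1 \<and> X [a,c,b] = 1 \<or> X [a,b,d] = 1 \<and> X [a,c,b] = 1"
      using two[OF X1 X1 X1 X1] co c2 by simp
    then show thesis
    proof (elim disjE conjE)
      assume "X [b,c,d] = 1" "X [a,d,c] = 1"
      then show thesis using result[of a b c d] m s by simp
    next
      assume 1: "X [b,c,d] = 1" and 2: "X [a,b,d] = 1"
      show thesis using result[of a c d b] m s m1 c1 vals[OF 1] vals[OF 2] by (simp add: insert_commute)
    next
      assume 1: "X [b,c,d] = 1" and 2: "X [a,c,b] = 1"
      show thesis using result[of a d b c] m s m2 c2' vals[OF 1] vals[OF 2] by (simp add: insert_commute)
    next
      assume 1: "X [a,d,c] = 1" and 2: "X [a,b,d] = 1"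
      show thesis using result[of b c a d] m s m3 c3 vals[OF 1] vals[OF 2] by (simp add: insert_commute)
    next
      assume 1: "X [a,d,c] = 1" and 2: "X [a,c,b] = 1"
      show thesis using result[of b d c a] m s m4 c4 vals[OF 1] vals[OF 2] by (simp add: insert_commute)
    next
      assume 1: "X [a,b,d] = 1" and 2: "X [a,c,b] = 1"
      show thesis using result[of c d a b] m s m5 c5 vals[OF 1] vals[OF 2] by (simp add: insert_commute)
    qed
  qed
  have "length xs = 4" using chains_supp(1)[OF M xs] by simp
  then obtain a b c d where abcd: "xs = [a,b,c,d]" by (rule length_4E)
  show thesis
  proof (cases "M xs > 0")
    case True
    then have "coboundary X xs \<ge> 2" using D
        mult_less_cancel_left_pos[of "M xs" 1 "coboundary X xs"] by simp
    with True show thesis unfolding abcd by (intro pos[of a b c d]) (simp_all add: abcd)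
  next
    case False
    have neg: "M [b,a,c,d] = - M xs" "coboundary X [b,a,c,d] = - coboundary X xs"
      using ms(1)[of a b c d] sw(1)[of a b d] sw(1)[of a b c] abcd by (simp_all add: coboundary_simp)
    have "M [b,a,c,d] * coboundary X [b,a,c,d] > M [b,a,c,d]" using D neg False by simp
    moreover have "M [b,a,c,d] > 0" using neg False xs by simp
    ultimately have "coboundary X [b,a,c,d] \<ge> 2"
      using mult_less_cancel_left_pos[of "M [b,a,c,d]" 1 "coboundary X [b,a,c,d]"] by simp
    moreover have "M [b,a,c,d] = \<bar>M xs\<bar>" using neg(1) False by simp
    moreover have "M [b,a,c,d] * coboundary X [b,a,c,d] = M xs * coboundary X xs" unfolding neg by simp
    moreover have "set xs = {b,a,c,d}" using abcd by auto
    ultimately show thesis using \<open>M [b,a,c,d] > 0\<close> by (intro pos[of b a c d])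
  qed
qed

text \<open>If \<open>ab\<close> is already an edge, it closes triangles of edges with
  \<open>c\<close> and with \<open>d\<close>, which are therefore faces. Their orientations are
  forced by \<open>uniq\<close> along \<open>bc\<close> and \<open>db\<close>, where the face
  \<open>[b,c,d]\<close> already has the positive sign.\<close>

lemma two_faces_flip:
  assumes full: "triangles_filled X"
    and f: "X [b,c,d] = 1" "X [a,d,c] = 1" and ab: "X [a,b,t] \<noteq> 0"
  shows "X [a,b,d] = 1" "X [a,c,b] = 1"
proof -
  note filled = full[unfolded triangles_filled_def, rule_format]
  note v1 = vals[OF f(1)] and v2 = vals[OF f(2)]
  have ac: "a \<noteq> c" "a \<noteq> d" using nzD[of a d c] f by auto
  have "X [a,b,d] \<noteq> 0"
    using filled[of a b t d c c] ab v1 v2 by simp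
  then have "X [d,b,a] \<noteq> 0" by (rule nz_perm(3))
  moreover have "X [d,b,a] \<noteq> 1" using uniq[of d b c a] v1 ac by auto
  ultimately have "X [d,b,a] = -1" using nzD(7) by blast
  from vals(3)[OF this] show "X [a,b,d] = 1" by simp
  have "X [a,b,c] \<noteq> 0"
    using filled[of a b t c d d] ab v1 v2 by simp
  then have "X [b,c,a] \<noteq> 0" by (rule nz_perm(4))
  moreover have "X [b,c,a] \<noteq> 1" using uniq[of b c d a] v1 ac by auto
  ultimately have "X [b,c,a] = -1" using nzD(7) by blast
  from vals(3)[OF this] show "X [a,c,b] = 1" by simp
qed

end

section \<open>Triangles of edges, and the induction on the mass\<close>

lemma card_pairs_le2:
  assumes "\<not> (P {u,v} \<and> P {v,w} \<and> P {u,w})"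
  shows "card {e \<in> {{u,v},{v,w},{u,w}}. P e} \<le> 2"
proof -
  obtain e where e: "e \<in> {{u,v},{v,w},{u,w}}" "\<not> P e" using assms by blast
  have "{e \<in> {{u,v},{v,w},{u,w}}. P e} \<subseteq> {{u,v},{v,w},{u,w}} - {e}" using e by blast
  then have "card {e \<in> {{u,v},{v,w},{u,w}}. P e} \<le> card ({{u,v},{v,w},{u,w}} - {e})"
    by (intro card_mono) auto
  also have "\<dots> \<le> 2"
  proof -
    have "card {{u,v},{v,w},{u,w}} \<le> 3" by (simp add: card_insert_if)
    then show ?thesis using e(1) by (simp add: card_Diff_singleton)
  qed
  finally show ?thesis .
qed

text \<open>The surplus sum is at least 72, i.e. 24 times 3. A tetrahedron whose removal destroys an edge of
  the triangle contributes 24, and it is determined by that edge, which lies on the sphere. If the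
  triangle is not a face of the sphere, then at most two of its edges qualify, so some removable
  tetrahedron keeps all three.\<close>

lemma (in sphere_cycle) triangle_spanned:
  assumes M: "taut \<Omega> M" and bM: "boundary \<Omega> M = X"
    and full: "triangles_filled X"
    and nocomp: "\<And>a b c d. M [a,b,c,d] > 0 \<Longrightarrow> X [b,c,d] = 1 \<Longrightarrow> X [a,d,c] = 1 \<Longrightarrow>
       X [a,b,d] = 1 \<Longrightarrow> X [a,c,b] = 1 \<Longrightarrow> False"
    and IH: "\<And>X' M'. sphere_cycle \<Omega> X' \<Longrightarrow> taut \<Omega> M' \<Longrightarrow> boundary \<Omega> M' = X' \<Longrightarrow> mass \<Omega> M' < mass \<Omega> M \<Longrightarrow> flagged M'"
    and v0: "X [v0,u0,u1] = 1"
    and tri: "spans M {u,v}" "spans M {v,w}" "spans M {u,w}"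
  shows "spans M {u,v,w}"
proof (rule ccontr)
  assume no: "\<not> spans M {u,v,w}"
  have Mc: "M \<in> chains \<Omega> 3" using M by (simp add: taut_def)
  have ne: "u \<noteq> v" "v \<noteq> w" "u \<noteq> w"
    using no tri by (auto simp: insert_absorb insert_commute)
  define onX where "onX e \<longleftrightarrow> (\<exists>x y t. e = {x,y} \<and> X [x,y,t] \<noteq> 0)" for e
  have onXD: "\<exists>t. X [x,y,t] \<noteq> 0" if "onX {x,y}" for x y
    using that nz_perm(1) unfolding onX_def doubleton_eq_iff by blast
  have "\<not> (onX {u,v} \<and> onX {v,w} \<and> onX {u,w})"
  proof
    assume "onX {u,v} \<and> onX {v,w} \<and> onX {u,w}"
    then obtain t1 t2 t3 where "X [u,v,t1] \<noteq> 0" "X [v,w,t2] \<noteq> 0" "X [w,u,t3] \<noteq> 0"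
      using onXD[of u v] onXD[of v w] onXD[of w u] by (auto simp: insert_commute)
    then have "X [u,v,w] \<noteq> 0" using full unfolding triangles_filled_def by blast
    then have "spans M (set [u,v,w])" using bM by (intro spans_boundary[of \<Omega>]) simp
    then show False using no by simp
  qed
  note le2 = card_pairs_le2[of onX, OF this]
  define PX where "PX = {e \<in> {{u,v},{v,w},{u,w}}. onX e}"
  have finPX: "finite PX" by (simp add: PX_def)
  have sp: "spans M e" if "e \<in> PX" for e using that tri by (auto simp: PX_def)
  \<comment> \<open>Some tetrahedron on the edge \<open>e\<close>. If removing a tetrahedron
    destroys \<open>e\<close>, then no other one contains \<open>e\<close>, so \<open>f e\<close>
    recovers the removed one and the bad tetrahedra number at most \<open>card PX\<close>.\<close>
  define f where "f e = set (SOME zs. M zs \<noteq> 0 \<and> e \<subseteq> set zs)" for e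
  have fe: "\<exists>zs. M zs \<noteq> 0 \<and> e \<subseteq> set zs \<and> f e = set zs" if "spans M e" for e
    using someI_ex[of "\<lambda>zs. M zs \<noteq> 0 \<and> e \<subseteq> set zs"] that unfolding f_def spans_def by blast
  define Bad where "Bad = f ` PX"
  have finBad: "finite Bad" and cardBad: "card Bad \<le> 2"
    using finPX card_image_le[OF finPX, of f] le2 by (simp_all add: Bad_def PX_def)
  have Bad4: "finite s \<and> card s = 4" if sB: "s \<in> Bad" for s
  proof -
    obtain zs where "M zs \<noteq> 0" "s = set zs" using sB fe sp unfolding Bad_def by blast
    then show ?thesis using chains_supp[OF Mc] by (auto simp: distinct_card)
  qed
  note co = card_orderings[OF finBad Bad4]
  have bound: "M xs * coboundary X xs - \<bar>M xs\<bar> \<le> (if distinct xs \<and> set xs \<in> Bad then 1 else 0)" for xs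
  proof (cases "M xs * coboundary X xs > \<bar>M xs\<bar>")
    case True
    then have xs: "M xs \<noteq> 0" by auto
    obtain a b c d where m: "M [a,b,c,d] > 0" and Q: "X [b,c,d] = 1" "X [a,d,c] = 1"
      and s: "set xs = {a,b,c,d}" "M [a,b,c,d] = \<bar>M xs\<bar>"
        "M [a,b,c,d] * coboundary X [a,b,c,d] = M xs * coboundary X xs"
      by (rule surplus_two_faces[OF Mc xs True])
    have ab: "X [a,b,t] = 0" for t
      using two_faces_flip[OF full Q] nocomp[OF m Q] by blast
    define M' where "M' = (\<lambda>ys. M ys - osimplex [a,b,c,d] ys)"
    define X' where "X' = (\<lambda>ys. X ys - boundary \<Omega> (osimplex [a,b,c,d]) ys)"
    note rs = remove_simplex[OF fin M m M'_def]
    note fl = flip[OF Q ab X'_def]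
    have bM': "boundary \<Omega> M' = X'" using rs(3) bM by (simp add: X'_def)
    have fM': "flagged M'" by (rule IH[OF fl(1) rs(1) bM' rs(2)])
    have "\<exists>e\<in>{{u,v},{v,w},{u,w}}. \<not> spans M' e"
    proof (rule ccontr)
      assume "\<not> ?thesis"
      then have "spans M' {u,v}" "spans M' {v,w}" "spans M' {u,w}" by auto
      then have "spans M' {u,v,w}" by (rule flagged_triangle[OF fM'])
      then show False using no rs(5) unfolding spans_def by blast
    qed
    then obtain e where e: "e \<in> {{u,v},{v,w},{u,w}}" "\<not> spans M' e" by blast
    have only: "set zs = {a,b,c,d}" if "M zs \<noteq> 0" "e \<subseteq> set zs" for zs
      using rs(4)[OF that(1)] e(2) that(2) unfolding spans_def by auto
    have spe: "spans M e" using e(1) tri by auto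
    obtain zs where zs: "M zs \<noteq> 0" "e \<subseteq> set zs" "f e = set zs" using fe[OF spe] by blast
    have esub: "e \<subseteq> {a,b,c,d}" using only[OF zs(1,2)] zs(2) by simp
    obtain x y where xy: "e = {x,y}" "x \<noteq> y" using e(1) ne by auto
    \<comment> \<open>Every other edge of the tetrahedron lies on the flipped sphere and is thus
      spanned by its filling \<open>M'\<close>.\<close>
    have "e = {c,d}"
    proof (rule ccontr)
      assume "e \<noteq> {c,d}"
      then obtain t where "X' [x,y,t] \<noteq> 0" using fl(4)[of x y] xy esub by auto
      then have "spans M' (set [x,y,t])" using bM' by (intro spans_boundary[of \<Omega>]) simp
      then show False using e(2) xy(1) spans_mono[of M' _ e] by auto
    qed
    then have "onX e" unfolding onX_def using vals[OF Q(1)] by (metis zero_neq_one)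
    then have "e \<in> PX" using e(1) by (simp add: PX_def)
    then have "{a,b,c,d} \<in> Bad" using zs(3) only[OF zs(1,2)] unfolding Bad_def by (metis imageI)
    then have inBad: "distinct xs \<and> set xs \<in> Bad" using s(1) chains_supp(2)[OF Mc xs] by simp
    \<comment> \<open>With multiplicity above 1 the removal would leave the support, and with it the
      edge \<open>e\<close>, unchanged.\<close>
    have M1: "M [a,b,c,d] = 1"
    proof (rule ccontr)
      assume "M [a,b,c,d] \<noteq> 1"
      then have "M' zs \<noteq> 0" using rs(6) zs(1) by blast
      then show False using e(2) zs(2) unfolding spans_def by blast
    qed
    \<comment> \<open>The two faces containing the absent edge \<open>ab\<close> contribute 0, so
      each ordering of a bad tetrahedron contributes 2 - 1 = 1.\<close>
    have "coboundary X [a,b,c,d] = 2"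
      using ab[of d] ab[of c] Q sw(2)[of a d c] by (simp add: coboundary_simp)
    then show ?thesis using s M1 inBad by simp
  qed auto
  have "72 \<le> (\<Sum>xs\<in>tuples \<Omega> 4. M xs * coboundary X xs - \<bar>M xs\<bar>)"
    by (rule surplus[OF M bM v0])
  also have "\<dots> \<le> (\<Sum>xs\<in>tuples \<Omega> 4. if distinct xs \<and> set xs \<in> Bad then 1 else 0)"
    by (intro sum_mono bound)
  also have "\<dots> = (\<Sum>xs | xs \<in> tuples \<Omega> 4 \<and> distinct xs \<and> set xs \<in> Bad. 1)"
    by (rule sum.inter_filter[OF finite_tuples[OF fin], symmetric])
  also have "\<dots> \<le> (\<Sum>xs\<in>{xs. distinct xs \<and> set xs \<in> Bad}. 1)"
    using co(2) by (intro sum_mono2) auto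
  also have "\<dots> = 24 * int (card Bad)" using co(1) by (simp add: fact_numeral)
  finally show False using cardBad by simp
qed

text \<open>In the last case, with all triangles of edges filled and no tetrahedral component, a
  single flip supplies a flagged \<open>M'\<close>. Cliques of \<open>M\<close> reduce to those of
  \<open>M'\<close> by \<open>flagged_add_simplex\<close>, whose triangle hypothesis needs the
  comparison of many flips in \<open>triangle_spanned\<close>.\<close>

theorem taut_flagged:
  assumes "sphere_cycle \<Omega> X" "taut \<Omega> M" "boundary \<Omega> M = X"
  shows "flagged M"
  using assms
proof (induction "nat (mass \<Omega> M)" arbitrary: X M rule: less_induct)
  case less
  interpret sphere_cycle \<Omega> X by (rule less.prems(1))
  note M = less.prems(2) and bM = less.prems(3)
  have Mc: "M \<in> chains \<Omega> 3" using M by (simp add: taut_def)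
  have IH: "flagged M'" if "sphere_cycle \<Omega> X'" "taut \<Omega> M'" "boundary \<Omega> M' = X'" "mass \<Omega> M' < mass \<Omega> M" for X' M'
    using less.hyps[OF _ that(1-3)] that(4) mass_nonneg[of \<Omega> M'] by auto
  consider "X = (\<lambda>_. 0)"
    | (sep) b c x t1 t2 t3 where "X [b,c,t1] \<noteq> 0" "X [c,x,t2] \<noteq> 0" "X [x,b,t3] \<noteq> 0" "X [b,c,x] = 0"
    | (comp) a b c d where "M [a,b,c,d] > 0" "X [b,c,d] = 1" "X [a,d,c] = 1" "X [a,b,d] = 1" "X [a,c,b] = 1"
    | (prime) "X \<noteq> (\<lambda>_. 0)"
       "triangles_filled X"
       "\<And>a b c d. M [a,b,c,d] > 0 \<Longrightarrow> X [b,c,d] = 1 \<Longrightarrow> X [a,d,c] = 1 \<Longrightarrow>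
       X [a,b,d] = 1 \<Longrightarrow> X [a,c,b] = 1 \<Longrightarrow> False"
    unfolding triangles_filled_def by blast
  then show ?case
  proof cases
    case 1
    then have "M xs = 0" for xs using taut_zero[OF fin M] bM by simp
    then show ?thesis unfolding flagged_def spans_def by blast
  next
    case sep
    obtain A B Y Z where AB: "A \<union> B = \<Omega>" "A \<inter> B = {b,c,x}" "card (A \<inter> B) = 3"
      and YZ: "sphere_cycle \<Omega> Y" "sphere_cycle \<Omega> Z" "X = (\<lambda>xs. Y xs + Z xs)"
        "\<forall>xs. Y xs \<noteq> 0 \<longrightarrow> set xs \<subseteq> A" "\<forall>xs. Z xs \<noteq> 0 \<longrightarrow> set xs \<subseteq> B"
        "Y [b,c,x] \<noteq> 0" "Z [b,c,x] \<noteq> 0"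
      by (rule split_triangle[OF sep])
    have sum: "almost_disjoint_sum \<Omega> M Y Z A B"
      using fin M bM YZ AB sphere_cycle.X[OF YZ(1)] sphere_cycle.cyc[OF YZ(1)]
        sphere_cycle.X[OF YZ(2)] sphere_cycle.cyc[OF YZ(2)]
      by unfold_locales simp_all
    obtain N K where NK: "taut \<Omega> N" "taut \<Omega> K" "boundary \<Omega> N = Y" "boundary \<Omega> K = Z"
      "M = (\<lambda>xs. N xs + K xs)" "mass \<Omega> M = mass \<Omega> N + mass \<Omega> K"
      and NA: "\<And>xs. N xs \<noteq> 0 \<Longrightarrow> set xs \<subseteq> A" and KB: "\<And>xs. K xs \<noteq> 0 \<Longrightarrow> set xs \<subseteq> B"
      and dj: "\<And>xs. N xs = 0 \<or> K xs = 0"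
      by (rule almost_disjoint_sum.split_taut[OF sum]) (rule that)
    have spN: "spans N {b,c,x}" using spans_boundary[of \<Omega> N "[b,c,x]"] NK(3) YZ(6) by simp
    have spK: "spans K {b,c,x}" using spans_boundary[of \<Omega> K "[b,c,x]"] NK(4) YZ(7) by simp
    \<comment> \<open>Both parts span the cut triangle, so both are nonzero and each is strictly
      lighter than \<open>M\<close>.\<close>
    have pos: "0 < mass \<Omega> L" if "taut \<Omega> L" "spans L s" for L s
    proof (rule ccontr)
      assume "\<not> 0 < mass \<Omega> L"
      then have "L xs = 0" for xs using that mass_zero[OF fin, of L] by (simp add: taut_def)
      then show False using that(2) by (simp add: spans_def)
    qed
    have fN: "flagged N" and fK: "flagged K"
      using IH[OF YZ(1) NK(1,3)] IH[OF YZ(2) NK(2,4)] NK(6) pos[OF NK(1) spN] pos[OF NK(2) spK] by auto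
    show ?thesis
    proof (rule flagged_glue[OF fN _ fK])
      show "set xs \<subseteq> A" if "N xs \<noteq> 0" for xs by (rule NA[OF that])
      show "set xs \<subseteq> B" if "K xs \<noteq> 0" for xs by (rule KB[OF that])
      show "M xs \<noteq> 0 \<longleftrightarrow> N xs \<noteq> 0 \<or> K xs \<noteq> 0" for xs using NK(5) dj[of xs] by auto
      show "spans N s \<and> spans K s" if "s \<subseteq> A \<inter> B" for s
        using that AB(2) spans_mono[OF spN] spans_mono[OF spK] by blast
    qed
  next
    case comp
    define M' where "M' = (\<lambda>ys. M ys - osimplex [a,b,c,d] ys)"
    define X' where "X' = (\<lambda>ys. X ys - boundary \<Omega> (osimplex [a,b,c,d]) ys)"
    note rs = remove_simplex[OF fin M comp(1) M'_def]
    note rc = remove_component[OF comp(2-5) X'_def]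
    have bM': "boundary \<Omega> M' = X'" using rs(3) bM by (simp add: X'_def)
    have fM': "flagged M'" by (rule IH[OF rc(1) rs(1) bM' rs(2)])
    \<comment> \<open>By the absence of interior vertices \<open>M'\<close> lives on the vertices of
      \<open>X'\<close>, which avoid the deleted component; the two parts glued below share no
      vertex.\<close>
    have vM': "set xs \<subseteq> verts X'" if "M' xs \<noteq> 0" for xs using taut_verts[OF fin rs(1) that] bM' by simp
    let ?o = "osimplex [a,b,c,d]"
    have d: "distinct [a,b,c,d]" using chains_supp(2)[OF Mc, of "[a,b,c,d]"] comp(1) by simp
    have so: "set xs = {a,b,c,d}" if "?o xs \<noteq> 0" for xs using osimplex_zero(1)[OF that] by simp
    have "flagged ?o"
      unfolding flagged_def
    proof (intro allI impI)
      fix s assume s: "\<forall>u\<in>s. \<forall>v\<in>s. spans ?o {u,v}"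
      have "s \<subseteq> {a,b,c,d}"
      proof
        fix u assume "u \<in> s"
        then have "spans ?o {u,u}" using s by blast
        then show "u \<in> {a,b,c,d}" using so unfolding spans_def by blast
      qed
      then show "spans ?o s" unfolding spans_def
        by (intro exI[of _ "[a,b,c,d]"]) (simp add: osimplex_self[OF d])
    qed
    then show ?thesis
    proof (rule flagged_glue[OF _ _ fM'])
      show "set xs \<subseteq> verts X'" if "M' xs \<noteq> 0" for xs by (rule vM'[OF that])
      show "set xs \<subseteq> {a,b,c,d}" if "?o xs \<noteq> 0" for xs using so[OF that] by simp
      show "M xs \<noteq> 0 \<longleftrightarrow> ?o xs \<noteq> 0 \<or> M' xs \<noteq> 0" for xs
      proof (cases "?o xs = 0")
        case True
        then show ?thesis by (simp add: M'_def)
      next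
        case False
        \<comment> \<open>Excludes higher multiplicity of the removed tetrahedron: a remaining copy
          would use vertices that \<open>X'\<close> lacks.\<close>
        have "M' xs = 0"
        proof (rule ccontr)
          assume "M' xs \<noteq> 0"
          then have "{a,b,c,d} \<subseteq> verts X'" using vM' so[OF False] by metis
          then show False using rc(2) by auto
        qed
        then show ?thesis using False by (simp add: M'_def)
      qed
      show "spans ?o s \<and> spans M' s" if "s \<noteq> {}" "s \<subseteq> {a,b,c,d} \<inter> verts X'" for s
        using that rc(2) by blast
    qed
  next
    case prime
    obtain ys where ys: "X ys \<noteq> 0" using prime(1) by auto
    have "length ys = 3" using chains_supp(1)[OF X ys] by simp
    then obtain v0 w0 w1 where "ys = [v0,w0,w1]" by (rule length_3E)
    then obtain u1 where v0: "X [v0,w0,u1] = 1" using edge_pm ys by metis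
    have "\<exists>xs. M xs * coboundary X xs > \<bar>M xs\<bar>"
    proof (rule ccontr)
      assume "\<not> ?thesis"
      then have "(\<Sum>xs\<in>tuples \<Omega> 4. M xs * coboundary X xs - \<bar>M xs\<bar>) \<le> 0"
        by (intro sum_nonpos) (auto simp: not_less)
      then show False using surplus[OF M bM v0] by linarith
    qed
    then obtain xs where xs: "M xs * coboundary X xs > \<bar>M xs\<bar>" by blast
    then have nz: "M xs \<noteq> 0" by auto
    obtain a b c d where m: "M [a,b,c,d] > 0" and Q: "X [b,c,d] = 1" "X [a,d,c] = 1"
      by (rule surplus_two_faces[OF Mc nz xs])
    have ab: "X [a,b,t] = 0" for t
      using two_faces_flip[OF prime(2) Q] prime(3)[OF m Q] by blast
    define M' where "M' = (\<lambda>ys. M ys - osimplex [a,b,c,d] ys)"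
    define X' where "X' = (\<lambda>ys. X ys - boundary \<Omega> (osimplex [a,b,c,d]) ys)"
    note rs = remove_simplex[OF fin M m M'_def]
    note fl = flip[OF Q ab X'_def]
    have bM': "boundary \<Omega> M' = X'" using rs(3) bM by (simp add: X'_def)
    have fM': "flagged M'" by (rule IH[OF fl(1) rs(1) bM' rs(2)])
    show ?thesis
    proof (rule flagged_add_simplex[OF fM' _ rs(4,5)])
      show "spans M (set [a,b,c,d])" using m unfolding spans_def by (intro exI[of _ "[a,b,c,d]"]) simp
      show "spans M {u,v,w}" if "spans M {u,v}" "spans M {v,w}" "spans M {u,w}" for u v w
        by (rule triangle_spanned[OF M bM prime(2,3) IH v0 that])
    qed
  qed
qed

section \<open>Triangulated topological spheres\<close>

definition point_mass :: "'v \<Rightarrow> 'v \<Rightarrow> real" where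
  "point_mass v = (\<lambda>u. if u = v then 1 else 0)"

definition segment :: "('v \<Rightarrow> real) \<Rightarrow> ('v \<Rightarrow> real) \<Rightarrow> real \<Rightarrow> 'v \<Rightarrow> real" where
  "segment p q t = (\<lambda>u. (1 - t) * p u + t * q u)"

lemma continuous_segment: "continuous_on A (segment p q)"
  unfolding segment_def
  by (intro continuous_on_coordinatewise_then_product continuous_intros)

lemma open_coordinate_gt: "open {p :: 'v \<Rightarrow> real. a < p v}"
  by (intro open_Collect_less continuous_intros continuous_on_product_coordinates)

lemma open_coordinate_lt: "open {p :: 'v \<Rightarrow> real. p v < a}"
  by (intro open_Collect_less continuous_intros continuous_on_product_coordinates)

locale triangulated_sphere =
  fixes \<sigma> :: "'v set set"
  assumes tri: "simplicial_triangulation \<sigma> (sphere (0 :: real ^ 3) 1)"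
begin

definition R where "R = geometric_realization \<sigma>"
definition V where "V = \<Union>\<sigma>"

lemma simplicial: "finite \<sigma>" "s \<in> \<sigma> \<Longrightarrow> finite s" "s \<in> \<sigma> \<Longrightarrow> t \<subseteq> s \<Longrightarrow> t \<in> \<sigma>"
  using tri by (auto simp: simplicial_triangulation_def abstract_simplicial_complex_def)

lemma finite_V: "finite V"
  using simplicial by (auto simp: V_def)

lemma realizationI:
  assumes "s \<in> \<sigma>" "\<And>v. 0 \<le> p v" "\<And>v. p v \<noteq> 0 \<Longrightarrow> v \<in> s" "sum p s = 1"
  shows "p \<in> R"
proof -
  have sub: "{v. p v \<noteq> 0} \<subseteq> s" using assms(3) by auto
  have "(\<Sum>v | p v \<noteq> 0. p v) = sum p s"
    by (rule sum.mono_neutral_left) (use simplicial(2)[OF assms(1)] sub in auto)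
  then show ?thesis
    using assms simplicial(3)[OF assms(1) sub] by (simp add: R_def geometric_realization_def)
qed

lemma realizationD:
  assumes "p \<in> R"
  shows "0 \<le> p v" "{v. p v \<noteq> 0} \<in> \<sigma>" "(\<Sum>v\<in>V. p v) = 1"
proof -
  show "0 \<le> p v" and s: "{v. p v \<noteq> 0} \<in> \<sigma>" using assms by (auto simp: R_def geometric_realization_def)
  have "(\<Sum>v\<in>V. p v) = (\<Sum>v | p v \<noteq> 0. p v)"
    by (rule sum.mono_neutral_right) (use s finite_V in \<open>auto simp: V_def\<close>)
  then show "(\<Sum>v\<in>V. p v) = 1" using assms by (simp add: R_def geometric_realization_def)
qed

lemma point_mass_R: "{v} \<in> \<sigma> \<Longrightarrow> point_mass v \<in> R"
  by (rule realizationI[of "{v}"]) (auto simp: point_mass_def split: if_splits)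

lemma segment_R:
  assumes s: "s \<in> \<sigma>" "p \<in> R" "q \<in> R" "\<And>v. p v \<noteq> 0 \<Longrightarrow> v \<in> s" "\<And>v. q v \<noteq> 0 \<Longrightarrow> v \<in> s" "0 \<le> t" "t \<le> 1"
  shows "segment p q t \<in> R"
proof (rule realizationI[OF s(1)])
  show "0 \<le> segment p q t v" for v
    using realizationD(1)[OF s(2), of v] realizationD(1)[OF s(3), of v] s(6,7) by (simp add: segment_def)
  show "v \<in> s" if "segment p q t v \<noteq> 0" for v
    using that s(4,5)[of v] by (cases "p v = 0"; cases "q v = 0") (auto simp: segment_def)
  have sV: "s \<subseteq> V" using s(1) by (auto simp: V_def)
  have "sum p s = 1" "sum q s = 1"
    using realizationD(3)[OF s(2)] realizationD(3)[OF s(3)] sum.mono_neutral_left[OF finite_V sV, of p]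
      sum.mono_neutral_left[OF finite_V sV, of q] s(4,5) by auto
  then show "sum (segment p q t) s = 1"
    by (simp add: segment_def sum.distrib sum_distrib_left[symmetric])
qed

lemma simplex_coordinates:
  assumes "p \<in> R" "finite A" "\<And>v. v \<in> A \<Longrightarrow> p v \<noteq> 0"
  shows "A \<in> \<sigma>"
  using simplicial(3)[OF realizationD(2)[OF assms(1)], of A] assms(3) by auto

section \<open>Planar charts; links and edges of a triangulated sphere\<close>

lemma chart:
  assumes "n \<in> R"
  obtains f g where "homeomorphism (R - {n}) (UNIV :: complex set) f g"
proof -
  obtain f g where fg: "homeomorphism R (sphere (0 :: real ^ 3) 1) f g"
    using tri by (auto simp: simplicial_triangulation_def R_def homeomorphic_def)
  have fn: "f n \<in> sphere 0 1" using fg assms by (auto simp: homeomorphism_def)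
  have "f ` (R - {n}) = sphere 0 1 - {f n}"
  proof -
    have "inj_on f R" using fg by (auto simp: homeomorphism_def intro: inj_on_inverseI)
    then have "f ` (R - {n}) = f ` R - f ` {n}" using assms by (intro inj_on_image_set_diff[of f R]) auto
    then show ?thesis using fg by (simp add: homeomorphism_def)
  qed
  then have "homeomorphism (R - {n}) (sphere 0 1 - {f n}) f g"
    by (intro homeomorphism_of_subsets[OF fg]) auto
  then have "R - {n} homeomorphic sphere 0 1 - {f n}" by (auto simp: homeomorphic_def)
  also have "sphere 0 1 - {f n} homeomorphic (UNIV :: complex set)"
    by (rule homeomorphic_punctured_sphere_affine) (use fn in auto)
  finally show ?thesis using that by (auto simp: homeomorphic_def)
qed

text \<open>Missing the point \<open>n\<close>, the set lies in a punctured sphere and becomes a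
  connected open subset of the plane, which has no cut points. Links and edges are controlled below
  by exhibiting a cut point.\<close>

lemma connected_delete:
  assumes U: "openin (top_of_set R) U" "connected U" and n: "n \<in> R" "n \<notin> U"
  shows "connected (U - {p})"
proof (cases "p \<in> U")
  case True
  obtain f g where fg: "homeomorphism (R - {n}) (UNIV :: complex set) f g" by (rule chart[OF n(1)])
  have UR: "U \<subseteq> R - {n}" using openin_imp_subset[OF U(1)] n by auto
  have "openin (top_of_set (R - {n})) U" by (rule openin_subset_trans[OF U(1) UR]) auto
  then have "openin (top_of_set UNIV) (f ` U)" by (rule homeomorphism_imp_open_map[OF fg])
  then have "open (f ` U)" by simp
  moreover have cf: "continuous_on U f" using fg UR continuous_on_subset by (auto simp: homeomorphism_def)
  moreover have "connected (f ` U)" by (rule connected_continuous_image[OF cf U(2)])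
  ultimately have "connected (f ` U - {f p})" by (intro connected_open_delete) auto
  moreover have "continuous_on (f ` U - {f p}) g"
    using fg by (auto simp: homeomorphism_def intro: continuous_on_subset)
  ultimately have "connected (g ` (f ` U - {f p}))" by (rule connected_continuous_image[rotated])
  moreover have "g ` (f ` U - {f p}) = U - {p}"
  proof -
    have gf: "g (f x) = x" if "x \<in> U" for x using fg UR that by (auto simp: homeomorphism_def)
    show ?thesis
    proof (intro equalityI subsetI)
      fix y assume "y \<in> g ` (f ` U - {f p})"
      then show "y \<in> U - {p}" using gf by auto
    next
      fix y assume y: "y \<in> U - {p}"
      then have "f y \<noteq> f p" using gf[of y] gf[OF True] by auto
      then show "y \<in> g ` (f ` U - {f p})" using y gf[of y] by (intro image_eqI[of _ _ "f y"]) auto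
    qed
  qed
  ultimately show ?thesis by simp
qed (use U in simp)

text \<open>The open star is star-shaped about \<open>v\<close>.\<close>

lemma star_connected:
  assumes v: "{v} \<in> \<sigma>"
  shows "openin (top_of_set R) {p \<in> R. 0 < p v}" "connected {p \<in> R. 0 < p v}"
proof -
  have eq: "{p \<in> R. 0 < p v} = R \<inter> {p. 0 < p v}" by auto
  show "openin (top_of_set R) {p \<in> R. 0 < p v}"
    unfolding eq by (intro openin_open_Int open_coordinate_gt)
  have segU: "segment p (point_mass v) ` {0..1} \<subseteq> {p \<in> R. 0 < p v}" if p: "p \<in> R" "0 < p v" for p
  proof
    fix q assume "q \<in> segment p (point_mass v) ` {0..1}"
    then obtain t where t: "0 \<le> t" "t \<le> 1" "q = segment p (point_mass v) t" by auto
    have "q \<in> R" unfolding t(3)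
      by (rule segment_R[OF realizationD(2)[OF p(1)] p(1) point_mass_R[OF v] _ _ t(1,2)])
        (use p in \<open>auto simp: point_mass_def split: if_splits\<close>)
    moreover have "0 < q v"
    proof (cases "t = 1")
      case False
      then have "0 < (1 - t) * p v" using t p by simp
      then show ?thesis using t by (simp add: segment_def point_mass_def)
    qed (simp add: t segment_def point_mass_def)
    ultimately show "q \<in> {p \<in> R. 0 < p v}" by simp
  qed
  have "{p \<in> R. 0 < p v} = (\<Union>p\<in>{p \<in> R. 0 < p v}. segment p (point_mass v) ` {0..1})"
  proof (intro equalityI subsetI)
    fix p assume p: "p \<in> {p \<in> R. 0 < p v}"
    have "p = segment p (point_mass v) 0" by (simp add: segment_def)
    then show "p \<in> (\<Union>p\<in>{p \<in> R. 0 < p v}. segment p (point_mass v) ` {0..1})"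
      using p by (intro UN_I[of p] image_eqI[of _ _ 0]) auto
  next
    fix q assume "q \<in> (\<Union>p\<in>{p \<in> R. 0 < p v}. segment p (point_mass v) ` {0..1})"
    then show "q \<in> {p \<in> R. 0 < p v}" using segU by blast
  qed
  moreover have "connected (\<Union>p\<in>{p \<in> R. 0 < p v}. segment p (point_mass v) ` {0..1})"
  proof (rule connected_Union)
    fix s assume "s \<in> (\<lambda>p. segment p (point_mass v) ` {0..1}) ` {p \<in> R. 0 < p v}"
    then show "connected s"
      by (auto intro!: connected_continuous_image continuous_segment)
  next
    have "point_mass v \<in> segment p (point_mass v) ` {0..1}" for p
      by (rule image_eqI[of _ _ 1]) (auto simp: segment_def)
    then show "\<Inter> ((\<lambda>p. segment p (point_mass v) ` {0..1}) ` {p \<in> R. 0 < p v}) \<noteq> {}" by blast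
  qed
  ultimately show "connected {p \<in> R. 0 < p v}" by simp
qed

lemma edge_segment_R:
  assumes "{v,u} \<in> \<sigma>" "0 \<le> t" "t \<le> 1"
  shows "segment (point_mass v) (point_mass u) t \<in> R"
proof (rule segment_R[OF assms(1) _ _ _ _ assms(2,3)])
  show "point_mass v \<in> R" "point_mass u \<in> R"
    using simplicial(3)[OF assms(1)] by (auto intro: point_mass_R)
qed (auto simp: point_mass_def split: if_splits)

text \<open>Otherwise \<open>v\<close> is a cut point of its open star. Every other point of the
  star has weight on a vertex different from \<open>v\<close>; the two labels give two open sets,
  disjoint there because vertices carrying weight at one point span a simplex with \<open>v\<close>,
  on which \<open>g\<close> agrees.\<close>

lemma link_connected:
  assumes g: "\<And>a b. {v,a,b} \<in> \<sigma> \<Longrightarrow> a \<noteq> v \<Longrightarrow> b \<noteq> v \<Longrightarrow> a \<noteq> b \<Longrightarrow> g a = g b"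
    and u: "{v,u} \<in> \<sigma>" "u \<noteq> v" and w: "{v,w} \<in> \<sigma>" "w \<noteq> v"
  shows "(g :: 'v \<Rightarrow> bool) u = g w"
proof (rule ccontr)
  assume ne: "g u \<noteq> g w"
  have vs: "{v} \<in> \<sigma>" and us: "{u} \<in> \<sigma>" using simplicial(3)[OF u(1)] by auto
  let ?U = "{p \<in> R. 0 < p v}"
  have con: "connected (?U - {point_mass v})"
  proof (rule connected_delete[OF star_connected[OF vs] point_mass_R[OF us]])
    show "point_mass u \<notin> ?U" using u(2) by (auto simp: point_mass_def)
  qed
  define A where "A b = (\<Union>z\<in>{z. z \<noteq> v \<and> g z = b}. {p :: 'v \<Rightarrow> real. 0 < p z})" for b
  have opA: "open (A b)" for b unfolding A_def by (intro open_UN ballI open_coordinate_gt)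
  have "A True \<inter> A False \<inter> (?U - {point_mass v}) = {}"
  proof (rule ccontr)
    assume "\<not> ?thesis"
    then obtain p y z where p: "p \<in> R" "0 < p v" "0 < p y" "0 < p z" "y \<noteq> v" "z \<noteq> v" "g y" "\<not> g z"
      unfolding A_def by auto
    then have "{v,y,z} \<in> \<sigma>" by (intro simplex_coordinates[OF p(1)]) auto
    then show False using g[of y z] p by auto
  qed
  moreover have "?U - {point_mass v} \<subseteq> A True \<union> A False"
  proof
    fix p assume p: "p \<in> ?U - {point_mass v}"
    have "\<exists>z. z \<noteq> v \<and> 0 < p z"
    proof (rule ccontr)
      assume "\<not> ?thesis"
      then have z: "p z = 0" if "z \<noteq> v" for z using realizationD(1)[of p z] p that by force
      have "v \<in> V" using vs by (auto simp: V_def)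
      then have "(\<Sum>z\<in>V. p z) = p v + (\<Sum>z\<in>V - {v}. p z)" using finite_V by (rule sum.remove[rotated])
      then have "p v = 1" using realizationD(3)[of p] p z by simp
      then have "p = point_mass v" using z by (auto simp: point_mass_def fun_eq_iff)
      then show False using p by simp
    qed
    then show "p \<in> A True \<union> A False" unfolding A_def by auto
  qed
  ultimately have "A True \<inter> (?U - {point_mass v}) = {} \<or> A False \<inter> (?U - {point_mass v}) = {}"
    using connectedD[OF con opA opA] by blast
  moreover have "A (g z) \<inter> (?U - {point_mass v}) \<noteq> {}" if z: "{v,z} \<in> \<sigma>" "z \<noteq> v" for z
  proof -
    let ?p = "segment (point_mass v) (point_mass z) (1/2)"
    have "?p \<in> R" using edge_segment_R[OF z(1)] by simp
    moreover have "?p z = 1/2" "?p v = 1/2" using z(2) by (auto simp: segment_def point_mass_def)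
    moreover have "?p \<noteq> point_mass v"
    proof
      assume "?p = point_mass v"
      then have "?p v = point_mass v v" by simp
      then show False using \<open>?p v = 1/2\<close> by (simp add: point_mass_def)
    qed
    ultimately have "?p \<in> A (g z) \<inter> (?U - {point_mass v})" using z(2) unfolding A_def by auto
    then show ?thesis by blast
  qed
  from this[OF u] this[OF w] have "A True \<inter> (?U - {point_mass v}) \<noteq> {} \<and> A False \<inter> (?U - {point_mass v}) \<noteq> {}"
    using ne by (cases "g u"; cases "g w") auto
  ultimately show False by blast
qed

text \<open>Otherwise the points with weight on both \<open>u\<close> and \<open>v\<close> form the
  open edge, which is then open in the realization and has its midpoint as a cut point.\<close>

lemma edge_in_triangle:
  assumes e: "{u,v} \<in> \<sigma>" "u \<noteq> v"
  shows "\<exists>w. {u,v,w} \<in> \<sigma> \<and> w \<noteq> u \<and> w \<noteq> v"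
proof (rule ccontr)
  assume "\<not> ?thesis"
  then have no: "{u,v,w} \<notin> \<sigma>" if "w \<noteq> u" "w \<noteq> v" for w using that by blast
  define U where "U = {p \<in> R. 0 < p u \<and> 0 < p v}"
  define m where "m = segment (point_mass u) (point_mass v)"
  have mR: "m t \<in> R" if "0 \<le> t" "t \<le> 1" for t unfolding m_def using edge_segment_R[OF e(1)] that by simp
  have mv: "m t u = 1 - t" "m t v = t" for t using e(2) by (auto simp: m_def segment_def point_mass_def)
  have Um: "U = m ` {0<..<1}"
  proof (intro equalityI subsetI)
    fix p assume "p \<in> U"
    then have p: "p \<in> R" "0 < p u" "0 < p v" by (auto simp: U_def)
    have z: "p w = 0" if "w \<noteq> u" "w \<noteq> v" for w
    proof (rule ccontr)
      assume "p w \<noteq> 0"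
      then have "{u,v,w} \<in> \<sigma>" using p by (intro simplex_coordinates[OF p(1)]) auto
      then show False using no[OF that] by simp
    qed
    have uv: "{u,v} \<subseteq> V" using e by (auto simp: V_def)
    have "(\<Sum>w\<in>V. p w) = (\<Sum>w\<in>{u,v}. p w)"
      by (rule sum.mono_neutral_right[OF finite_V uv]) (use z in auto)
    then have s: "p u + p v = 1" using realizationD(3)[OF p(1)] e(2) by simp
    then have "p = m (p v)" using z e(2) by (auto simp: m_def segment_def point_mass_def fun_eq_iff)
    then show "p \<in> m ` {0<..<1}" using p s by (intro image_eqI[of _ _ "p v"]) auto
  next
    fix p assume "p \<in> m ` {0<..<1}"
    then show "p \<in> U" using mR mv by (auto simp: U_def)
  qed
  have "U = R \<inter> ({p. 0 < p u} \<inter> {p. 0 < p v})" by (auto simp: U_def)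
  then have oU: "openin (top_of_set R) U" by (auto intro!: openin_open_Int open_Int open_coordinate_gt)
  have cU: "connected U"
    unfolding Um m_def by (intro connected_continuous_image continuous_segment) simp
  have us: "{u} \<in> \<sigma>" using simplicial(3)[OF e(1)] by auto
  have "connected (U - {m (1/2)})"
  proof (rule connected_delete[OF oU cU point_mass_R[OF us]])
    show "point_mass u \<notin> U" using e(2) by (auto simp: U_def point_mass_def)
  qed
  moreover have "{p. p v < 1/2} \<inter> {p. 1/2 < p v} \<inter> (U - {m (1/2)}) = {}" by auto
  moreover have "U - {m (1/2)} \<subseteq> {p. p v < 1/2} \<union> {p. 1/2 < p v}"
  proof
    fix p assume p: "p \<in> U - {m (1/2)}"
    then obtain t where "p = m t" unfolding Um by auto
    then have "p = m (p v)" using mv by simp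
    have "p v \<noteq> 1/2"
    proof
      assume "p v = 1/2"
      with \<open>p = m (p v)\<close> have "p = m (1/2)" by metis
      then show False using p by simp
    qed
    then show "p \<in> {p. p v < 1/2} \<union> {p. 1/2 < p v}" by auto
  qed
  ultimately have "{p. p v < 1/2} \<inter> (U - {m (1/2)}) = {} \<or> {p. 1/2 < p v} \<inter> (U - {m (1/2)}) = {}"
    by (intro connectedD open_coordinate_lt open_coordinate_gt)
  moreover have mne: "m t \<in> U - {m (1/2)}" if "0 < t" "t < 1" "t \<noteq> 1/2" for t
  proof -
    have "m t \<noteq> m (1/2)" using mv(2)[of t] mv(2)[of "1/2"] that(3) by metis
    then show ?thesis using that unfolding Um by auto
  qed
  moreover have "m (1/4) \<in> {p. p v < 1/2}" "m (3/4) \<in> {p. 1/2 < p v}" by (simp_all add: mv)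
  ultimately show False using mne[of "1/4"] mne[of "3/4"] by force
qed

text \<open>Two triangles at the edge \<open>uv\<close> contain an embedded open rectangle around
  the midpoint of the edge. By invariance of domain its image in the chart is open, so it contains
  points arbitrarily near the midpoint on the third triangle. These have positive weight on
  \<open>w3\<close>, contrary to the embedding.\<close>

lemma three_pages:
  assumes w: "{u,v,w1} \<in> \<sigma>" "{u,v,w2} \<in> \<sigma>" "{u,v,w3} \<in> \<sigma>"
    and d: "distinct [u,v,w1,w2,w3]"
  shows False
proof -
  define D where "D = {z :: complex. 0 < Re z \<and> Re z < 1 \<and> -1 < Im z \<and> Im z < 1}"
  have "D = {z. 0 < Re z} \<inter> {z. Re z < 1} \<inter> {z. -1 < Im z} \<inter> {z. Im z < 1}" by (auto simp: D_def)
  then have oD: "open D"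
    by (auto intro!: open_Int open_halfspace_Re_gt open_halfspace_Re_lt open_halfspace_Im_gt open_halfspace_Im_lt)
  \<comment> \<open>The rectangle folded along \<open>uv\<close>: \<open>Re z\<close> is the
    position on the edge, \<open>Im z\<close> the weight of \<open>w1\<close> when positive and of
    \<open>w2\<close> when negative.\<close>
  define F :: "complex \<Rightarrow> 'v \<Rightarrow> real" where "F z = (\<lambda>x.
      if x = u then (1 - \<bar>Im z\<bar>) * Re z else if x = v then (1 - \<bar>Im z\<bar>) * (1 - Re z)
      else if x = w1 then max 0 (Im z) else if x = w2 then max 0 (- Im z) else 0)" for z
  have Fv: "F z u = (1 - \<bar>Im z\<bar>) * Re z" "F z v = (1 - \<bar>Im z\<bar>) * (1 - Re z)"
     "F z w1 = max 0 (Im z)" "F z w2 = max 0 (- Im z)" "F z w3 = 0"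
     "x \<notin> {u,v,w1,w2} \<Longrightarrow> F z x = 0" for z x
    using d by (auto simp: F_def)
  have cF: "continuous_on D F"
  proof (rule continuous_on_coordinatewise_then_product)
    fix x
    consider "x = u" | "x = v" | "x = w1" | "x = w2" | "x \<notin> {u,v,w1,w2}" by auto
    then show "continuous_on D (\<lambda>z. F z x)"
    proof cases
      case 5
      then show ?thesis using Fv(6) by simp
    qed (auto simp only: Fv intro!: continuous_intros)
  qed
  have pos: "0 < F z u" "0 < F z v" if "z \<in> D" for z
    using that by (auto simp: D_def Fv abs_if)
  have FR: "F z \<in> R" if z: "z \<in> D" for z
  proof (cases "0 \<le> Im z")
    case True
    show ?thesis
    proof (rule realizationI[OF w(1)])
      show "0 \<le> F z x" for x
        using pos[OF z] by (cases "x \<in> {u,v,w1,w2}") (auto simp: Fv)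
      show "x \<in> {u,v,w1}" if "F z x \<noteq> 0" for x
        using that True Fv(1-5)[of z] Fv(6)[of x z] by (cases "x \<in> {u,v,w1,w2}") auto
      show "sum (F z) {u,v,w1} = 1" using d True by (simp add: Fv) (simp add: algebra_simps)
    qed
  next
    case False
    show ?thesis
    proof (rule realizationI[OF w(2)])
      show "0 \<le> F z x" for x
        using pos[OF z] by (cases "x \<in> {u,v,w1,w2}") (auto simp: Fv)
      show "x \<in> {u,v,w2}" if "F z x \<noteq> 0" for x
        using that False Fv(1-5)[of z] Fv(6)[of x z] by (cases "x \<in> {u,v,w1,w2}") auto
      show "sum (F z) {u,v,w2} = 1" using d False by (simp add: Fv) (simp add: algebra_simps)
    qed
  qed
  have inj: "inj_on F D"
  proof (rule inj_onI)
    fix z z' assume z: "z \<in> D" "z' \<in> D" "F z = F z'"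
    have "max 0 (Im z) = max 0 (Im z')" "max 0 (- Im z) = max 0 (- Im z')" using Fv z(3) by metis+
    then have im: "Im z = Im z'" by (auto simp: max_def split: if_splits)
    have "(1 - \<bar>Im z\<bar>) * Re z = (1 - \<bar>Im z'\<bar>) * Re z'" using Fv z(3) by metis
    moreover have "1 - \<bar>Im z\<bar> \<noteq> 0" using z(1) by (auto simp: D_def)
    ultimately have "Re z = Re z'" using im by simp
    then show "z = z'" using im by (simp add: complex_eq_iff)
  qed
  define n where "n = point_mass u"
  have us: "{u} \<in> \<sigma>" "{w3} \<in> \<sigma>" using simplicial(3)[OF w(3)] by auto
  have nR: "n \<in> R" unfolding n_def by (rule point_mass_R[OF us(1)])
  have nv: "n v = 0"
  proof -
    have "v \<noteq> u" using d by auto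
    then show ?thesis by (simp add: n_def point_mass_def)
  qed
  obtain f g where fg: "homeomorphism (R - {n}) (UNIV :: complex set) f g" by (rule chart[OF nR])
  have Fn: "F ` D \<subseteq> R - {n}" using FR pos(2) nv by force
  have injf: "inj_on f (R - {n})" using fg by (auto simp: homeomorphism_def intro: inj_on_inverseI)
  have cf: "continuous_on (R - {n}) f" using fg by (simp add: homeomorphism_def)
  have "continuous_on D (f \<circ> F)" by (rule continuous_on_compose[OF cF continuous_on_subset[OF cf Fn]])
  moreover have "inj_on (f \<circ> F) D" using inj inj_on_subset[OF injf Fn] by (rule comp_inj_on)
  ultimately have oW: "open ((f \<circ> F) ` D)" using oD invariance_of_domain by blast
  define z0 where "z0 = Complex (1/2) 0"
  have z0: "z0 \<in> D" by (simp add: z0_def D_def)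
  \<comment> \<open>The path from the midpoint of \<open>uv\<close> into the third triangle; its
    weight on \<open>w3\<close> at time \<open>t\<close> is \<open>t\<close>.\<close>
  define m where "m = segment (F z0) (point_mass w3)"
  have mR: "m t \<in> R - {n}" if t: "0 \<le> t" "t \<le> 1" for t
  proof -
    have "m t \<in> R" unfolding m_def
    proof (rule segment_R[OF w(3) FR[OF z0] point_mass_R[OF us(2)] _ _ t])
      show "x \<in> {u,v,w3}" if "F z0 x \<noteq> 0" for x
        using that Fv(1-5)[of z0] Fv(6)[of x z0] by (cases "x \<in> {u,v,w1,w2}") (auto simp: z0_def)
    qed (auto simp: point_mass_def split: if_splits)
    moreover have "m t \<noteq> n"
    proof
      assume eq: "m t = n"
      have "m t v = (1 - t) * F z0 v" "m t w3 = t" using d by (auto simp: m_def segment_def point_mass_def Fv)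
      moreover have "n w3 = 0" using d by (auto simp: n_def point_mass_def)
      ultimately show False using eq nv pos(2)[OF z0] by auto
    qed
    ultimately show ?thesis by simp
  qed
  have "continuous_on {0..1} (f \<circ> m)"
    unfolding m_def[symmetric]
  proof (rule continuous_on_compose)
    show "continuous_on {0..1} m" unfolding m_def by (rule continuous_segment)
    show "continuous_on (m ` {0..1}) f" by (rule continuous_on_subset[OF cf], rule image_subsetI, rule mR) auto
  qed
  then have "openin (top_of_set {0..1}) ({0..1} \<inter> (f \<circ> m) -` ((f \<circ> F) ` D))"
    using oW by (rule continuous_openin_preimage_gen)
  moreover have "(0::real) \<in> {0..1} \<inter> (f \<circ> m) -` ((f \<circ> F) ` D)"
    using z0 by (auto simp: m_def segment_def)
  ultimately obtain e where e: "0 < e" "ball 0 e \<inter> {0..1} \<subseteq> {0..1} \<inter> (f \<circ> m) -` ((f \<circ> F) ` D)"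
    unfolding openin_contains_ball by blast
  define t where "t = min 1 (e/2)"
  have t: "0 < t" "t \<le> 1" "t < e" using e(1) by (auto simp: t_def)
  then have "t \<in> ball 0 e \<inter> {0..1}" by (simp add: dist_real_def)
  then have "t \<in> {0..1} \<inter> (f \<circ> m) -` ((f \<circ> F) ` D)" by (rule subsetD[OF e(2)])
  then have "f (m t) \<in> (f \<circ> F) ` D" by (simp only: Int_iff vimage_eq o_apply)
  then obtain z where z: "z \<in> D" "f (m t) = f (F z)" by auto
  then have "m t = F z" using injf mR[of t] t Fn by (intro inj_onD[of f "R - {n}"]) auto
  moreover have "m t w3 = t" using d by (simp add: m_def segment_def point_mass_def Fv)
  ultimately show False using t Fv(5)[of z] by simp
qed

section \<open>Vanishing of the first cohomology\<close>

text \<open>An integral cocycle defines a map to the circle that winds \<open>\<phi> u v\<close>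
  times along each edge. The sphere is Borsukian, so the map lifts to a real function, whose
  differences along edges are the values of the cocycle.\<close>

lemma cocycle_potential:
  fixes \<phi> :: "'v \<Rightarrow> 'v \<Rightarrow> int"
  assumes anti: "\<And>u v. \<phi> v u = - \<phi> u v"
    and co: "\<And>u v w. {u,v,w} \<in> \<sigma> \<Longrightarrow> distinct [u,v,w] \<Longrightarrow> \<phi> u v + \<phi> v w + \<phi> w u = 0"
  shows "\<exists>h :: 'v \<Rightarrow> int. \<forall>u v. {u,v} \<in> \<sigma> \<longrightarrow> \<phi> u v = h v - h u"
proof -
  have z: "\<phi> u u = 0" for u using anti[of u u] by simp
  have co': "\<phi> u v = \<phi> u w + \<phi> w v" if "{u,v,w} \<in> \<sigma>" for u v w
  proof (cases "distinct [u,v,w]")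
    case True
    then show ?thesis using co[OF that] anti[of v w] anti[of u w] by simp
  next
    case False
    then show ?thesis using z anti[of u v] anti[of u w] anti[of v w] by auto
  qed
  define E where "E u p = (\<Sum>v\<in>V. p v * of_int (\<phi> u v))" for u and p :: "'v \<Rightarrow> real"
  \<comment> \<open>\<open>E u p\<close> is the angle seen from \<open>u\<close>. For two base
    vertices with nonzero weight it differs by an integer, by the cocycle relation, so the weighted
    mean of the circle values is their common value. Taking the mean makes continuity evident across
    simplices.\<close>
  define G where "G p = (\<Sum>u\<in>V. of_real (p u) * cis (2 * pi * E u p))" for p
  have G_eq: "G p = cis (2 * pi * E u p)" if p: "p \<in> R" "p u \<noteq> 0" for p u
  proof -
    have eq: "cis (2 * pi * E u' p) = cis (2 * pi * E u p)" if u': "p u' \<noteq> 0" for u'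
    proof -
      have "E u' p = (\<Sum>v\<in>V. p v * (of_int (\<phi> u' u) + of_int (\<phi> u v)))"
        unfolding E_def
      proof (rule sum.cong[OF refl])
        fix v
        show "p v * of_int (\<phi> u' v) = p v * (of_int (\<phi> u' u) + of_int (\<phi> u v))"
        proof (cases "p v = 0")
          case False
          then have "{u',v,u} \<in> \<sigma>" using p u' by (intro simplex_coordinates[OF p(1)]) auto
          then show ?thesis using co' by simp
        qed simp
      qed
      also have "\<dots> = of_int (\<phi> u' u) + E u p"
        using realizationD(3)[OF p(1)]
        by (simp add: E_def distrib_left sum.distrib sum_distrib_right[symmetric])
      finally have "2 * pi * E u' p = 2 * pi * of_int (\<phi> u' u) + 2 * pi * E u p" by (simp add: distrib_left)
      then show ?thesis by (simp add: cis_mult[symmetric] cis_multiple_2pi)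
    qed
    have "G p = (\<Sum>u'\<in>V. of_real (p u') * cis (2 * pi * E u p))"
      unfolding G_def using eq by (intro sum.cong) (metis mult_zero_left of_real_0)+
    also have "\<dots> = of_real (\<Sum>u'\<in>V. p u') * cis (2 * pi * E u p)"
      by (simp add: sum_distrib_right)
    finally show ?thesis using realizationD(3)[OF p(1)] by simp
  qed
  have nz: "\<exists>u. p u \<noteq> 0" if "p \<in> R" for p
  proof (rule ccontr)
    assume "\<not> ?thesis"
    then show False using realizationD(3)[OF that] by simp
  qed
  have cG: "continuous_on R G"
    unfolding G_def E_def
    by (intro continuous_intros continuous_on_cis continuous_on_subset[OF continuous_on_product_coordinates]) auto
  obtain f k where fk: "homeomorphism R (sphere (0 :: real ^ 3) 1) f k"
    using tri by (auto simp: simplicial_triangulation_def R_def homeomorphic_def)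
  let ?S = "sphere (0 :: real ^ 3) 1"
  have kR: "k ` ?S = R" and ck: "continuous_on ?S k" and cf: "continuous_on R f"
    and kf: "\<And>p. p \<in> R \<Longrightarrow> k (f p) = p" and fS: "f ` R = ?S"
    using fk by (auto simp: homeomorphism_def)
  have "Borsukian ?S" by (rule Borsukian_sphere) simp
  moreover have "continuous_on ?S (G \<circ> k)"
    by (rule continuous_on_compose[OF ck]) (simp add: kR cG)
  moreover have "G \<circ> k \<in> ?S \<rightarrow> sphere 0 1"
  proof
    fix x assume "x \<in> ?S"
    then have "k x \<in> R" using kR by blast
    then show "(G \<circ> k) x \<in> sphere 0 1" using nz[of "k x"] G_eq[of "k x"] by auto
  qed
  ultimately obtain l where l: "continuous_on ?S (complex_of_real \<circ> l)"
      "\<And>x. x \<in> ?S \<Longrightarrow> (G \<circ> k) x = exp (\<i> * complex_of_real (l x))"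
    unfolding Borsukian_continuous_logarithm_circle_real by blast
  define H where "H p = l (f p) / (2 * pi)" for p
  have GH: "G p = cis (2 * pi * H p)" if "p \<in> R" for p
  proof -
    have "f p \<in> ?S" using fS that by blast
    then show ?thesis using l(2)[of "f p"] kf[OF that] by (simp add: H_def cis_conv_exp)
  qed
  have cH: "continuous_on R H"
  proof -
    have "continuous_on ?S l"
      using continuous_on_Re[OF l(1)] by (simp add: o_def)
    then have "continuous_on R (\<lambda>p. l (f p))"
      using continuous_on_compose2[OF _ cf, of ?S l] fS by blast
    then show ?thesis unfolding H_def by (intro continuous_intros) auto
  qed
  have real: "of_int (\<phi> u v) = H (point_mass v) - H (point_mass u)" if e: "{u,v} \<in> \<sigma>" for u v
  proof (cases "u = v")
    case False
    let ?p = "segment (point_mass u) (point_mass v)"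
    have pR: "?p t \<in> R" if "t \<in> {0..1}" for t using edge_segment_R[OF e] that by simp
    have uv: "u \<in> V" "v \<in> V" using e by (auto simp: V_def)
    have Eu: "E u (?p t) = t * of_int (\<phi> u v)" for t
    proof -
      have "E u (?p t) = (\<Sum>x\<in>V. if x = v then t * of_int (\<phi> u v) else 0)"
        unfolding E_def using z[of u] by (intro sum.cong) (auto simp: segment_def point_mass_def)
      then show ?thesis using finite_V uv by simp
    qed
    have Gp: "G (?p t) = cis (2 * pi * (t * of_int (\<phi> u v)))" if t: "t \<in> {0..1}" for t
    proof (cases "t = 1")
      case False
      then show ?thesis using G_eq[OF pR[OF t], of u] Eu \<open>u \<noteq> v\<close> by (simp add: segment_def point_mass_def)
    next
      \<comment> \<open>At the far end \<open>u\<close> has weight 0, so the angle must be taken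
        from \<open>v\<close>; the results agree because \<open>\<phi> u v\<close> is an
        integer.\<close>
      case True
      have "E v (?p t) = (\<Sum>x\<in>V. 0)"
        unfolding E_def using z[of v] True by (intro sum.cong) (auto simp: segment_def point_mass_def)
      then have "E v (?p t) = 0" by simp
      then have "G (?p t) = 1" using G_eq[OF pR[OF t], of v] True by (simp add: segment_def point_mass_def)
      then show ?thesis using True by (simp add: cis_multiple_2pi)
    qed
    \<comment> \<open>The lift minus the expected linear angle: continuous and integer-valued on the
      edge, hence constant.\<close>
    define d where "d t = H (?p t) - t * of_int (\<phi> u v)" for t
    have dint: "d t \<in> \<int>" if t: "t \<in> {0..1}" for t
    proof -
      have "cis (2 * pi * d t) = cis (2 * pi * H (?p t)) / cis (2 * pi * (t * of_int (\<phi> u v)))"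
        by (simp add: d_def cis_divide right_diff_distrib)
      then have "cis (2 * pi * d t) = 1" using GH[OF pR[OF t]] Gp[OF t] by simp
      then have "cos (2 * pi * d t) = 1" by (simp add: cis.ctr complex_eq_iff)
      then obtain j :: int where "2 * pi * d t = of_int j * 2 * pi" using cos_one_2pi_int by auto
      then have "d t = of_int j" by simp
      then show ?thesis by simp
    qed
    have "continuous_on {0..1} (\<lambda>t. H (?p t))"
      by (rule continuous_on_compose2[OF cH continuous_segment]) (use pR in auto)
    then have cd: "continuous_on {0..1} d"
      unfolding d_def by (intro continuous_intros)
    have "d constant_on {0..1}"
    proof (rule continuous_discrete_range_constant[OF _ cd])
      show "connected {0..1::real}" by simp
      show "\<exists>e>0. \<forall>y. y \<in> {0..1} \<and> d y \<noteq> d x \<longrightarrow> e \<le> norm (d y - d x)" if "x \<in> {0..1}" for x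
      proof (intro exI[of _ 1] conjI allI impI)
        fix y assume y: "y \<in> {0..1} \<and> d y \<noteq> d x"
        then have "d y - d x \<in> \<int>" "d y - d x \<noteq> 0" using dint that by auto
        then show "1 \<le> norm (d y - d x)" using Ints_nonzero_abs_ge1[of "d y - d x"] by simp
      qed simp
    qed
    then have "d 0 = d 1" unfolding constant_on_def by auto
    then show ?thesis by (simp add: d_def segment_def)
  qed (simp add: z)
  \<comment> \<open>Rounding down makes the potential integral without changing its integral
    differences along edges.\<close>
  have "\<phi> u v = \<lfloor>H (point_mass v)\<rfloor> - \<lfloor>H (point_mass u)\<rfloor>" if "{u,v} \<in> \<sigma>" for u v
  proof -
    have "H (point_mass v) = H (point_mass u) + of_int (\<phi> u v)" using real[OF that] by simp
    then show ?thesis by simp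
  qed
  then show ?thesis by (intro exI[of _ "\<lambda>v. \<lfloor>H (point_mass v)\<rfloor>"]) blast
qed

text \<open>Without edges the realization would be a finite set of vertices. A finite connected
  sphere has at most one point, but it contains a unit vector and its negative.\<close>

lemma edge_exists:
  "\<exists>u v. {u,v} \<in> \<sigma> \<and> u \<noteq> v"
proof (rule ccontr)
  assume "\<not> ?thesis"
  then have no: "{u,v} \<notin> \<sigma>" if "u \<noteq> v" for u v using that by blast
  have "R \<subseteq> point_mass ` V"
  proof
    fix p assume p: "p \<in> R"
    obtain v where v: "p v \<noteq> 0" "v \<in> V"
      using realizationD(3)[OF p] by (metis sum.neutral zero_neq_one)
    have z: "p w = 0" if "w \<noteq> v" for w
    proof (rule ccontr)
      assume "p w \<noteq> 0"
      then have "{v,w} \<in> \<sigma>" using v by (intro simplex_coordinates[OF p]) auto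
      then show False using no[of v w] that by simp
    qed
    have "(\<Sum>w\<in>V. p w) = p v + (\<Sum>w\<in>V - {v}. p w)" using finite_V v(2) by (rule sum.remove)
    then have "p v = 1" using realizationD(3)[OF p] z by simp
    then have "p = point_mass v" using z by (auto simp: point_mass_def fun_eq_iff)
    then show "p \<in> point_mass ` V" using v(2) by blast
  qed
  then have "finite R" using finite_V finite_subset by blast
  moreover obtain f k where "homeomorphism R (sphere (0 :: real ^ 3) 1) f k"
    using tri by (auto simp: simplicial_triangulation_def R_def homeomorphic_def)
  ultimately have "finite (sphere (0 :: real ^ 3) 1)" by (metis finite_imageI homeomorphism_def)
  moreover have "connected (sphere (0 :: real ^ 3) 1)" by (rule connected_sphere) simp
  ultimately obtain a where "sphere (0 :: real ^ 3) 1 \<subseteq> {a}"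
    using connected_finite_iff_sing by (metis empty_subsetI subset_refl)
  moreover obtain x :: "real ^ 3" where "norm x = 1" using vector_choose_size[of 1] by auto
  moreover then have "x \<in> sphere 0 1" "- x \<in> sphere 0 1" by simp_all
  ultimately have "x = a" "- x = a" by blast+
  then have "x \<bullet> x = x \<bullet> (- x)" by metis
  then show False using \<open>norm x = 1\<close> by (simp add: norm_eq_1)
qed

end

section \<open>From topological to homological spheres\<close>

text \<open>For \<open>uniq\<close>, two positive triangles on one oriented edge would have to be
  balanced in the boundary by a negative one, giving three distinct pages at the edge. The link and
  cohomology axioms are the corresponding topological facts, read on the faces of
  \<open>X\<close>.\<close>

lemma triangulated_sphere_cycle:
  assumes tri: "simplicial_triangulation \<sigma> (sphere (0 :: real ^ 3) 1)"
    and fin: "finite \<Omega>" and sub: "\<Union>\<sigma> \<subseteq> \<Omega>" and X: "associated_cycle \<Omega> \<sigma> X"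
  shows "sphere_cycle \<Omega> X" "X \<noteq> (\<lambda>_. 0)"
proof -
  interpret triangulated_sphere \<sigma> by unfold_locales (rule tri)
  have Xc: "X \<in> chains \<Omega> 2" and cyc: "boundary \<Omega> X = (\<lambda>_. 0)"
    and Xabs: "\<And>xs. distinct xs \<Longrightarrow> length xs = 3 \<Longrightarrow> \<bar>X xs\<bar> = (if set xs \<in> \<sigma> then 1 else 0)"
    using X by (auto simp: associated_cycle_def)
  have nzD: "distinct [u,v,w]" "{u,v,w} \<in> \<sigma>" if "X [u,v,w] \<noteq> 0" for u v w
    using chains_supp(2)[OF Xc that] Xabs[of "[u,v,w]"] that by (auto split: if_splits)
  have nzI: "X [u,v,w] \<noteq> 0" if "{u,v,w} \<in> \<sigma>" "distinct [u,v,w]" for u v w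
    using Xabs[of "[u,v,w]"] that by auto
  have edge: "{u,v} \<in> \<sigma>" if "X [u,v,w] \<noteq> 0" for u v w
    using simplicial(3)[OF nzD(2)[OF that]] by auto
  have le1: "\<bar>X xs\<bar> \<le> 1" for xs
  proof (cases "X xs = 0")
    case False
    then show ?thesis using chains_supp(1,2)[OF Xc False] Xabs[of xs] by simp
  qed simp
  show "sphere_cycle \<Omega> X"
  proof
    fix u v w w' assume w: "X [u,v,w] = 1" "X [u,v,w'] = 1"
    show "w = w'"
    proof (rule ccontr)
      assume ne: "w \<noteq> w'"
      have rot: "X [t,u,v] = X [u,v,t]" for t by (rule chains2_swap(5)[OF Xc])
      have "\<exists>q\<in>\<Omega>. X [u,v,q] < 0"
      proof (rule ccontr)
        assume "\<not> ?thesis"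
        then have nn: "\<forall>q\<in>\<Omega>. 0 \<le> X [q,u,v]" using rot by (metis not_less)
        have "(\<Sum>q\<in>\<Omega>. X [q,u,v]) = 0" using cyc by (auto simp: boundary_def fun_eq_iff)
        then have "\<forall>q\<in>\<Omega>. X [q,u,v] = 0" using nn fin by (simp add: sum_nonneg_eq_0_iff)
        moreover have "w \<in> \<Omega>" using chains_supp(3)[OF Xc, of "[u,v,w]"] w by simp
        ultimately show False using rot w(1) by auto
      qed
      then obtain q where q: "X [u,v,q] < 0" by blast
      then have nz: "X [u,v,w] \<noteq> 0" "X [u,v,w'] \<noteq> 0" "X [u,v,q] \<noteq> 0" using w by auto
      have "distinct [u,v,w,w',q]" using nzD(1)[OF nz(1)] nzD(1)[OF nz(2)] nzD(1)[OF nz(3)] ne w q by auto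
      then show False by (rule three_pages[OF nzD(2)[OF nz(1)] nzD(2)[OF nz(2)] nzD(2)[OF nz(3)]])
    qed
  next
    fix v u u' w w' and g :: "'a \<Rightarrow> bool"
    assume g: "\<And>a b. X [v,a,b] \<noteq> 0 \<Longrightarrow> g a = g b" and nz: "X [v,u,u'] \<noteq> 0" "X [v,w,w'] \<noteq> 0"
    show "g u = g w"
    proof (rule link_connected[OF _ edge[OF nz(1)] _ edge[OF nz(2)]])
      show "g a = g b" if "{v,a,b} \<in> \<sigma>" "a \<noteq> v" "b \<noteq> v" "a \<noteq> b" for a b
        using that by (intro g nzI) auto
    qed (use nzD(1)[OF nz(1)] nzD(1)[OF nz(2)] in auto)
  next
    fix \<phi> :: "'a \<Rightarrow> 'a \<Rightarrow> int"
    assume anti: "\<And>u v. \<phi> v u = - \<phi> u v"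
      and co: "\<And>u v w. X [u,v,w] \<noteq> 0 \<Longrightarrow> \<phi> u v + \<phi> v w + \<phi> w u = 0"
    have "\<exists>h :: 'a \<Rightarrow> int. \<forall>u v. {u,v} \<in> \<sigma> \<longrightarrow> \<phi> u v = h v - h u"
      by (rule cocycle_potential[OF anti]) (rule co[OF nzI])
    then show "\<exists>h :: 'a \<Rightarrow> int. \<forall>u v w. X [u,v,w] \<noteq> 0 \<longrightarrow> \<phi> u v = h v - h u" using edge by blast
  qed (fact fin Xc cyc le1)+
  obtain u v where "{u,v} \<in> \<sigma>" "u \<noteq> v" using edge_exists by blast
  then obtain w where "{u,v,w} \<in> \<sigma>" "w \<noteq> u" "w \<noteq> v" using edge_in_triangle by blast
  then have "X [u,v,w] \<noteq> 0" using \<open>u \<noteq> v\<close> by (intro nzI) auto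
  then show "X \<noteq> (\<lambda>_. 0)" by auto
qed

lemma taut_filling_taut:
  assumes "finite \<Omega>" "taut_filling \<Omega> X M"
  shows "taut \<Omega> M" "boundary \<Omega> M = X"
proof -
  have M: "M \<in> chains \<Omega> 3" and bM: "boundary \<Omega> M = X"
    using assms(2) by (auto simp: taut_filling_def filling_def)
  have mass: "mass \<Omega> N = 24 * l1_norm \<Omega> 3 N" if "N \<in> chains \<Omega> 3" for N
    using l1_norm_tuples[OF assms(1) that] by (simp add: mass_def fact_numeral)
  show "taut \<Omega> M"
    unfolding taut_def
  proof (intro conjI ballI impI)
    fix N assume "N \<in> chains \<Omega> 3" "boundary \<Omega> N = boundary \<Omega> M"
    then show "mass \<Omega> M \<le> mass \<Omega> N"
      using assms(2) bM mass M by (auto simp: taut_filling_def filling_def)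
  qed (rule M)
  show "boundary \<Omega> M = X" by (rule bM)
qed

theorem theorem4:
  fixes \<sigma> :: "'v set set" and \<Omega> :: "'v set" and X M :: "'v list \<Rightarrow> int"
  assumes "simplicial_triangulation \<sigma> (sphere (0 :: real ^ 3) 1)"
    and "finite \<Omega>" and "\<Union>\<sigma> \<subseteq> \<Omega>"
    and "associated_cycle \<Omega> \<sigma> X"
    and "taut_filling \<Omega> X M"
  shows "flag_complex (support_complex M)"
proof -
  note X = triangulated_sphere_cycle[OF assms(1-4)]
  note M = taut_filling_taut[OF assms(2,5)]
  have Mc: "M \<in> chains \<Omega> 3" using M(1) by (simp add: taut_def)
  have flag: "flagged M" by (rule taut_flagged[OF X(1) M])
  have K: "s \<in> support_complex M \<longleftrightarrow> spans M s" for s by (simp add: support_complex_def spans_def)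
  \<comment> \<open>The empty set is a simplex of the complex only because the filling is not zero;
    this is where the second part of \<open>X\<close> enters.\<close>
  obtain xs where "X xs \<noteq> 0" using X(2) by auto
  then have "spans M (set xs)" using M(2) by (intro spans_boundary[of \<Omega>]) simp
  then have empty: "spans M {}" by (rule spans_mono) simp
  have "support_complex M \<subseteq> Pow \<Omega>"
    using chains_supp(3)[OF Mc] by (auto simp: support_complex_def)
  then have "finite (support_complex M)" using assms(2) finite_subset by blast
  then have "abstract_simplicial_complex (support_complex M)"
    unfolding abstract_simplicial_complex_def
    by (auto simp: support_complex_def intro: finite_subset)
  moreover have "s \<in> support_complex M"
    if s: "s \<subseteq> \<Union>(support_complex M)" "\<forall>u\<in>s. \<forall>v\<in>s. u \<noteq> v \<longrightarrow> {u,v} \<in> support_complex M" for s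
  proof (cases "s = {}")
    case False
    have "spans M {u,v}" if uv: "u \<in> s" "v \<in> s" for u v
    proof (cases "u = v")
      case True
      obtain t where t: "u \<in> t" "spans M t" using s(1) uv(1) K by blast
      have "{u,v} \<subseteq> t" using t(1) True by simp
      with t(2) show ?thesis by (rule spans_mono)
    next
      case False
      then show ?thesis using s(2) uv K by simp
    qed
    then have "\<forall>u\<in>s. \<forall>v\<in>s. spans M {u,v}" by simp
    then have "spans M s" using flag[unfolded flagged_def, THEN spec, THEN mp, OF False] by (rule mp[rotated])
    then show ?thesis by (simp add: K)
  qed (simp add: K empty)
  ultimately show ?thesis unfolding flag_complex_def by simp
qed

end
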